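(* Suppose that $f(\mathbf 0,i)=\mathbf 0$ and $g(\mathbf 0,i)=\mathbf 0$ for all $i\in\mathbb S$, and that for some $\rho>0$ there exist a symmetric positive-definite matrix $Q\in\mathbb R^{n\times n}$ and constants $\beta_i\in\mathbb R$, $i\in\mathbb S$, such that $$(x^TQx)\psi(x,i)-(2-\rho)|x^TQg(x,i)|^2\le\beta_i(x^TQx)^2,\qquad\forall x\in\mathbb R^n,\ i\in\mathbb S,$$ where $\psi(x,i):=2x^TQf(x,i)+\mathrm{trace}(g^T(x,i)Qg(x,i))$. Let $\beta=(\beta_1,\dots,\beta_m)^T$ and suppose $\pi\beta:=\sum_i\pi_i\beta_i<0$. Then for any $p\in(0,p^*_\beta)\cap(0,\rho]$ and any $\varrho\in(0,\eta_{p,\beta})$ there is a constant $\Delta^{**}\in(0,1]$ such that for all $\Delta\in(0,\Delta^{**}]$ the truncated Euler–Maruyama scheme satisfies $$\limsup_{k\to\infty}\frac{\log(\mathbb E|Z_k^{x_0,\ell}|^p)}{k\Delta}\le-(\eta_{p,\beta}-\varrho)<0,$$ and $$\limsup_{k\to\infty}\frac{\log(|Z_k^{x_0,\ell}|)}{k\Delta}\le-\frac{\eta_{p,\beta}-\varrho}{p}\quad\text{a.s.}$$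
   Context: Notation: $|\cdot|$ is the Euclidean norm on $\mathbb R^n$ and the trace norm $|A|=\sqrt{\mathrm{trace}(A^TA)}$ on matrices; $a\vee b=\max\{a,b\}$, $a\wedge b=\min\{a,b\}$; for a family $(c_i)_{i\in\mathbb S}$, $\check c=\max_i c_i$; $\mathbb R_+=[0,\infty)$; $\log0=-\infty$. System: $(\Omega,\mathcal F,\mathbb P)$ is a complete probability space with a filtration $\{\mathcal F_t\}_{t\ge0}$ satisfying the usual conditions; $B(t)$ is a $d$-dimensional Brownian motion and $r(t)$ is a right-continuous Markov chain with finite state space $\mathbb S=\{1,\dots,m\}$ and generator $\Gamma=(\gamma_{ij})_{m\times m}$ ($\gamma_{ij}\ge0$ for $i\ne j$, $\gamma_{ii}=-\sum_{j\ne i}\gamma_{ij}$), independent of $B$; both are adapted to (and are a Brownian motion, resp. a Markov chain, relative to) $\{\mathcal F_t\}$. The chain is irreducible, i.e. $\pi\Gamma=0$, $\sum_i\pi_i=1$ has a unique solution $\pi=(\pi_1,\dots,\pi_m)$, with all $\pi_i>0$. The switching diffusion system is $dX(t)=f(X(t),r(t))dt+g(X(t),r(t))dB(t)$, $(X(0),r(0))=(x_0,\ell)$, where $f:\mathbb R^n\times\mathbb S\to\mathbb R^n$, $g:\mathbb R^n\times\mathbb S\to\mathbb R^{n\times d}$ are locally Lipschitz in $x$ for each $i$. The quantities $\eta_{p,u},p^*_u$: for $u=(u_1,\dots,u_m)^T$ with $\pi u<0$ and $p>0$ let $\Gamma_{p,u}=\Gamma+\frac p2\mathrm{diag}(u_1,\dots,u_m)$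 and $\eta_{p,u}=-\max_{\nu\in\mathrm{spec}(\Gamma_{p,u})}\mathrm{Re}(\nu)$. If $\check u\le0$, $p^*_u=+\infty$; if $\check u>0$, $p^*_u$ is a number in $(0,\min_{i:u_i>0}\{-2\gamma_{ii}/u_i\})$ such that $\eta_{p,u}>0$ for all $p\in(0,p^*_u)$ (such a number exists; and $\eta_{p,u}>0$ for all $p>0$ in the first case). Truncated Euler–Maruyama scheme: for each $i\in\mathbb S$ choose a strictly increasing continuous $\bar\varphi_i:\mathbb R_+\to\mathbb R_+$ with $\bar\varphi_i(u)\to\infty$ as $u\to\infty$ and $\sup_{|x|\vee|y|\le u,\,x\ne y}\big(\frac{|f(x,i)-f(y,i)|}{|x-y|}\vee\frac{|g(x,i)-g(y,i)|^2}{|x-y|^2}\big)\le\bar\varphi_i(u)$ for all $u\ge1$; $\bar\varphi_i^{-1}:[\bar\varphi_i(1),\infty)\to\mathbb R_+$ is its inverse. (If for a state $i$, $|f(x,i)-f(y,i)|\le C|x-y|$ and $|g(x,i)-g(y,i)|^2\le C|x-y|^2$ for all $x,y$, one may instead take $\bar\varphi_i\equiv C$, $\bar\varphi_i^{-1}\equiv+\infty$ on $[C,\infty)$.) Choose a strictly decreasing $\bar h:(0,1]\to[\check{\bar\varphi}(|x_0|\vee1),\infty)$ with $\bar h(1)\ge\max_{i}\{|f(\mathbf 0,i)|\vee|g(\mathbf 0,i)|^2\}$, $\lim_{\Delta\to0}\bar h(\Delta)=\infty$ and $\Delta^{1/2-\bar\theta}\bar h(\Delta)\le K$ for all $\Delta\in(0,1]$,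 for some $0<\bar\theta<\frac12$ and a constant $K>0$. Set $\bar\pi^i_\Delta(x)=(|x|\wedge\bar\varphi_i^{-1}(\bar h(\Delta)))\frac{x}{|x|}$, with $\frac{x}{|x|}=\mathbf 0$ if $x=\mathbf 0$. With $t_k=k\Delta$, $r_k=r(t_k)$, $\Delta B_k=B(t_{k+1})-B(t_k)$, define $\tilde Z_0=x_0$, $r_0=\ell$, and for $k\ge0$: $Z_k=\bar\pi_\Delta^{r_k}(\tilde Z_k)$, $\tilde Z_{k+1}=Z_k+f(Z_k,r_k)\Delta+g(Z_k,r_k)\Delta B_k$. $Z_k^{x_0,\ell}$ denotes $Z_k$ with the initial data highlighted. *)

theory Defs
  imports "HOL-Probability.Probability"
begin

section \<open>Filtered probability spaces, Brownian motion and Markov chains\<close>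

text \<open>
  Time is \<open>[0, \<infinity>)\<close>, modelled by guarded reals: \<^term>\<open>F t\<close> is irrelevant for \<open>t < 0\<close>.
\<close>

locale usual_filtered_prob_space = prob_space M + complete_measure M
  for M :: "'a measure" +
  fixes F :: "real \<Rightarrow> 'a measure"
  assumes subalgebra_F: "0 \<le> t \<Longrightarrow> subalgebra M (F t)"
    and F_mono: "0 \<le> s \<Longrightarrow> s \<le> t \<Longrightarrow> sets (F s) \<subseteq> sets (F t)"
    and F_right_continuous: "0 \<le> t \<Longrightarrow> sets (F t) = (\<Inter>s\<in>{t<..}. sets (F s))"
    and F_null_sets: "null_sets M \<subseteq> sets (F 0)"
begin

text \<open>
  As usual for stochastic processes, path properties are required for almost every sample point.
  The increment over \<open>[s, t]\<close> is \<open>N(0, (t - s) I)\<close>: independent coordinates, each normal with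
  standard deviation \<open>sqrt (t - s)\<close>.
\<close>

definition brownian_motion :: "(real \<Rightarrow> 'a \<Rightarrow> real^'d) \<Rightarrow> bool" where
  "brownian_motion B \<longleftrightarrow>
     (\<forall>t\<ge>0. B t \<in> borel_measurable (F t)) \<and>
     (AE \<omega> in M. B 0 \<omega> = 0) \<and>
     (AE \<omega> in M. continuous_on {0..} (\<lambda>t. B t \<omega>)) \<and>
     (\<forall>s t. 0 \<le> s \<and> s < t \<longrightarrow>
        indep_set (sets (F s)) (sets (vimage_algebra (space M) (\<lambda>\<omega>. B t \<omega> - B s \<omega>) borel)) \<and>
        indep_vars (\<lambda>_. borel) (\<lambda>k \<omega>. (B t \<omega> - B s \<omega>) $ k) UNIV \<and>
        (\<forall>k. distributed M lborel (\<lambda>\<omega>. (B t \<omega> - B s \<omega>) $ k) (normal_density 0 (sqrt (t - s)))))"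

end

definition is_generator :: "real^'s^'s \<Rightarrow> bool" where
  "is_generator \<Gamma> \<longleftrightarrow>
     (\<forall>i j. i \<noteq> j \<longrightarrow> 0 \<le> \<Gamma> $ i $ j) \<and> (\<forall>i. \<Gamma> $ i $ i = - (\<Sum>j\<in>UNIV - {i}. \<Gamma> $ i $ j))"

text \<open>
  The derivative at \<open>0\<close> says \<open>P\<^sub>i\<^sub>j(t) = \<gamma>\<^sub>i\<^sub>j t + o(t)\<close> for \<open>i \<noteq> j\<close> and
  \<open>P\<^sub>i\<^sub>i(t) = 1 + \<gamma>\<^sub>i\<^sub>i t + o(t)\<close>.
\<close>

definition transition_semigroup :: "real^'s^'s \<Rightarrow> (real \<Rightarrow> real^'s^'s) \<Rightarrow> bool" where
  "transition_semigroup \<Gamma> P \<longleftrightarrow>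
     P 0 = mat 1 \<and>
     (\<forall>s\<ge>0. \<forall>t\<ge>0. P (s + t) = P s ** P t) \<and>
     (\<forall>t\<ge>0. \<forall>i. (\<forall>j. 0 \<le> P t $ i $ j) \<and> (\<Sum>j\<in>UNIV. P t $ i $ j) = 1) \<and>
     (P has_vector_derivative \<Gamma>) (at 0 within {0..})"

context usual_filtered_prob_space
begin

text \<open>The state space \<open>{1, \<dots>, m}\<close> is an arbitrary finite type \<^typ>\<open>'s\<close>, discretely topologised.\<close>

definition markov_chain :: "real^'s^'s \<Rightarrow> (real \<Rightarrow> 'a \<Rightarrow> 's) \<Rightarrow> bool" where
  "markov_chain \<Gamma> r \<longleftrightarrow>
     is_generator \<Gamma> \<and>
     (\<forall>t\<ge>0. r t \<in> measurable (F t) (count_space UNIV)) \<and>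
     (AE \<omega> in M. \<forall>t\<ge>0. eventually (\<lambda>s. r s \<omega> = r t \<omega>) (at_right t)) \<and>
     (\<exists>P. transition_semigroup \<Gamma> P \<and>
        (\<forall>s\<ge>0. \<forall>t\<ge>0. \<forall>j. AE \<omega> in M.
           real_cond_exp M (F s) (indicator {\<omega> \<in> space M. r (s + t) \<omega> = j}) \<omega>
             = P t $ (r s \<omega>) $ j))"

definition indep_processes :: "(real \<Rightarrow> 'a \<Rightarrow> real^'d) \<Rightarrow> (real \<Rightarrow> 'a \<Rightarrow> 's) \<Rightarrow> bool" where
  "indep_processes B r \<longleftrightarrow>
     indep_set
       (sets (vimage_algebra (space M) (\<lambda>\<omega>. \<lambda>t\<in>{0..}. B t \<omega>) (PiM {0..} (\<lambda>_. borel))))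
       (sets (vimage_algebra (space M) (\<lambda>\<omega>. \<lambda>t\<in>{0..}. r t \<omega>)
          (PiM {0..} (\<lambda>_. count_space UNIV))))"

end

definition irreducible_with_stationary :: "real^'s^'s \<Rightarrow> real^'s \<Rightarrow> bool" where
  "irreducible_with_stationary \<Gamma> \<pi> \<longleftrightarrow>
     (\<forall>\<mu>. \<mu> v* \<Gamma> = 0 \<and> (\<Sum>i\<in>UNIV. \<mu> $ i) = 1 \<longleftrightarrow> \<mu> = \<pi>) \<and> (\<forall>i. 0 < \<pi> $ i)"


section \<open>The exponents \<open>\<eta>\<close> and \<open>p\<^sup>*\<close>\<close>

definition spectrum :: "real^'s^'s \<Rightarrow> complex set" where
  "spectrum A = {\<nu>. \<exists>v :: complex^'s. v \<noteq> 0 \<and> (\<chi> i j. complex_of_real (A $ i $ j)) *v v = \<nu> *s v}"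

definition diag :: "real^'s \<Rightarrow> real^'s^'s" where
  "diag u = (\<chi> i j. if i = j then u $ i else 0)"

definition eta :: "real^'s^'s \<Rightarrow> real \<Rightarrow> real^'s \<Rightarrow> real" where
  "eta \<Gamma> p u = - Max (Re ` spectrum (\<Gamma> + (p / 2) *\<^sub>R diag u))"

text \<open>
  \<open>p\<^sup>*\<close> is not determined by \<open>\<Gamma>\<close> and \<open>u\<close>: any number with the following property may be chosen.
\<close>

definition is_pstar :: "real^'s^'s \<Rightarrow> real^'s \<Rightarrow> ereal \<Rightarrow> bool" where
  "is_pstar \<Gamma> u q \<longleftrightarrow>
     (if (MAX i. u $ i) \<le> 0 then q = \<infinity>
      else 0 < q \<and> q < ereal (Min {- 2 * \<Gamma> $ i $ i / u $ i | i. 0 < u $ i}) \<and>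
        (\<forall>p. 0 < p \<and> ereal p < q \<longrightarrow> 0 < eta \<Gamma> p u))"


section \<open>The truncated Euler--Maruyama scheme\<close>

text \<open>
  On \<^typ>\<open>real^'d^'n\<close> (\<open>n \<times> d\<close> matrices) the library norm is the trace (Frobenius) norm.
  \<open>a\<close> and \<open>b\<close> are the drift and diffusion coefficients in one fixed state; the second disjunct is the
  admissible alternative for globally Lipschitz coefficients, in which nothing is truncated.
\<close>

definition truncation_control ::
  "(real^'n \<Rightarrow> real^'n) \<Rightarrow> (real^'n \<Rightarrow> real^'d^'n) \<Rightarrow> (real \<Rightarrow> real) \<Rightarrow> (real \<Rightarrow> ereal) \<Rightarrow> bool"
where
  "truncation_control a b \<phi> \<phi>inv \<longleftrightarrow>
     (strict_mono_on {0..} \<phi> \<and> continuous_on {0..} \<phi> \<and> \<phi> \<in> {0..} \<rightarrow> {0..} \<and>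
      filterlim \<phi> at_top at_top \<and>
      (\<forall>u\<ge>1. \<forall>x y. norm x \<le> u \<and> norm y \<le> u \<and> x \<noteq> y \<longrightarrow>
         max (norm (a x - a y) / norm (x - y)) ((norm (b x - b y))\<^sup>2 / (norm (x - y))\<^sup>2) \<le> \<phi> u) \<and>
      (\<forall>v\<ge>\<phi> 1. \<phi>inv v = ereal (the_inv_into {0..} \<phi> v)))
   \<or> (\<exists>C. (\<forall>x y. norm (a x - a y) \<le> C * norm (x - y) \<and>
                   (norm (b x - b y))\<^sup>2 \<le> C * (norm (x - y))\<^sup>2) \<and>
          (\<forall>u\<ge>0. \<phi> u = C) \<and> (\<forall>v\<ge>C. \<phi>inv v = \<infinity>))"

definition stepsize_control ::
  "(real^'n \<Rightarrow> 's \<Rightarrow> real^'n) \<Rightarrow> (real^'n \<Rightarrow> 's \<Rightarrow> real^'d^'n) \<Rightarrow> ('s::finite \<Rightarrow> real \<Rightarrow> real)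
    \<Rightarrow> real^'n \<Rightarrow> (real \<Rightarrow> real) \<Rightarrow> bool"
where
  "stepsize_control f g \<phi> x\<^sub>0 h \<longleftrightarrow>
     (\<forall>\<Delta>\<in>{0<..1}. (MAX i. \<phi> i (max (norm x\<^sub>0) 1)) \<le> h \<Delta>) \<and>
     (\<forall>\<Delta>\<in>{0<..1}. \<forall>\<Delta>'\<in>{0<..1}. \<Delta> < \<Delta>' \<longrightarrow> h \<Delta>' < h \<Delta>) \<and>
     (MAX i. max (norm (f 0 i)) ((norm (g 0 i))\<^sup>2)) \<le> h 1 \<and>
     filterlim h at_top (at_right 0) \<and>
     (\<exists>\<theta> K. 0 < \<theta> \<and> \<theta> < 1 / 2 \<and> 0 < K \<and> (\<forall>\<Delta>\<in>{0<..1}. \<Delta> powr (1 / 2 - \<theta>) * h \<Delta> \<le> K))"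

text \<open>\<^term>\<open>sgn x\<close> is \<open>x / |x|\<close>, and \<open>0\<close> for \<open>x = 0\<close>. The radius may be infinite.\<close>

definition truncate :: "ereal \<Rightarrow> real^'n \<Rightarrow> real^'n" where
  "truncate R x = real_of_ereal (min (ereal (norm x)) R) *\<^sub>R sgn x"

text \<open>
  \<open>tem_pre\<close> is the untruncated iterate (usually written \<open>Z\<close> with a tilde) and \<open>tem\<close> is \<open>Z\<close> itself,
  both at step \<open>k\<close> and sample point \<open>\<omega>\<close>; \<open>r\<^sub>k = r(k \<Delta>)\<close>.
\<close>

primrec tem_pre ::
  "(real^'n \<Rightarrow> 's \<Rightarrow> real^'n) \<Rightarrow> (real^'n \<Rightarrow> 's \<Rightarrow> real^'d^'n) \<Rightarrow> ('s \<Rightarrow> real \<Rightarrow> ereal)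
    \<Rightarrow> (real \<Rightarrow> real) \<Rightarrow> (real \<Rightarrow> 'a \<Rightarrow> real^'d) \<Rightarrow> (real \<Rightarrow> 'a \<Rightarrow> 's) \<Rightarrow> real^'n \<Rightarrow> real
    \<Rightarrow> nat \<Rightarrow> 'a \<Rightarrow> real^'n"
where
  "tem_pre f g \<phi>inv h B r x\<^sub>0 \<Delta> 0 = (\<lambda>\<omega>. x\<^sub>0)"
| "tem_pre f g \<phi>inv h B r x\<^sub>0 \<Delta> (Suc k) = (\<lambda>\<omega>.
     let i = r (real k * \<Delta>) \<omega>;
         z = truncate (\<phi>inv i (h \<Delta>)) (tem_pre f g \<phi>inv h B r x\<^sub>0 \<Delta> k \<omega>)
     in z + \<Delta> *\<^sub>R f z i + g z i *v (B (real (Suc k) * \<Delta>) \<omega> - B (real k * \<Delta>) \<omega>))"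

definition tem ::
  "(real^'n \<Rightarrow> 's \<Rightarrow> real^'n) \<Rightarrow> (real^'n \<Rightarrow> 's \<Rightarrow> real^'d^'n) \<Rightarrow> ('s \<Rightarrow> real \<Rightarrow> ereal)
    \<Rightarrow> (real \<Rightarrow> real) \<Rightarrow> (real \<Rightarrow> 'a \<Rightarrow> real^'d) \<Rightarrow> (real \<Rightarrow> 'a \<Rightarrow> 's) \<Rightarrow> real^'n \<Rightarrow> real
    \<Rightarrow> nat \<Rightarrow> 'a \<Rightarrow> real^'n"
where
  "tem f g \<phi>inv h B r x\<^sub>0 \<Delta> k \<omega> =
     truncate (\<phi>inv (r (real k * \<Delta>) \<omega>) (h \<Delta>)) (tem_pre f g \<phi>inv h B r x\<^sub>0 \<Delta> k \<omega>)"


section \<open>Logarithm and the Lyapunov function\<close>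

definition elog :: "ennreal \<Rightarrow> ereal" where
  "elog x = (if x = 0 then -\<infinity> else if x = \<infinity> then \<infinity> else ereal (ln (enn2real x)))"

definition sym_pos_def :: "real^'n^'n \<Rightarrow> bool" where
  "sym_pos_def Q \<longleftrightarrow> transpose Q = Q \<and> (\<forall>x. x \<noteq> 0 \<longrightarrow> 0 < x \<bullet> (Q *v x))"

definition psi ::
  "real^'n^'n \<Rightarrow> (real^'n \<Rightarrow> 's \<Rightarrow> real^'n) \<Rightarrow> (real^'n \<Rightarrow> 's \<Rightarrow> real^'d^'n) \<Rightarrow> real^'n \<Rightarrow> 's \<Rightarrow> real"
where
  "psi Q f g x i = 2 * (x \<bullet> (Q *v f x i)) + trace (transpose (g x i) ** Q ** g x i)"

end

theory Submission
  imports Defs "HOL-Computational_Algebra.Polynomial"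
begin

text \<open>
  Write \<open>V x = x \<bullet> (Q *v x)\<close>, \<open>q = p / 2\<close> and let \<open>Z\<^sub>k\<close>, \<open>r\<^sub>k\<close> be the scheme and the chain at step \<open>k\<close>.  The
  proof follows the vector of moments \<open>u\<^sub>k(i) = E(V(Z\<^sub>k)\<^sup>q; r\<^sub>k = i)\<close> and shows that in one step of
  length \<open>\<Delta>\<close> it is dominated, up to a relative error \<open>o(\<Delta>)\<close>, by its product with the matrix
  \<open>I + \<Delta> (\<Gamma> + q diag \<beta>)\<close>.

  For the Euler step, in a fixed state \<open>i\<close>, the power \<open>V\<^sup>q\<close> is expanded to third order
  (\<open>Euler_step_moment\<close>).  Truncation guarantees linear growth of the coefficients with constant
  \<open>h(\<Delta>)\<close>, so the increment is of size \<open>(h(\<Delta>) \<Delta>)\<^sup>1\<^sup>/\<^sup>2\<close>; odd orders vanish because the Gaussian increment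
  is symmetric, the first two orders are controlled by the hypothesis on \<open>\<psi>\<close> and contribute at most
  \<open>q \<beta>\<^sub>i \<Delta>\<close>, and the rest is \<open>O((h(\<Delta>) \<Delta>)\<^sup>2)\<close>, which is \<open>o(\<Delta>)\<close> by the choice of \<open>h\<close>.  Truncation never
  increases \<open>V\<close>.

  For the switching, the Brownian increment is independent of everything the scheme has used so far
  together with the whole path of the chain (\<open>increment_indep_driving\<close>).  It can therefore be integrated
  out with \<open>r\<^sub>k\<^sub>+\<^sub>1\<close> held fixed, after which the Markov property contributes the transition
  probability \<open>P(\<Delta>) = I + \<Delta> \<Gamma> + o(\<Delta>)\<close> (\<open>tem_one_step\<close>).

  Finally \<open>\<Gamma> + q diag \<beta>\<close> has nonnegative off-diagonal entries, and \<open>- \<eta>\<close> is its spectral abscissa.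
  Hence for every \<open>a < \<eta>\<close> there is a positive vector \<open>c\<close> with \<open>(\<Gamma> + q diag \<beta>) c < - a c\<close>
  (\<open>metzler_positive_subeigenvector\<close>), and for small \<open>\<Delta>\<close> the weighted sum of the \<open>u\<^sub>k(i)\<close> contracts by
  \<open>e\<^sup>-\<^sup>a\<^sup>\<Delta>\<close> in each step (\<open>transition_contraction\<close>, \<open>tem_moment_decay\<close>).  This exponential decay of
  \<open>E |Z\<^sub>k|\<^sup>p\<close> gives both conclusions (\<open>exponential_decay_Lyapunov\<close>).
\<close>

section \<open>Positive subeigenvectors of Metzler matrices\<close>

text \<open>
  The eigenvalues are the roots of the characteristic polynomial, which is not the zero polynomial
  because a number exceeding the sum of the moduli of all entries is no eigenvalue.  Finiteness is
  what makes the maximum in \<^const>\<open>eta\<close> an upper bound of all real parts.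
\<close>

lemma finite_spectrum:
  fixes A :: "real^'s::finite^'s"
  shows "finite (spectrum A)"
proof -
  define Ac :: "complex^'s^'s" where "Ac = (\<chi> i j. complex_of_real (A $ i $ j))"
  define charmat :: "complex poly^'s^'s"
    where "charmat = (\<chi> i j. if i = j then [:- Ac$i$j, 1:] else [:- Ac$i$j:])"
  have poly_det: "poly (det charmat) x = det (\<chi> i j. (if i = j then x else 0) - Ac$i$j)" for x
    unfolding det_def poly_sum poly_mult poly_prod charmat_def
    by (intro sum.cong refl arg_cong2[where f="(*)"] prod.cong) auto
  have apply_shift: "(\<chi> i j. (if i = j then x else 0) - Ac$i$j) *v v = x *s v - Ac *v v" for x v
    by (simp add: vec_eq_iff matrix_vector_mult_def left_diff_distrib sum_subtractf if_distribR
        mult_delta_left sum.delta)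
  have root_iff: "poly (det charmat) x = 0 \<longleftrightarrow> x \<in> spectrum A" for x
  proof -
    have "det (\<chi> i j. (if i = j then x else 0) - Ac$i$j) = 0 \<longleftrightarrow>
      (\<exists>v. v \<noteq> 0 \<and> (\<chi> i j. (if i = j then x else 0) - Ac$i$j) *v v = 0)"
      using invertible_det_nz[of "\<chi> i j. (if i = j then x else 0) - Ac$i$j"]
        invertible_left_inverse[of "\<chi> i j. (if i = j then x else 0) - Ac$i$j"]
        matrix_left_invertible_ker[of "\<chi> i j. (if i = j then x else 0) - Ac$i$j"]
      by blast
    then show ?thesis
      unfolding poly_det apply_shift spectrum_def Ac_def[symmetric] by auto
  qed
  define R where "R = (\<Sum>i\<in>UNIV. \<Sum>j\<in>UNIV. cmod (Ac$i$j)) + 1"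
  have Rpos: "R > 0" unfolding R_def by (simp add: sum_nonneg add_nonneg_pos)
  have "of_real R \<notin> spectrum A"
  proof
    assume "of_real R \<in> spectrum A"
    then obtain v :: "complex^'s" where v: "v \<noteq> 0" "Ac *v v = of_real R *s v"
      unfolding spectrum_def Ac_def[symmetric] by auto
    obtain i where i: "\<And>j. cmod (v$j) \<le> cmod (v$i)"
    proof -
      have "Max (range (\<lambda>j. cmod (v$j))) \<in> range (\<lambda>j. cmod (v$j))" by (rule Max_in) auto
      then obtain i where "Max (range (\<lambda>j. cmod (v$j))) = cmod (v$i)" by blast
      then show ?thesis using that[of i] by (metis Max_ge finite_class.finite_UNIV finite_imageI rangeI)
    qed
    have pos: "0 < cmod (v$i)"
    proof -
      obtain k where "v$k \<noteq> 0" using v(1) by (auto simp: vec_eq_iff)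
      then have "0 < cmod (v$k)" by simp
      then show ?thesis using i[of k] by linarith
    qed
    have "R * cmod (v$i) = cmod ((Ac *v v)$i)" using v(2) Rpos by (simp add: norm_mult)
    also have "\<dots> \<le> (\<Sum>j\<in>UNIV. cmod (Ac$i$j) * cmod (v$j))"
      unfolding matrix_vector_mult_def by (simp add: norm_mult[symmetric] norm_sum)
    also have "\<dots> \<le> (\<Sum>j\<in>UNIV. cmod (Ac$i$j) * cmod (v$i))"
      by (intro sum_mono mult_left_mono i) auto
    also have "\<dots> = (\<Sum>j\<in>UNIV. cmod (Ac$i$j)) * cmod (v$i)" by (simp add: sum_distrib_right)
    finally have "R \<le> (\<Sum>j\<in>UNIV. cmod (Ac$i$j))" using pos by simp
    also have "\<dots> \<le> (\<Sum>i\<in>UNIV. \<Sum>j\<in>UNIV. cmod (Ac$i$j))"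
      by (rule member_le_sum[where f="\<lambda>i. \<Sum>j\<in>UNIV. cmod (Ac$i$j)"]) (auto simp: sum_nonneg)
    finally show False unfolding R_def by simp
  qed
  then have "det charmat \<noteq> 0" using root_iff by force
  then have "finite {x. poly (det charmat) x = 0}" by (rule poly_roots_finite)
  then show ?thesis unfolding root_iff by simp
qed

text \<open>
  The maximum principle behind M-matrices.  Let \<open>t\<close> be the smallest ratio of the entries of \<open>x\<close>
  and \<open>c\<close>, attained at \<open>k\<close>.  Then \<open>x - t c\<close> is nonnegative with a zero at \<open>k\<close>, so row \<open>k\<close> of
  \<open>A (x - t c)\<close>, which only involves off-diagonal entries, is nonnegative; if \<open>t\<close> were
  negative this would contradict the strict inequality for \<open>c\<close>.
\<close>

lemma inverse_positive:
  fixes A :: "real^'s::finite^'s"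
  assumes off: "\<And>i j. i \<noteq> j \<Longrightarrow> 0 \<le> A$i$j"
    and c: "\<And>i. 0 < c$i" "\<And>i. (A *v c)$i < \<mu> * c$i"
    and x: "\<And>i. (A *v x)$i \<le> \<mu> * x$i"
  shows "0 \<le> x$i"
proof -
  define t where "t = Min (range (\<lambda>i. x$i / c$i))"
  have "t \<in> range (\<lambda>i. x$i / c$i)" unfolding t_def by (rule Min_in) auto
  then obtain k where k: "t = x$k / c$k" by auto
  have tle: "t * c$j \<le> x$j" for j
  proof -
    have "t \<le> x$j / c$j" unfolding t_def by (rule Min_le) auto
    then show ?thesis using c(1)[of j] by (simp add: field_simps)
  qed
  have tk: "x$k = t * c$k" using k c(1)[of k] by simp
  have "0 \<le> t"
  proof (rule ccontr)
    assume "\<not> 0 \<le> t"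
    then have neg: "t < 0" by simp
    have "t * (A *v c)$k = (\<Sum>j\<in>UNIV. A$k$j * (t * c$j))"
      by (simp add: matrix_vector_mult_def sum_distrib_left ac_simps)
    also have "\<dots> \<le> (\<Sum>j\<in>UNIV. A$k$j * x$j)"
    proof (rule sum_mono)
      fix j show "A$k$j * (t * c$j) \<le> A$k$j * x$j"
        by (cases "j = k") (auto simp: tk intro: mult_left_mono tle off)
    qed
    also have "\<dots> \<le> \<mu> * x$k" using x[of k] by (simp add: matrix_vector_mult_def)
    also have "\<dots> = t * (\<mu> * c$k)" by (simp add: tk)
    finally have "\<mu> * c$k \<le> (A *v c)$k" using neg by (simp add: mult_le_cancel_left)
    with c(2)[of k] show False by simp
  qed
  then show ?thesis using tle[of i] c(1)[of i]
    by (meson less_eq_real_def mult_nonneg_nonneg order_trans)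
qed

text \<open>
  A positive vector whose flow under \<open>A\<close> grows more slowly than \<open>e\<^sup>\<mu>\<^sup>t\<close>, obtained without
  Perron--Frobenius theory.  The set \<open>S\<close> of all \<open>\<mu>\<close> admitting such a vector is upward closed and bounded below; let
  \<open>m\<close> be its infimum.  If \<open>m - A\<close> were invertible, the solution \<open>x\<close> of \<open>(m - A) x = 1\<close> would be
  nonnegative by \<open>inverse_positive\<close> applied slightly above \<open>m\<close>, hence positive, and would show
  that even numbers below \<open>m\<close> belong to \<open>S\<close>.  So \<open>m\<close> is a real eigenvalue, and every number beyond
  the spectral abscissa lies above it.
\<close>

lemma metzler_positive_subeigenvector:
  fixes A :: "real^'s::finite^'s"
  assumes off: "\<And>i j. i \<noteq> j \<Longrightarrow> 0 \<le> A$i$j"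
    and \<mu>: "Max (Re ` spectrum A) < \<mu>"
  obtains c where "\<And>i. 0 < c$i" "\<And>i. (A *v c)$i < \<mu> * c$i"
proof -
  define good where "good = (\<lambda>\<mu>. \<exists>c. (\<forall>i. 0 < c$i) \<and> (\<forall>i. (A *v c)$i < \<mu> * c$i))"
  define S where "S = Collect good"
  have goodE: "\<exists>c. (\<forall>i. 0 < c$i) \<and> (\<forall>i. (A *v c)$i < s * c$i)" if "s \<in> S" for s
    using that unfolding S_def good_def by simp
  \<comment> \<open>Any index will do: its diagonal entry is a lower bound of \<open>S\<close>.\<close>
  define k :: 's where "k = undefined"
  have lower: "A$k$k \<le> s" if s: "s \<in> S" for s
  proof -
    obtain c where c: "\<And>i. 0 < c$i" "\<And>i. (A *v c)$i < s * c$i"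
      using goodE[OF s] by blast
    have "A$k$k * c$k \<le> (\<Sum>j\<in>UNIV. A$k$j * c$j)"
    proof -
      have "(\<Sum>j\<in>UNIV. A$k$j * c$j) = A$k$k * c$k + (\<Sum>j\<in>UNIV - {k}. A$k$j * c$j)"
        by (simp add: sum.remove)
      moreover have "0 \<le> (\<Sum>j\<in>UNIV - {k}. A$k$j * c$j)"
        by (intro sum_nonneg mult_nonneg_nonneg off) (auto simp: c(1) less_imp_le)
      ultimately show ?thesis by simp
    qed
    also have "\<dots> < s * c$k" using c(2)[of k] by (simp add: matrix_vector_mult_def)
    finally show ?thesis using c(1)[of k] by simp
  qed
  then have bdd: "bdd_below S" by (rule bdd_belowI)
  have up: "t \<in> S" if st: "s \<in> S" "s \<le> t" for s t
  proof -
    obtain c where c: "\<And>i. 0 < c$i" "\<And>i. (A *v c)$i < s * c$i"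
      using goodE[OF st(1)] by blast
    have "(A *v c)$i < t * c$i" for i
      using c(2)[of i] mult_right_mono[OF st(2), of "c$i"] c(1)[of i] by linarith
    then show ?thesis using c(1) unfolding S_def good_def by blast
  qed
  have ne: "S \<noteq> {}"
  proof -
    define s where "s = (\<Sum>i\<in>UNIV. \<bar>(A *v vec 1)$i\<bar>) + 1"
    have "(A *v vec 1)$i < s" for i
    proof -
      have "\<bar>(A *v vec 1)$i\<bar> \<le> (\<Sum>i\<in>UNIV. \<bar>(A *v vec 1)$i\<bar>)"
        by (rule member_le_sum[where f="\<lambda>i. \<bar>(A *v vec 1)$i\<bar>"]) auto
      then show ?thesis unfolding s_def by linarith
    qed
    then have "good s" unfolding good_def by (intro exI[of _ "vec 1"]) simp
    then show ?thesis unfolding S_def by auto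
  qed
  define m where "m = Inf S"
  have "m \<in> Re ` spectrum A"
  proof (rule ccontr)
    assume notin: "m \<notin> Re ` spectrum A"
    define N where "N = (mat m - A :: real^'s^'s)"
    have Nv: "N *v x = m *\<^sub>R x - A *v x" for x
      unfolding N_def
      by (simp add: vec_eq_iff matrix_vector_mult_def mat_def left_diff_distrib sum_subtractf
          mult_delta_left sum.delta)
    have ker: "x = 0" if "N *v x = 0" for x
    proof (rule ccontr)
      assume "x \<noteq> 0"
      define v :: "complex^'s" where "v = (\<chi> i. of_real (x$i))"
      have "v \<noteq> 0" using \<open>x \<noteq> 0\<close> unfolding v_def by (auto simp: vec_eq_iff)
      moreover have "(\<chi> i j. complex_of_real (A $ i $ j)) *v v = of_real m *s v"
      proof -
        have "(A *v x)$i = m * x$i" for i using that unfolding Nv by (auto simp: vec_eq_iff)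
        then have "complex_of_real ((A *v x)$i) = of_real (m * x$i)" for i by simp
        then show ?thesis unfolding v_def matrix_vector_mult_def by (simp add: vec_eq_iff)
      qed
      ultimately have "of_real m \<in> spectrum A" unfolding spectrum_def by blast
      then show False using notin by force
    qed
    obtain N' where N': "N ** N' = mat 1"
      using matrix_left_invertible_ker[of N] ker matrix_left_right_inverse by metis
    define x where "x = N' *v vec 1"
    have "N *v x = vec 1" unfolding x_def by (simp add: matrix_vector_mul_assoc N')
    then have Ax: "(A *v x)$i = m * x$i - 1" for i
      unfolding Nv by (auto simp: vec_eq_iff algebra_simps)
    \<comment> \<open>\<open>1 / b\<close> is a perturbation of \<open>m\<close> that moves no entry of \<open>(m - A) x = 1\<close> to or below \<open>0\<close>.\<close>
    define b where "b = (\<Sum>i\<in>UNIV. \<bar>x$i\<bar>) + 1"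
    have b: "\<bar>x$i\<bar> < b" for i
    proof -
      have "\<bar>x$i\<bar> \<le> (\<Sum>i\<in>UNIV. \<bar>x$i\<bar>)"
        by (rule member_le_sum[where f="\<lambda>i. \<bar>x$i\<bar>"]) auto
      then show ?thesis unfolding b_def by linarith
    qed
    then have bpos: "0 < b" using b[of k] by linarith
    have scaled: "- 1 < x$i / b" "x$i / b < 1" for i
      using b[of i] bpos by (simp_all add: field_simps abs_less_iff)
    have nonneg: "0 \<le> x$i" for i
    proof -
      have "m < m + 1 / b" using bpos by simp
      then obtain s where s: "s \<in> S" "s < m + 1 / b"
        unfolding m_def using cInf_lessD[OF ne] by blast
      then have "m + 1 / b \<in> S" using up by force
      then obtain c where c: "\<And>i. 0 < c$i" "\<And>i. (A *v c)$i < (m + 1 / b) * c$i"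
        using goodE by blast
      have le: "(A *v x)$i \<le> (m + 1 / b) * x$i" for i
        unfolding Ax using scaled(1)[of i] by (simp add: distrib_right)
      show ?thesis by (rule inverse_positive[OF off c le])
    qed
    have xpos: "0 < x$i" for i
    proof (rule ccontr)
      assume "\<not> 0 < x$i"
      then have "x$i = 0" using nonneg[of i] by simp
      then have "(A *v x)$i = -1" using Ax[of i] by simp
      moreover have "0 \<le> (A *v x)$i"
        unfolding matrix_vector_mult_def
        using \<open>x$i = 0\<close> off nonneg
        by (auto intro!: sum_nonneg) (metis mult_nonneg_nonneg mult_zero_right order_refl)
      ultimately show False by simp
    qed
    have "m - 1 / b \<in> S"
      unfolding S_def good_def
      using xpos scaled(2) Ax by (auto intro!: exI[of _ x] simp: left_diff_distrib)
    then have "m \<le> m - 1 / b" unfolding m_def using bdd by (rule cInf_lower)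
    then show False using bpos by simp
  qed
  then have "m < \<mu>" using \<mu> finite_spectrum[of A] by (meson Max_ge finite_imageI le_less_trans)
  then obtain s where "s \<in> S" "s < \<mu>" unfolding m_def using cInf_lessD[OF ne] by blast
  then have "\<mu> \<in> S" using up by force
  then show ?thesis using that goodE by blast
qed


section \<open>Even part of a power near one\<close>

text \<open>
  Close to \<open>0\<close> this is Taylor's formula with Lagrange remainder.  Away from \<open>0\<close> both the power
  and the cubic polynomial are dominated by \<open>x\<^sup>4 (1 + x\<^sup>2\<^sup>m)\<close>, where \<open>2m \<ge> q\<close>.  The remainder is
  nonnegative and polynomial, so that its Gaussian expectation exists.
\<close>

lemma powr_le_cubic_Taylor:
  fixes q :: real
  assumes q: "0 < q"
  obtains C m where "0 \<le> C"
    "\<And>x. -1 \<le> x \<Longrightarrow> (1 + x) powr q \<le>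
       1 + q * x + q * (q-1) / 2 * x^2 + q * (q-1) * (q-2) / 6 * x^3 + C * (x^4 * (1 + x^(2*m)))"
proof -
  obtain m :: nat where m: "q \<le> 2 * real m"
    using real_arch_simple[of "q/2"] by (metis divide_le_eq_numeral1(1) mult.commute)
  \<comment> \<open>\<open>C1\<close> bounds the Lagrange remainder on \<open>[-1/2, 1/2]\<close>, where \<open>1 + x\<close> lies between \<open>1/2\<close> and \<open>2\<close>;
    \<open>C2\<close> collects the crude bounds used where \<open>1 \<le> 2 \<bar>x\<bar>\<close>.\<close>
  define C1 where "C1 = \<bar>q * (q-1) * (q-2) * (q-3)\<bar> / 24 * 2 powr \<bar>q - 4\<bar>"
  define C2 where "C2 = 16 * 3 powr q + 16 + 8 * \<bar>q\<bar> + 4 * \<bar>q * (q-1) / 2\<bar> + 2 * \<bar>q * (q-1) * (q-2) / 6\<bar>"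
  have C1: "0 \<le> C1" and C2: "0 \<le> C2" unfolding C1_def C2_def by auto
  define T where "T x = 1 + q * x + q * (q-1) / 2 * x^2 + q * (q-1) * (q-2) / 6 * x^3" for x
  have one_le: "1 \<le> 1 + x^(2*m)" for x :: real by (simp add: zero_le_even_power)
  have main: "(1 + x) powr q \<le> T x + (C1 + C2) * (x^4 * (1 + x^(2*m)))" if x: "-1 \<le> x" for x
  proof (cases "\<bar>x\<bar> \<le> 1/2")
    case True
    show ?thesis
    proof (cases "x = 0")
      case True then show ?thesis using C1 C2 by (simp add: T_def)
    next
      case False
      define df where "df = (\<lambda>k t. (\<Prod>i<k. q - real i) * (1 + t) powr (q - real k))"
      have der: "\<forall>k t. k < 4 \<and> -1/2 \<le> t \<and> t \<le> 1/2 \<longrightarrow> DERIV (df k) t :> df (Suc k) t"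
        unfolding df_def
        by (auto intro!: derivative_eq_intros simp: algebra_simps)
      obtain t where t: "if x < 0 then x < t \<and> t < 0 else 0 < t \<and> t < x"
        and eq: "(1+x) powr q = (\<Sum>k<4. df k 0 / fact k * (x - 0)^k) + df 4 t / fact 4 * (x - 0)^4"
        using Taylor[OF _ _ der, of "\<lambda>t. (1+t) powr q" 0 x] True False
        by (force simp: df_def)
      have t2: "1/2 \<le> 1 + t" "1 + t \<le> 2" using t True by (auto split: if_splits)
      have "(1+t) powr (q-4) \<le> 2 powr \<bar>q-4\<bar>"
      proof (cases "q \<ge> 4")
        case True then show ?thesis using t2 by (auto intro: powr_mono2)
      next
        case False
        have "(1+t) powr (q-4) \<le> (1/2) powr (q-4)" using t2 False by (intro powr_mono2') auto
        also have "\<dots> = 2 powr \<bar>q-4\<bar>" using False by (simp add: powr_divide powr_minus_divide[symmetric])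
        finally show ?thesis .
      qed
      then have "\<bar>df 4 t / fact 4\<bar> \<le> C1"
        unfolding df_def C1_def
        by (auto simp: abs_mult eval_nat_numeral lessThan_Suc fact_numeral ac_simps intro!: mult_left_mono divide_right_mono)
      then have "df 4 t / fact 4 * x^4 \<le> C1 * x^4"
        by (intro mult_right_mono) (use abs_ge_self order_trans in blast, simp)
      moreover have "(\<Sum>k<4. df k 0 / fact k * (x - 0)^k) = T x"
        unfolding T_def df_def by (simp add: eval_nat_numeral lessThan_Suc fact_numeral ac_simps)
      ultimately have "(1+x) powr q \<le> T x + C1 * x^4" using eq by simp
      also have "C1 * x^4 \<le> (C1 + C2) * (x^4 * (1 + x^(2*m)))"
      proof (rule mult_mono)
        show "x^4 \<le> x^4 * (1 + x^(2*m))" using mult_left_mono[OF one_le, of "x^4" x] by simp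
      qed (use C1 C2 in auto)
      finally show ?thesis by simp
    qed
  next
    case False
    define y where "y = \<bar>x\<bar>"
    have y: "1/2 \<le> y" using False unfolding y_def by simp
    have y4: "1 \<le> 16 * y^4" using power_mono[of "1/2" y 4] y by (simp add: power_divide)
    have y1: "y \<le> 8 * y^4" using power_mono[of "1/2" y 3] y mult_left_mono[of 1 "8 * y^3" y]
      by (simp add: power_divide eval_nat_numeral)
    have y2: "y^2 \<le> 4 * y^4" using power_mono[of "1/2" y 2] y mult_left_mono[of 1 "4 * y^2" "y^2"]
      by (simp add: power_divide eval_nat_numeral)
    have y3: "y^3 \<le> 2 * y^4" using y mult_left_mono[of 1 "2 * y" "y^3"]
      by (simp add: power_divide eval_nat_numeral)
    have "(1+x) powr q \<le> (3 * y) powr q"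
      using x y q unfolding y_def by (intro powr_mono2) auto
    also have "\<dots> = 3 powr q * y powr q" using y by (simp add: powr_mult)
    also have "y powr q \<le> 1 + y^(2*m)"
    proof (cases "y \<le> 1")
      case True
      then have "y powr q \<le> 1" using y q powr_mono2[of q y 1] by simp
      then show ?thesis using y by (simp add: add_increasing2)
    next
      case False
      then have "y powr q \<le> y powr (2 * real m)" using m by (intro powr_mono) auto
      also have "\<dots> = y^(2*m)" using y by (subst powr_realpow[symmetric]) auto
      finally show ?thesis by simp
    qed
    also have "1 + y^(2*m) \<le> (16 * y^4) * (1 + y^(2*m))"
      using y4 y mult_right_mono[of 1 "16*y^4" "1 + y^(2*m)"] by (simp add: add_nonneg_nonneg)
    finally have A: "(1+x) powr q \<le> 16 * 3 powr q * (y^4 * (1 + y^(2*m)))"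
      by (simp add: mult_left_mono algebra_simps)
    have "- T x \<le> 1 + \<bar>q\<bar> * y + \<bar>q * (q-1) / 2\<bar> * y^2 + \<bar>q * (q-1) * (q-2) / 6\<bar> * y^3"
    proof -
      have "\<bar>T x\<bar> \<le> \<bar>1\<bar> + \<bar>q * x\<bar> + \<bar>q * (q-1) / 2 * x^2\<bar> + \<bar>q * (q-1) * (q-2) / 6 * x^3\<bar>"
        unfolding T_def by linarith
      then show ?thesis unfolding y_def abs_mult power_abs by linarith
    qed
    also have "\<dots> \<le> 16 * y^4 + \<bar>q\<bar> * (8 * y^4) + \<bar>q * (q-1) / 2\<bar> * (4 * y^4) + \<bar>q * (q-1) * (q-2) / 6\<bar> * (2 * y^4)"
      by (intro add_mono mult_left_mono y1 y2 y3 y4) auto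
    also have "\<dots> = (C2 - 16 * 3 powr q) * y^4" unfolding C2_def by (simp add: algebra_simps)
    also have "\<dots> \<le> (C2 - 16 * 3 powr q) * (y^4 * (1 + y^(2*m)))"
    proof -
      have "0 \<le> C2 - 16 * 3 powr q" unfolding C2_def by simp
      moreover have "y^4 \<le> y^4 * (1 + y^(2*m))" using y mult_left_mono[of 1 "1 + y^(2*m)" "y^4"] by simp
      ultimately show ?thesis by (rule mult_left_mono[rotated])
    qed
    finally have "(1 + x) powr q \<le> T x + C2 * (y^4 * (1 + y^(2*m)))" using A by (simp add: algebra_simps)
    also have "C2 * (y^4 * (1 + y^(2*m))) \<le> (C1 + C2) * (y^4 * (1 + y^(2*m)))"
      using C1 y by (intro mult_right_mono) auto
    also have "y^4 * (1 + y^(2*m)) = x^4 * (1 + x^(2*m))" unfolding y_def by (simp add: power_even_abs)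
    finally show ?thesis by simp
  qed
  show ?thesis
    by (rule that[of "C1 + C2" m]) (use C1 C2 main in \<open>auto simp: T_def\<close>)
qed

text \<open>
  The relative increment of the Lyapunov function in one step is \<open>e + (a + b)\<close>: \<open>a\<close> is the leading
  term, linear in the Gaussian increment, \<open>b\<close> a further linear term, \<open>e\<close> the even part; \<open>n\<close> is the
  norm of the standardised increment and \<open>s\<^sup>4\<close> is the error that can be afforded.  The size of \<open>a\<close> is
  only \<open>s\<close>, so that the cubic term of Taylor's formula, of size \<open>s\<^sup>3\<close>, is too large to be
  estimated.  Averaging over the sign of the increment removes it: only \<open>o\<^sup>2 + e\<^sup>2\<close> and
  \<open>e\<^sup>3 + 3 o\<^sup>2 e\<close> survive from the square and the cube of \<open>e + o\<close>, where \<open>o = a + b\<close>.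
\<close>

lemma powr_even_part_le:
  fixes q K S :: real
  assumes q: "0 < q" and K: "0 \<le> K" and S: "0 \<le> S"
  obtains C M where "0 \<le> C"
    "\<And>s n a b e. 0 \<le> s \<Longrightarrow> s \<le> S \<Longrightarrow> 0 \<le> n \<Longrightarrow> \<bar>a\<bar> \<le> K * s * n \<Longrightarrow> \<bar>b\<bar> \<le> K * s^3 * n \<Longrightarrow>
       \<bar>e\<bar> \<le> K * s^2 * (1 + n^2) \<Longrightarrow> -1 \<le> e + (a + b) \<Longrightarrow> -1 \<le> e - (a + b) \<Longrightarrow>
       ((1 + (e + (a + b))) powr q + (1 + (e - (a + b))) powr q) / 2
         \<le> 1 + q * e + q * (q-1) / 2 * a^2 + C * s^4 * (1 + n)^M"
proof -
  obtain C0 m where C0: "0 \<le> C0"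
    and T: "\<And>x. -1 \<le> x \<Longrightarrow> (1 + x) powr q \<le>
       1 + q * x + q * (q-1) / 2 * x^2 + q * (q-1) * (q-2) / 6 * x^3 + C0 * (x^4 * (1 + x^(2*m)))"
    using powr_le_cubic_Taylor[OF q] by blast
  define c2 where "c2 = q * (q-1) / 2"
  define c3 where "c3 = q * (q-1) * (q-2) / 6"
  \<comment> \<open>\<open>L s (1 + n)\<^sup>2\<close> bounds \<open>e + (a + b)\<close>: each of the three terms is at most a third of it.\<close>
  define L where "L = K * (1 + S)^2 * 3"
  define M where "M = 8 + 4 * m"
  define C where "C = \<bar>c2\<bar> * (2 * K^2 + K^2 * S^2 + K^2) + \<bar>c3\<bar> * (L^2 * K * 4) + C0 * (L^4 * (1 + (L * S)^(2*m)))"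
  have L: "0 \<le> L" using K S unfolding L_def by simp
  have Cpos: "0 \<le> C" unfolding C_def using C0 L K S by (intro add_nonneg_nonneg mult_nonneg_nonneg) auto
  show ?thesis
  proof (rule that[of C M])
    show "0 \<le> C" by (rule Cpos)
    fix s n a b e :: real
    assume s: "0 \<le> s" "s \<le> S" and n: "0 \<le> n" and a: "\<bar>a\<bar> \<le> K * s * n" and b: "\<bar>b\<bar> \<le> K * s^3 * n"
      and e: "\<bar>e\<bar> \<le> K * s^2 * (1 + n^2)" and p1: "-1 \<le> e + (a + b)" and p2: "-1 \<le> e - (a + b)"
    define N where "N = 1 + n"
    have N: "1 \<le> N" "n \<le> N" using n unfolding N_def by auto
    have NM: "N^k \<le> N^M" if "k \<le> M" for k using N that by (simp add: power_increasing)
    have nN2: "1 + n^2 \<le> N^2" unfolding N_def power2_eq_square using n by (simp add: algebra_simps)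
    have nN: "n \<le> N^2" using N power_increasing[of 1 2 N] by simp
    have nn: "n^2 \<le> N^2" using n N by (intro power_mono) auto
    have e': "\<bar>e\<bar> \<le> K * s^2 * N^2"
      using e mult_left_mono[OF nN2, of "K * s^2"] K by simp
    have sS2: "s^2 \<le> S^2" using s by (intro power_mono) auto
    define o' where "o' = a + b"
    define bd where "bd = K * (1 + S)^2 * s * N^2"
    have oa: "\<bar>a\<bar> \<le> bd"
    proof -
      have "K * s * n \<le> K * s * N^2" using nN K s by (intro mult_left_mono) auto
      also have "\<dots> = K * 1 * s * N^2" by simp
      also have "\<dots> \<le> K * (1 + S)^2 * s * N^2"
        using K s N S by (intro mult_right_mono mult_left_mono one_le_power) auto
      finally show ?thesis using a unfolding bd_def by simp
    qed
    have ob: "\<bar>b\<bar> \<le> bd"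
    proof -
      have "K * s^3 * n = K * s^2 * s * n" by (simp add: eval_nat_numeral)
      also have "\<dots> \<le> K * (1 + S)^2 * s * N^2"
        using K s S nN n by (intro mult_mono mult_nonneg_nonneg power_mono) auto
      finally show ?thesis using b unfolding bd_def by simp
    qed
    have oe: "\<bar>e\<bar> \<le> bd"
    proof -
      have "s \<le> S * 2 + (1 + S * S)" using s S mult_nonneg_nonneg[OF S S] by linarith
      also have "\<dots> = (1 + S)^2" by (simp add: power2_eq_square algebra_simps)
      finally have "s \<le> (1 + S)^2" .
      then have "K * s^2 * N^2 \<le> K * (1 + S)^2 * s * N^2"
        unfolding power2_eq_square[of s] using K s
        by (metis (no_types, lifting) mult.assoc mult_left_mono mult_right_mono zero_le_power2)
      then show ?thesis using e' unfolding bd_def by simp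
    qed
    have Lbd: "L * s * N^2 = 3 * bd" unfolding L_def bd_def by simp
    have x1: "\<bar>e + o'\<bar> \<le> L * s * N^2" and x2: "\<bar>e - o'\<bar> \<le> L * s * N^2" and oL: "\<bar>o'\<bar> \<le> L * s * N^2"
      and eL: "\<bar>e\<bar> \<le> L * s * N^2"
      unfolding Lbd o'_def using oa ob oe by linarith+
    have rem: "x^4 * (1 + x^(2*m)) \<le> L^4 * (1 + (L * S)^(2*m)) * (s^4 * N^M)" if x: "\<bar>x\<bar> \<le> L * s * N^2" for x
    proof -
      have "x^4 \<le> (L * s * N^2)^4" using power_mono[OF x, of 4] by (simp add: power_even_abs)
      moreover have "x^(2*m) \<le> (L * S)^(2*m) * N^(4*m)"
      proof -
        have "x^(2*m) \<le> (L * s * N^2)^(2*m)" using power_mono[OF x, of "2*m"] by (simp add: power_even_abs)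
        also have "\<dots> \<le> (L * S * N^2)^(2*m)" using s L by (intro power_mono mult_right_mono mult_left_mono) auto
        also have "\<dots> = (L * S)^(2*m) * N^(4*m)" by (simp add: power_mult_distrib power_mult[symmetric])
        finally show ?thesis .
      qed
      then have "1 + x^(2*m) \<le> (1 + (L * S)^(2*m)) * N^(4*m)"
        using one_le_power[OF N(1), of "4*m"] by (simp add: algebra_simps)
      ultimately have "x^4 * (1 + x^(2*m)) \<le> (L * s * N^2)^4 * ((1 + (L * S)^(2*m)) * N^(4*m))"
        using L s S by (intro mult_mono) (auto simp: zero_le_even_power)
      also have "\<dots> = L^4 * (1 + (L * S)^(2*m)) * (s^4 * N^M)"
        unfolding M_def by (simp add: power_mult_distrib power_mult[symmetric] power_add)
      finally show ?thesis .
    qed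
    have q2: "\<bar>2 * a * b + b^2 + e^2\<bar> \<le> (2 * K^2 + K^2 * S^2 + K^2) * (s^4 * N^M)"
    proof -
      have "\<bar>a * b\<bar> \<le> (K * s * n) * (K * s^3 * n)" unfolding abs_mult using a b by (intro mult_mono) (auto intro: order_trans[OF abs_ge_zero])
      also have "\<dots> = K^2 * s^4 * n^2" by (simp add: eval_nat_numeral)
      also have "\<dots> \<le> K^2 * s^4 * N^M" using nn NM[of 2] unfolding M_def by (intro mult_left_mono) auto
      finally have 1: "\<bar>a * b\<bar> \<le> K^2 * (s^4 * N^M)" by simp
      have "b^2 \<le> (K * s^3 * n)^2" using power_mono[OF b, of 2] by simp
      also have "\<dots> = K^2 * s^4 * s^2 * n^2" by (simp add: eval_nat_numeral)
      also have "\<dots> \<le> K^2 * s^4 * S^2 * N^M" using nn NM[of 2] sS2 unfolding M_def by (intro mult_mono mult_left_mono) auto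
      finally have 2: "b^2 \<le> K^2 * S^2 * (s^4 * N^M)" by (simp add: ac_simps)
      have "e^2 \<le> (K * s^2 * N^2)^2" using power_mono[OF e', of 2] by simp
      also have "\<dots> = K^2 * s^4 * N^4" by (simp add: eval_nat_numeral)
      also have "\<dots> \<le> K^2 * s^4 * N^M" using NM[of 4] unfolding M_def by (intro mult_left_mono) auto
      finally have 3: "e^2 \<le> K^2 * (s^4 * N^M)" by simp
      have "\<bar>2 * a * b + b^2 + e^2\<bar> \<le> 2 * \<bar>a * b\<bar> + b^2 + e^2"
      proof -
        have "\<bar>2 * a * b\<bar> = 2 * \<bar>a * b\<bar>" by (simp add: abs_mult)
        then show ?thesis using zero_le_power2[of b] zero_le_power2[of e] by linarith
      qed
      also have "\<dots> \<le> 2 * (K^2 * (s^4 * N^M)) + K^2 * S^2 * (s^4 * N^M) + K^2 * (s^4 * N^M)"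
        using 1 2 3 by linarith
      finally show ?thesis by (simp add: algebra_simps)
    qed
    have q3: "\<bar>e^3 + 3 * o'^2 * e\<bar> \<le> (L^2 * K * 4) * (s^4 * N^M)"
    proof -
      have o2: "o'^2 \<le> (L * s * N^2)^2" using power_mono[OF oL, of 2] by simp
      have e2: "e^2 \<le> (L * s * N^2)^2" using power_mono[OF eL, of 2] by simp
      have "\<bar>e^3 + 3 * o'^2 * e\<bar> = (e^2 + 3 * o'^2) * \<bar>e\<bar>"
      proof -
        have "e^3 + 3 * o'^2 * e = (e^2 + 3 * o'^2) * e" by (simp add: power3_eq_cube power2_eq_square algebra_simps)
        then show ?thesis by (simp add: abs_mult)
      qed
      also have "\<dots> \<le> (4 * (L * s * N^2)^2) * (K * s^2 * N^2)"
        using o2 e2 e' by (intro mult_mono) auto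
      also have "\<dots> = L^2 * K * 4 * (s^4 * N^6)" by (simp add: eval_nat_numeral)
      also have "\<dots> \<le> L^2 * K * 4 * (s^4 * N^M)"
        using K NM[of 6] unfolding M_def by (intro mult_left_mono) auto
      finally show ?thesis .
    qed
    have "((1 + (e + o')) powr q + (1 + (e - o')) powr q) / 2
      \<le> ((1 + q * (e + o') + c2 * (e + o')^2 + c3 * (e + o')^3 + C0 * ((e + o')^4 * (1 + (e + o')^(2*m))))
        + (1 + q * (e - o') + c2 * (e - o')^2 + c3 * (e - o')^3 + C0 * ((e - o')^4 * (1 + (e - o')^(2*m))))) / 2"
      unfolding c2_def c3_def by (intro divide_right_mono add_mono T) (use p1 p2 in \<open>auto simp: o'_def\<close>)
    also have "\<dots> = 1 + q * e + c2 * (o'^2 + e^2) + c3 * (e^3 + 3 * o'^2 * e)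
        + C0 * (((e + o')^4 * (1 + (e + o')^(2*m)) + (e - o')^4 * (1 + (e - o')^(2*m))) / 2)"
    proof -
      have sq: "((e + o')^2 + (e - o')^2) / 2 = o'^2 + e^2" by (simp add: power2_eq_square algebra_simps)
      have cb: "((e + o')^3 + (e - o')^3) / 2 = e^3 + 3 * o'^2 * e"
        by (simp add: power2_eq_square power3_eq_cube algebra_simps)
      have gather: "\<And>u v w x y z :: real. ((1 + q * (e + o') + c2 * u + c3 * v + C0 * w)
        + (1 + q * (e - o') + c2 * x + c3 * y + C0 * z)) / 2
        = 1 + q * e + c2 * ((u + x) / 2) + c3 * ((v + y) / 2) + C0 * ((w + z) / 2)"
        by (simp add: field_simps)
      show ?thesis by (simp only: gather sq cb)
    qed
    also have "\<dots> \<le> 1 + q * e + c2 * a^2 + \<bar>c2\<bar> * \<bar>2 * a * b + b^2 + e^2\<bar> + \<bar>c3\<bar> * \<bar>e^3 + 3 * o'^2 * e\<bar>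
        + C0 * (L^4 * (1 + (L * S)^(2*m)) * (s^4 * N^M))"
    proof -
      have "c2 * (o'^2 + e^2) = c2 * a^2 + c2 * (2 * a * b + b^2 + e^2)"
        unfolding o'_def by (simp add: power2_eq_square algebra_simps)
      moreover have "c2 * (2 * a * b + b^2 + e^2) \<le> \<bar>c2\<bar> * \<bar>2 * a * b + b^2 + e^2\<bar>"
        by (metis abs_ge_self abs_mult)
      moreover have "c3 * (e^3 + 3 * o'^2 * e) \<le> \<bar>c3\<bar> * \<bar>e^3 + 3 * o'^2 * e\<bar>"
        by (metis abs_ge_self abs_mult)
      moreover have "C0 * (((e + o')^4 * (1 + (e + o')^(2*m)) + (e - o')^4 * (1 + (e - o')^(2*m))) / 2)
         \<le> C0 * (L^4 * (1 + (L * S)^(2*m)) * (s^4 * N^M))"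
        using rem[OF x1] rem[OF x2] C0 by (intro mult_left_mono) auto
      ultimately show ?thesis by linarith
    qed
    also have "\<dots> \<le> 1 + q * e + c2 * a^2 + C * (s^4 * N^M)"
      using mult_left_mono[OF q2, of "\<bar>c2\<bar>"] mult_left_mono[OF q3, of "\<bar>c3\<bar>"]
      unfolding C_def by (simp add: algebra_simps)
    finally show "((1 + (e + (a + b))) powr q + (1 + (e - (a + b))) powr q) / 2
         \<le> 1 + q * e + q * (q-1) / 2 * a^2 + C * s^4 * (1 + n)^M"
      unfolding o'_def c2_def N_def by (simp add: mult.assoc)
  qed
qed


section \<open>Isotropic Gaussian vectors\<close>

text \<open>
  A centred normal vector with covariance \<open>\<sigma>\<^sup>2 I\<close>, described through its coordinates because this is how
  the increments of a Brownian motion are given.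
\<close>

definition (in prob_space) isotropic_gaussian :: "real \<Rightarrow> ('a \<Rightarrow> real^'d) \<Rightarrow> bool" where
  "isotropic_gaussian \<sigma> W \<longleftrightarrow> indep_vars (\<lambda>_. borel) (\<lambda>k \<omega>. W \<omega> $ k) UNIV \<and>
     (\<forall>k. distributed M lborel (\<lambda>\<omega>. W \<omega> $ k) (normal_density 0 \<sigma>))"

lemma borel_measurable_vec_componentwise:
  fixes W :: "'a \<Rightarrow> real^'d"
  assumes "\<And>k. (\<lambda>\<omega>. W \<omega> $ k) \<in> borel_measurable M"
  shows "W \<in> borel_measurable M"
  by (rule borel_measurable_euclidean_space[THEN iffD2])
     (auto simp: Basis_vec_def inner_axis assms)

text \<open>
  The norm is at most the dimension times the largest coordinate, which reduces moments of a vector to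
  moments of its coordinates.
\<close>

lemma one_plus_norm_power_le:
  fixes v :: "real^'d"
  shows "(1 + norm v)^k \<le> (\<Sum>i\<in>UNIV. 2^k * (1 + real CARD('d)^k * \<bar>v$i\<bar>^k))"
proof -
  have "Max (range (\<lambda>i. \<bar>v$i\<bar>)) \<in> range (\<lambda>i. \<bar>v$i\<bar>)" by (rule Max_in) auto
  then obtain i where "Max (range (\<lambda>i. \<bar>v$i\<bar>)) = \<bar>v$i\<bar>" by blast
  then have i: "\<bar>v$j\<bar> \<le> \<bar>v$i\<bar>" for j by (metis Max_ge finite_class.finite_UNIV finite_imageI rangeI)
  have "norm v \<le> (\<Sum>j\<in>UNIV. \<bar>v$j\<bar>)" by (rule norm_le_l1_cart)
  also have "\<dots> \<le> (\<Sum>j\<in>(UNIV::'d set). \<bar>v$i\<bar>)" by (intro sum_mono i)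
  finally have nv: "norm v \<le> real CARD('d) * \<bar>v$i\<bar>" by simp
  define y where "y = real CARD('d) * \<bar>v$i\<bar>"
  have y: "0 \<le> y" unfolding y_def by simp
  have "(1 + norm v)^k \<le> (1 + y)^k" using nv unfolding y_def by (intro power_mono) auto
  also have "\<dots> \<le> (2 * max 1 y)^k" using y by (intro power_mono) auto
  also have "\<dots> = 2^k * (max 1 y)^k" by (simp add: power_mult_distrib)
  also have "(max 1 y)^k \<le> 1 + y^k" using y by (auto simp: max_def)
  finally have "(1 + norm v)^k \<le> 2^k * (1 + real CARD('d)^k * \<bar>v$i\<bar>^k)"
    unfolding y_def by (simp add: power_mult_distrib)
  also have "\<dots> \<le> (\<Sum>i\<in>UNIV. 2^k * (1 + real CARD('d)^k * \<bar>v$i\<bar>^k))"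
    by (rule member_le_sum[where f="\<lambda>i. 2^k * (1 + real CARD('d)^k * \<bar>v$i\<bar>^k)"]) auto
  finally show ?thesis .
qed

context prob_space
begin

lemma isotropic_gaussian_component_measurable:
  assumes "isotropic_gaussian \<sigma> W" shows "(\<lambda>\<omega>. W \<omega> $ k) \<in> borel_measurable M"
  using assms distributed_measurable[of M lborel "\<lambda>\<omega>. W \<omega> $ k" "normal_density 0 \<sigma>"]
  unfolding isotropic_gaussian_def by auto

lemma isotropic_gaussian_measurable:
  assumes "isotropic_gaussian \<sigma> W" shows "W \<in> borel_measurable M"
  by (intro borel_measurable_vec_componentwise isotropic_gaussian_component_measurable[OF assms])

text \<open>
  Each coordinate has a symmetric law, and by independence the joint law is the product of these.
\<close>

lemma isotropic_gaussian_symmetric: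
  fixes W :: "'a \<Rightarrow> real^'d"
  assumes W: "isotropic_gaussian \<sigma> W" and \<sigma>: "0 < \<sigma>"
  shows "distr M borel (\<lambda>\<omega>. - W \<omega>) = distr M borel W"
proof -
  have ind: "indep_vars (\<lambda>_. borel) (\<lambda>k \<omega>. W \<omega> $ k) UNIV"
    and d: "\<And>k. distributed M lborel (\<lambda>\<omega>. W \<omega> $ k) (normal_density 0 \<sigma>)"
    using W unfolding isotropic_gaussian_def by auto
  have rv [measurable]: "(\<lambda>\<omega>. W \<omega> $ k) \<in> borel_measurable M" for k
    by (rule isotropic_gaussian_component_measurable[OF W])
  have ind': "indep_vars (\<lambda>_. borel) (\<lambda>k \<omega>. - (W \<omega> $ k)) UNIV"
    by (rule indep_vars_compose2[OF ind, where Y="\<lambda>_ x. - x"]) simp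
  have marg: "distr M borel (\<lambda>\<omega>. - (W \<omega> $ k)) = distr M borel (\<lambda>\<omega>. W \<omega> $ k)" for k
  proof -
    have "distributed M lborel (\<lambda>\<omega>. 0 + (-1) * W \<omega> $ k) (normal_density (0 + (-1) * 0) (\<bar>-1\<bar> * \<sigma>))"
      by (rule normal_density_affine[OF d \<sigma>]) simp
    then have "distr M lborel (\<lambda>\<omega>. - (W \<omega> $ k)) = distr M lborel (\<lambda>\<omega>. W \<omega> $ k)"
      using distributed_distr_eq_density[OF d[of k]] by (simp add: distributed_distr_eq_density)
    then show ?thesis by (metis distr_cong sets_lborel)
  qed
  have joint: "distr M (Pi\<^sub>M UNIV (\<lambda>_. borel)) (\<lambda>\<omega>. \<lambda>k\<in>UNIV. - (W \<omega> $ k))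
      = distr M (Pi\<^sub>M UNIV (\<lambda>_. borel)) (\<lambda>\<omega>. \<lambda>k\<in>UNIV. W \<omega> $ k)"
    using indep_vars_iff_distr_eq_PiM[where I=UNIV and X="\<lambda>k \<omega>. W \<omega> $ k" and M'="\<lambda>_. borel"]
      indep_vars_iff_distr_eq_PiM[where I=UNIV and X="\<lambda>k \<omega>. - (W \<omega> $ k)" and M'="\<lambda>_. borel"]
      ind ind' marg by simp
  define T :: "('d \<Rightarrow> real) \<Rightarrow> real^'d" where "T = (\<lambda>u. \<chi> k. u k)"
  have T [measurable]: "T \<in> measurable (Pi\<^sub>M UNIV (\<lambda>_. borel)) borel"
    unfolding T_def by (rule borel_measurable_vec_componentwise) simp
  have R [measurable]: "(\<lambda>\<omega>. \<lambda>k\<in>UNIV. W \<omega> $ k) \<in> measurable M (Pi\<^sub>M UNIV (\<lambda>_. borel))"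
    "(\<lambda>\<omega>. \<lambda>k\<in>UNIV. - (W \<omega> $ k)) \<in> measurable M (Pi\<^sub>M UNIV (\<lambda>_. borel))"
    by measurable
  have TR: "T \<circ> (\<lambda>\<omega>. \<lambda>k\<in>UNIV. W \<omega> $ k) = W" "T \<circ> (\<lambda>\<omega>. \<lambda>k\<in>UNIV. - (W \<omega> $ k)) = (\<lambda>\<omega>. - W \<omega>)"
    by (auto simp: T_def fun_eq_iff vec_eq_iff)
  have "distr M borel (\<lambda>\<omega>. - W \<omega>)
      = distr (distr M (Pi\<^sub>M UNIV (\<lambda>_. borel)) (\<lambda>\<omega>. \<lambda>k\<in>UNIV. - (W \<omega> $ k))) borel T"
    unfolding distr_distr[OF T R(2)] TR ..
  also have "\<dots> = distr M borel W"
    unfolding joint distr_distr[OF T R(1)] TR ..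
  finally show ?thesis .
qed

lemma isotropic_gaussian_symmetrise:
  fixes W :: "'a \<Rightarrow> real^'d" and \<phi> :: "real^'d \<Rightarrow> ennreal"
  assumes W: "isotropic_gaussian \<sigma> W" and \<sigma>: "0 < \<sigma>" and \<phi> [measurable]: "\<phi> \<in> borel_measurable borel"
  shows "(\<integral>\<^sup>+\<omega>. \<phi> (- W \<omega>) \<partial>M) = (\<integral>\<^sup>+\<omega>. \<phi> (W \<omega>) \<partial>M)"
proof -
  note [measurable] = isotropic_gaussian_measurable[OF W]
  have "(\<integral>\<^sup>+\<omega>. \<phi> (- W \<omega>) \<partial>M) = (\<integral>\<^sup>+x. \<phi> x \<partial>distr M borel (\<lambda>\<omega>. - W \<omega>))"
    by (simp add: nn_integral_distr)
  also have "\<dots> = (\<integral>\<^sup>+\<omega>. \<phi> (W \<omega>) \<partial>M)"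
    unfolding isotropic_gaussian_symmetric[OF W \<sigma>] by (simp add: nn_integral_distr)
  finally show ?thesis .
qed

lemma isotropic_gaussian_covariance:
  fixes W :: "'a \<Rightarrow> real^'d"
  assumes W: "isotropic_gaussian \<sigma> W" and \<sigma>: "0 < \<sigma>"
  shows "has_bochner_integral M (\<lambda>\<omega>. W \<omega> $ i * W \<omega> $ j) (if i = j then \<sigma>\<^sup>2 else 0)"
proof -
  have ind: "indep_vars (\<lambda>_. borel) (\<lambda>k \<omega>. W \<omega> $ k) UNIV"
    and d: "\<And>k. distributed M lborel (\<lambda>\<omega>. W \<omega> $ k) (normal_density 0 \<sigma>)"
    using W unfolding isotropic_gaussian_def by auto
  have int1: "integrable M (\<lambda>\<omega>. W \<omega> $ k)" for k
    using integrable_normal_moment[OF \<sigma>, of 0 1] distributed_integrable[OF d[of k], of "\<lambda>x. x"]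
    by simp
  have mean: "(\<integral>\<omega>. W \<omega> $ k \<partial>M) = 0" for k
    using integral_normal_moment_nz_1[OF \<sigma>, of 0] distributed_integral[OF d[of k], of "\<lambda>x. x"]
    by simp
  show ?thesis
  proof (cases "i = j")
    case True
    have "integrable M (\<lambda>\<omega>. (W \<omega> $ i)^2)"
      using integrable_normal_moment[OF \<sigma>, of 0 2] distributed_integrable[OF d[of i], of "\<lambda>x. x^2"]
      by simp
    moreover have "(\<integral>\<omega>. (W \<omega> $ i)^2 \<partial>M) = \<sigma>\<^sup>2"
      using integral_normal_moment_even[OF \<sigma>, of 0 1] distributed_integral[OF d[of i], of "\<lambda>x. x^2"]
      by (simp add: fact_2)
    ultimately show ?thesis using True
      by (simp add: has_bochner_integral_iff power2_eq_square)
  next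
    case False
    have ij: "indep_vars (\<lambda>_. borel) (\<lambda>k \<omega>. W \<omega> $ k) {i, j}"
      using ind by (rule indep_vars_subset) simp
    have "integrable M (\<lambda>\<omega>. W \<omega> $ i * W \<omega> $ j)" "(\<integral>\<omega>. W \<omega> $ i * W \<omega> $ j \<partial>M) = 0"
      using indep_vars_integrable[OF _ ij int1] indep_vars_lebesgue_integral[OF _ ij int1] mean False
      by auto
    then show ?thesis using False by (simp add: has_bochner_integral_iff)
  qed
qed

text \<open>
  The bound does not depend on \<open>\<sigma>\<close>: this makes the error of one Euler step uniform in the step size.
\<close>

lemma isotropic_gaussian_moment:
  fixes W :: "'a \<Rightarrow> real^'d"
  assumes W: "isotropic_gaussian \<sigma> W" and \<sigma>: "0 < \<sigma>"
  shows "integrable M (\<lambda>\<omega>. (1 + norm (W \<omega>) / \<sigma>)^k)"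
    and "(\<integral>\<omega>. (1 + norm (W \<omega>) / \<sigma>)^k \<partial>M)
      \<le> real CARD('d) * (2^k * (1 + real CARD('d)^k * (\<integral>x. std_normal_density x * \<bar>x\<bar>^k \<partial>lborel)))"
proof -
  have d: "\<And>i. distributed M lborel (\<lambda>\<omega>. W \<omega> $ i) (normal_density 0 \<sigma>)"
    using W unfolding isotropic_gaussian_def by auto
  note [measurable] = isotropic_gaussian_measurable[OF W] isotropic_gaussian_component_measurable[OF W]
  have d1: "distributed M lborel (\<lambda>\<omega>. W \<omega> $ i / \<sigma>) std_normal_density" for i
    using normal_standard_normal_convert[OF \<sigma>, of "\<lambda>\<omega>. W \<omega> $ i" 0] d by simp
  have int: "integrable M (\<lambda>\<omega>. \<bar>W \<omega> $ i / \<sigma>\<bar>^k)" for i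
    using integrable_normal_moment_abs[of 1 0 k] distributed_integrable[OF d1[of i], of "\<lambda>x. \<bar>x\<bar>^k"]
    by simp
  have mom: "(\<integral>\<omega>. \<bar>W \<omega> $ i / \<sigma>\<bar>^k \<partial>M) = (\<integral>x. std_normal_density x * \<bar>x\<bar>^k \<partial>lborel)" for i
    using distributed_integral[OF d1[of i], of "\<lambda>x. \<bar>x\<bar>^k"] by simp
  define S where "S \<omega> = (\<Sum>i\<in>UNIV. 2^k * (1 + real CARD('d)^k * \<bar>W \<omega> $ i / \<sigma>\<bar>^k))" for \<omega>
  have le: "(1 + norm (W \<omega>) / \<sigma>)^k \<le> S \<omega>" for \<omega>
    using one_plus_norm_power_le[of "(1 / \<sigma>) *\<^sub>R W \<omega>" k] \<sigma> unfolding S_def by simp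
  have intS: "integrable M S" unfolding S_def using int by auto
  show *: "integrable M (\<lambda>\<omega>. (1 + norm (W \<omega>) / \<sigma>)^k)"
    by (rule Bochner_Integration.integrable_bound[OF intS])
       (use \<sigma> le in \<open>auto intro!: AE_I2 intro: order_trans[OF _ abs_ge_self]\<close>)
  have "(\<integral>\<omega>. (1 + norm (W \<omega>) / \<sigma>)^k \<partial>M) \<le> (\<integral>\<omega>. S \<omega> \<partial>M)"
    by (rule integral_mono[OF * intS le])
  also have "\<dots> = real CARD('d) * (2^k * (1 + real CARD('d)^k * (\<integral>x. std_normal_density x * \<bar>x\<bar>^k \<partial>lborel)))"
    unfolding S_def using int
    by (subst Bochner_Integration.integral_sum) (auto simp del: power_abs abs_divide simp: mom prob_space)
  finally show "(\<integral>\<omega>. (1 + norm (W \<omega>) / \<sigma>)^k \<partial>M)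
      \<le> real CARD('d) * (2^k * (1 + real CARD('d)^k * (\<integral>x. std_normal_density x * \<bar>x\<bar>^k \<partial>lborel)))" .
qed

end


section \<open>Quadratic forms along one Euler step\<close>

definition quad_form :: "real^'n^'n \<Rightarrow> real^'n \<Rightarrow> real" where
  "quad_form Q x = x \<bullet> (Q *v x)"

lemma norm_matrix_vector_mult_le:
  fixes A :: "real^'d^'n"
  shows "norm (A *v x) \<le> norm A * norm x"
proof -
  have "norm (A *v x) = L2_set (\<lambda>i. norm ((A *v x) $ i)) UNIV" by (rule norm_vec_def)
  also have "\<dots> \<le> L2_set (\<lambda>i. norm (A $ i) * norm x) UNIV"
    by (intro L2_set_mono) (auto simp: matrix_vector_mul_component Cauchy_Schwarz_ineq2)
  also have "\<dots> = norm A * norm x"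
    by (simp add: L2_set_left_distrib[symmetric] norm_vec_def[of A])
  finally show ?thesis .
qed

text \<open>
  The constant is the minimum of the form on the unit sphere.
\<close>

lemma sym_pos_def_coercive:
  fixes Q :: "real^'n^'n"
  assumes "sym_pos_def Q"
  obtains c where "0 < c" "\<And>x. c * (norm x)\<^sup>2 \<le> quad_form Q x"
proof -
  have cont: "continuous_on (sphere 0 1) (quad_form Q)"
    unfolding quad_form_def by (intro continuous_intros)
  have "sphere (0::real^'n) 1 \<noteq> {}" by simp
  then obtain z where z: "z \<in> sphere 0 1" and min: "\<And>y. y \<in> sphere 0 1 \<Longrightarrow> quad_form Q z \<le> quad_form Q y"
    using continuous_attains_inf[OF compact_sphere _ cont] by blast
  have "z \<noteq> 0" using z by auto
  then have "0 < quad_form Q z" using assms unfolding sym_pos_def_def quad_form_def by blast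
  moreover have "quad_form Q z * (norm x)\<^sup>2 \<le> quad_form Q x" for x
  proof (cases "x = 0")
    case False
    have "quad_form Q ((1 / norm x) *\<^sub>R x) = quad_form Q x / (norm x)\<^sup>2"
      unfolding quad_form_def by (simp add: matrix_vector_mult_scaleR power2_eq_square)
    moreover have "quad_form Q z \<le> quad_form Q ((1 / norm x) *\<^sub>R x)" using False by (intro min) simp
    ultimately have "quad_form Q z \<le> quad_form Q x / (norm x)\<^sup>2" by simp
    then show ?thesis using False by (simp add: pos_le_divide_eq)
  qed (simp add: quad_form_def)
  ultimately show ?thesis using that by blast
qed

lemma quad_form_nonneg:
  assumes "sym_pos_def Q" shows "0 \<le> quad_form Q x"
  using assms unfolding sym_pos_def_def quad_form_def by (cases "x = 0") (auto simp: less_imp_le)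

lemma quad_form_pos:
  assumes "sym_pos_def Q" "x \<noteq> 0" shows "0 < quad_form Q x"
  using assms unfolding sym_pos_def_def quad_form_def by auto

lemma norm_powr_le_quad_form:
  assumes c: "0 < c" "\<And>x. c * (norm x)\<^sup>2 \<le> quad_form Q x" and p: "0 < p"
  shows "norm x powr p \<le> (1 / c) powr (p / 2) * quad_form Q x powr (p / 2)"
proof -
  have "norm x powr p = ((norm x)\<^sup>2) powr (p / 2)"
    by (cases "x = 0") (auto simp: powr_realpow[symmetric] powr_powr simp flip: powr_numeral)
  also have "\<dots> \<le> (1 / c * quad_form Q x) powr (p / 2)"
    using c(1) c(2)[of x] p by (intro powr_mono2) (auto simp: field_simps)
  also have "\<dots> = (1 / c) powr (p / 2) * quad_form Q x powr (p / 2)" by (rule powr_mult)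
  finally show ?thesis .
qed

lemma continuous_on_quad_form: "continuous_on S (quad_form Q)"
  unfolding quad_form_def
  by (intro continuous_intros bounded_linear.continuous_on[OF matrix_vector_mul_bounded_linear])

lemma quad_form_add:
  assumes "transpose Q = Q"
  shows "quad_form Q (x + y) = quad_form Q x + 2 * (x \<bullet> (Q *v y)) + quad_form Q y"
proof -
  have "y \<bullet> (Q *v x) = x \<bullet> (Q *v y)"
    by (metis assms dot_lmul_matrix inner_commute transpose_matrix_vector)
  then show ?thesis
    unfolding quad_form_def by (simp add: matrix_vector_right_distrib inner_add_left inner_add_right)
qed

lemma inner_matrix_vector_eq_sum:
  fixes A :: "real^'d^'d" and w :: "real^'d"
  shows "w \<bullet> (A *v w) = (\<Sum>i\<in>UNIV. \<Sum>j\<in>UNIV. A$i$j * (w$i * w$j))"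
  by (simp add: inner_vec_def matrix_vector_mult_def sum_distrib_left ac_simps)

context prob_space
begin

lemma isotropic_gaussian_quadratic:
  fixes W :: "'a \<Rightarrow> real^'d" and A :: "real^'d^'d"
  assumes W: "isotropic_gaussian \<sigma> W" and \<sigma>: "0 < \<sigma>"
  shows "has_bochner_integral M (\<lambda>\<omega>. W \<omega> \<bullet> (A *v W \<omega>)) (\<sigma>\<^sup>2 * trace A)"
proof -
  have "has_bochner_integral M (\<lambda>\<omega>. \<Sum>i\<in>UNIV. \<Sum>j\<in>UNIV. A$i$j * (W \<omega> $ i * W \<omega> $ j))
      (\<Sum>i\<in>UNIV. \<Sum>j\<in>UNIV. A$i$j * (if i = j then \<sigma>\<^sup>2 else 0))"
    by (intro has_bochner_integral_sum has_bochner_integral_mult_right isotropic_gaussian_covariance[OF W \<sigma>])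
  also have "(\<Sum>i\<in>UNIV. \<Sum>j\<in>UNIV. A$i$j * (if i = j then \<sigma>\<^sup>2 else 0)) = \<sigma>\<^sup>2 * trace A"
    by (simp add: trace_def sum_distrib_left if_distrib sum.delta cong: if_cong) (simp add: mult.commute)
  finally show ?thesis unfolding inner_matrix_vector_eq_sum .
qed

lemma isotropic_gaussian_linear_square:
  fixes W :: "'a \<Rightarrow> real^'d" and v :: "real^'d"
  assumes W: "isotropic_gaussian \<sigma> W" and \<sigma>: "0 < \<sigma>"
  shows "has_bochner_integral M (\<lambda>\<omega>. (v \<bullet> W \<omega>)\<^sup>2) (\<sigma>\<^sup>2 * (norm v)\<^sup>2)"
proof -
  define A :: "real^'d^'d" where "A = (\<chi> i j. v$i * v$j)"
  have "w \<bullet> (A *v w) = (v \<bullet> w)\<^sup>2" for w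
    unfolding inner_matrix_vector_eq_sum A_def
    by (simp add: inner_vec_def power2_eq_square sum_product ac_simps)
  moreover have "trace A = (norm v)\<^sup>2"
    unfolding A_def trace_def by (simp add: power2_norm_eq_inner inner_vec_def)
  ultimately show ?thesis using isotropic_gaussian_quadratic[OF W \<sigma>, of A] by simp
qed

text \<open>
  One explicit Euler step from \<open>z\<close> with drift \<open>u\<close> and diffusion \<open>G\<close>, measured by the power \<open>q\<close> of the
  quadratic form.  With \<open>s\<^sup>2 = h \<Delta>\<close> the linear growth of \<open>u\<close> and \<open>G\<close> makes the relative increment of the
  form a sum \<open>e + (a + b)\<close> of the shape treated in \<open>powr_even_part_le\<close>.  Taking expectations, \<open>q E(e)\<close>
  yields the generator term, \<open>E(a\<^sup>2)\<close> the Ito correction with the factor \<open>2 - 2q\<close>, and the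
  remaining error is of order \<open>s\<^sup>4\<close>, uniformly in \<open>z\<close>, \<open>u\<close>, \<open>G\<close>, \<open>h\<close> and \<open>\<Delta>\<close>.
\<close>

lemma Euler_step_moment:
  fixes Q :: "real^'n^'n" and q H :: real
  assumes Q: "sym_pos_def Q" and q: "0 < q" and H: "0 \<le> H"
  obtains C where "0 \<le> C"
    "\<And>\<Delta> h z u (G :: real^'d^'n) W. 0 < \<Delta> \<Longrightarrow> 0 \<le> h \<Longrightarrow> h * \<Delta> \<le> H \<Longrightarrow> z \<noteq> 0 \<Longrightarrow>
       norm u \<le> h * norm z \<Longrightarrow> (norm G)\<^sup>2 \<le> h * (norm z)\<^sup>2 \<Longrightarrow> isotropic_gaussian (sqrt \<Delta>) W \<Longrightarrow>
       (\<integral>\<^sup>+\<omega>. ennreal (quad_form Q (z + \<Delta> *\<^sub>R u + G *v W \<omega>) powr q) \<partial>M)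
       \<le> ennreal (quad_form Q z powr q * (1 + q * \<Delta> *
            ((2 * (z \<bullet> (Q *v u)) + trace (transpose G ** Q ** G)) / quad_form Q z
              - (2 - 2 * q) * (norm ((z v* Q) v* G))\<^sup>2 / (quad_form Q z)\<^sup>2) + C * (h * \<Delta>)\<^sup>2))"
proof -
  obtain c where c: "0 < c" and cV: "\<And>x. c * (norm x)\<^sup>2 \<le> quad_form Q x"
    using sym_pos_def_coercive[OF Q] by blast
  have sym: "transpose Q = Q" using Q unfolding sym_pos_def_def by simp
  define L where "L = norm Q / c"
  have L: "0 \<le> L" unfolding L_def using c by simp
  define K where "K = L * (2 + H)"
  have K: "0 \<le> K" "2 * L \<le> K" unfolding K_def using L H by (auto simp: algebra_simps)
  obtain C0 m where C0: "0 \<le> C0" and even_part: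
    "\<And>s n a b e. 0 \<le> s \<Longrightarrow> s \<le> sqrt H \<Longrightarrow> 0 \<le> n \<Longrightarrow> \<bar>a\<bar> \<le> K * s * n \<Longrightarrow> \<bar>b\<bar> \<le> K * s^3 * n \<Longrightarrow>
       \<bar>e\<bar> \<le> K * s^2 * (1 + n^2) \<Longrightarrow> -1 \<le> e + (a + b) \<Longrightarrow> -1 \<le> e - (a + b) \<Longrightarrow>
       ((1 + (e + (a + b))) powr q + (1 + (e - (a + b))) powr q) / 2
         \<le> 1 + q * e + q * (q-1) / 2 * a^2 + C0 * s^4 * (1 + n)^m"
    using powr_even_part_le[OF q K(1), of "sqrt H"] H by auto
  define R where "R = real CARD('d) * (2^m * (1 + real CARD('d)^m * (\<integral>x. std_normal_density x * \<bar>x\<bar>^m \<partial>lborel)))"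
  have R: "0 \<le> R" unfolding R_def
    by (intro mult_nonneg_nonneg add_nonneg_nonneg integral_nonneg_AE) auto
  show ?thesis
  proof (rule that[of "q * L + C0 * R"])
    show "0 \<le> q * L + C0 * R" using q L C0 R by simp
    fix \<Delta> h :: real and z u :: "real^'n" and G :: "real^'d^'n" and W :: "'a \<Rightarrow> real^'d"
    assume \<Delta>: "0 < \<Delta>" and h: "0 \<le> h" "h * \<Delta> \<le> H" and z: "z \<noteq> 0"
      and u: "norm u \<le> h * norm z" and G: "(norm G)\<^sup>2 \<le> h * (norm z)\<^sup>2"
      and W: "isotropic_gaussian (sqrt \<Delta>) W"
    have sD: "0 < sqrt \<Delta>" using \<Delta> by simp
    define v where "v = quad_form Q z"
    have v: "0 < v" unfolding v_def by (rule quad_form_pos[OF Q z])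
    define s where "s = sqrt (h * \<Delta>)"
    have s: "0 \<le> s" "s \<le> sqrt H" "s^2 = h * \<Delta>" unfolding s_def using h \<Delta> by auto
    have s4: "s^4 = (h * \<Delta>)^2" unfolding s(3)[symmetric] by simp
    define a where "a w = 2 * (((z v* Q) v* G) \<bullet> w) / v" for w
    define b where "b w = 2 * \<Delta> * (u \<bullet> (Q *v (G *v w))) / v" for w
    define e where "e w = (2 * \<Delta> * (z \<bullet> (Q *v u)) + \<Delta>^2 * quad_form Q u + quad_form Q (G *v w)) / v" for w
    have Q_le: "\<bar>x \<bullet> (Q *v y)\<bar> \<le> L * v * (X * Y)"
      if "norm x \<le> X * norm z" "norm y \<le> Y * norm z" "0 \<le> X" for x y X Y
    proof -
      have "\<bar>x \<bullet> (Q *v y)\<bar> \<le> norm x * norm (Q *v y)" by (rule Cauchy_Schwarz_ineq2)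
      also have "\<dots> \<le> norm x * (norm Q * norm y)"
        by (intro mult_left_mono norm_matrix_vector_mult_le) auto
      also have "\<dots> \<le> (X * norm z) * (norm Q * (Y * norm z))"
        using that by (intro mult_mono) auto
      also have "\<dots> = norm Q * (X * Y) * (norm z)^2" by (simp add: power2_eq_square)
      also have "\<dots> \<le> norm Q * (X * Y) * (v / c)"
      proof -
        have "0 \<le> Y * norm z" using that(2) norm_ge_zero order_trans by blast
        then have "0 \<le> Y" using z by (simp add: zero_le_mult_iff)
        moreover have "(norm z)^2 \<le> v / c" using cV[of z] c unfolding v_def by (simp add: field_simps)
        ultimately show ?thesis using that(3) by (intro mult_left_mono) auto
      qed
      also have "\<dots> = L * v * (X * Y)" unfolding L_def by simp
      finally show ?thesis .
    qed
    have Gw: "norm (G *v w) \<le> (s * (norm w / sqrt \<Delta>)) * norm z" for w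
    proof -
      have "norm G \<le> sqrt h * norm z"
        using real_le_rsqrt[OF G] by (simp add: real_sqrt_mult)
      then have "norm (G *v w) \<le> sqrt h * norm z * norm w"
        using norm_matrix_vector_mult_le[of G w] mult_right_mono[of "norm G" "sqrt h * norm z" "norm w"] by simp
      also have "\<dots> = (s * (norm w / sqrt \<Delta>)) * norm z" unfolding s_def using sD by (simp add: real_sqrt_mult)
      finally show ?thesis .
    qed
    have Du: "norm (\<Delta> *\<^sub>R u) \<le> s^2 * norm z"
      unfolding s(3) using mult_left_mono[OF u, of \<Delta>] \<Delta> by (simp add: ac_simps)
    have zz: "norm z \<le> 1 * norm z" by simp
    have cancel_v: "y \<le> 2 * L * t" if "v * y = 2 * X" "X \<le> L * v * t" for X y t
    proof -
      have "v * y \<le> v * (2 * L * t)" using that by (simp add: algebra_simps)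
      then show ?thesis using v by (rule mult_left_le_imp_le)
    qed
    have a_le: "\<bar>a w\<bar> \<le> K * s * (norm w / sqrt \<Delta>)" for w
    proof -
      have "\<bar>z \<bullet> (Q *v (G *v w))\<bar> \<le> L * v * (1 * (s * (norm w / sqrt \<Delta>)))"
        by (rule Q_le[OF zz Gw]) simp
      moreover have "v * \<bar>a w\<bar> = 2 * \<bar>z \<bullet> (Q *v (G *v w))\<bar>"
        unfolding a_def using v by (simp add: dot_lmul_matrix abs_mult)
      ultimately have "\<bar>a w\<bar> \<le> 2 * L * (1 * (s * (norm w / sqrt \<Delta>)))"
        by (rule cancel_v[rotated])
      then have "\<bar>a w\<bar> \<le> 2 * L * (s * (norm w / sqrt \<Delta>))" by simp
      also have "\<dots> \<le> K * (s * (norm w / sqrt \<Delta>))"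
        using K(2) s(1) \<Delta> by (intro mult_right_mono) auto
      finally show ?thesis by (simp add: mult.assoc)
    qed
    have b_le: "\<bar>b w\<bar> \<le> K * s^3 * (norm w / sqrt \<Delta>)" for w
    proof -
      have "\<bar>(\<Delta> *\<^sub>R u) \<bullet> (Q *v (G *v w))\<bar> \<le> L * v * (s^2 * (s * (norm w / sqrt \<Delta>)))"
        by (rule Q_le[OF Du Gw]) simp
      moreover have "v * \<bar>b w\<bar> = 2 * \<bar>(\<Delta> *\<^sub>R u) \<bullet> (Q *v (G *v w))\<bar>"
        unfolding b_def using v \<Delta> by (simp add: abs_mult)
      ultimately have "\<bar>b w\<bar> \<le> 2 * L * (s^2 * (s * (norm w / sqrt \<Delta>)))"
        by (rule cancel_v[rotated])
      also have "\<dots> \<le> K * (s^2 * (s * (norm w / sqrt \<Delta>)))"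
        using K(2) s(1) \<Delta> by (intro mult_right_mono) auto
      finally show ?thesis by (simp add: power2_eq_square power3_eq_cube mult.assoc)
    qed
    have uu: "\<Delta>^2 * quad_form Q u \<le> v * L * s^4" "\<bar>\<Delta>^2 * quad_form Q u\<bar> \<le> L * v * s^4"
    proof -
      have "\<bar>(\<Delta> *\<^sub>R u) \<bullet> (Q *v (\<Delta> *\<^sub>R u))\<bar> \<le> L * v * (s^2 * s^2)"
        by (rule Q_le[OF Du Du]) simp
      moreover have "(\<Delta> *\<^sub>R u) \<bullet> (Q *v (\<Delta> *\<^sub>R u)) = \<Delta>^2 * quad_form Q u"
        unfolding quad_form_def by (simp add: matrix_vector_mult_scaleR power2_eq_square)
      ultimately show "\<bar>\<Delta>^2 * quad_form Q u\<bar> \<le> L * v * s^4" by simp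
      then show "\<Delta>^2 * quad_form Q u \<le> v * L * s^4" by (simp add: ac_simps)
    qed
    have e_le: "\<bar>e w\<bar> \<le> K * s^2 * (1 + (norm w / sqrt \<Delta>)^2)" for w
    proof -
      define n where "n = norm w / sqrt \<Delta>"
      have 1: "\<bar>2 * \<Delta> * (z \<bullet> (Q *v u))\<bar> \<le> 2 * (L * v * s^2)"
      proof -
        have "\<bar>z \<bullet> (Q *v (\<Delta> *\<^sub>R u))\<bar> \<le> L * v * (1 * s^2)" by (rule Q_le[OF zz Du]) simp
        then show ?thesis by (simp add: matrix_vector_mult_scaleR abs_mult)
      qed
      have 3: "\<bar>quad_form Q (G *v w)\<bar> \<le> L * v * (s^2 * n^2)"
        unfolding quad_form_def using Q_le[OF Gw Gw] s(1) \<Delta> unfolding n_def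
        by (simp add: power2_eq_square ac_simps)
      have "\<bar>e w\<bar> * v = \<bar>2 * \<Delta> * (z \<bullet> (Q *v u)) + \<Delta>^2 * quad_form Q u + quad_form Q (G *v w)\<bar>"
        unfolding e_def using v by simp
      also have "\<dots> \<le> 2 * (L * v * s^2) + L * v * s^4 + L * v * (s^2 * n^2)"
        using 1 3 uu(2) by linarith
      also have "\<dots> = L * (2 + s^2 + n^2) * s^2 * v" by (simp add: algebra_simps eval_nat_numeral)
      finally have "\<bar>e w\<bar> \<le> L * (2 + s^2 + n^2) * s^2" using v by simp
      also have "\<dots> \<le> L * ((2 + H) * (1 + n^2)) * s^2"
      proof -
        have "2 + s^2 + n^2 \<le> 2 + H + n^2" using s(3) h(2) by simp
        also have "\<dots> \<le> 2 + H + n^2 + (n^2 + H * n^2)" using H by simp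
        also have "\<dots> = (2 + H) * (1 + n^2)" by (simp add: algebra_simps)
        finally have "2 + s^2 + n^2 \<le> (2 + H) * (1 + n^2)" .
        then show ?thesis using L by (intro mult_right_mono mult_left_mono) auto
      qed
      also have "\<dots> = K * s^2 * (1 + n^2)" unfolding K_def by (simp add: ac_simps)
      finally show ?thesis unfolding n_def .
    qed
    have expand: "quad_form Q (z + \<Delta> *\<^sub>R u + G *v w) = v * (1 + (e w + (a w + b w)))"
      and expand': "quad_form Q (z + \<Delta> *\<^sub>R u + G *v (- w)) = v * (1 + (e w - (a w + b w)))" for w
    proof -
      have qs: "quad_form Q (\<Delta> *\<^sub>R u) = \<Delta>^2 * quad_form Q u"
        unfolding quad_form_def by (simp add: matrix_vector_mult_scaleR power2_eq_square)
      have ve: "v * e w = 2 * \<Delta> * (z \<bullet> (Q *v u)) + \<Delta>^2 * quad_form Q u + quad_form Q (G *v w)"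
        and va: "v * a w = 2 * (z \<bullet> (Q *v (G *v w)))"
        and vb: "v * b w = 2 * \<Delta> * (u \<bullet> (Q *v (G *v w)))"
        unfolding e_def a_def b_def using v by (simp_all add: dot_lmul_matrix)
      have "quad_form Q (z + \<Delta> *\<^sub>R u + G *v w) = v + v * e w + v * a w + v * b w"
        unfolding ve va vb unfolding quad_form_add[OF sym] qs v_def
        by (simp add: matrix_vector_mult_scaleR inner_add_left algebra_simps)
      then show "quad_form Q (z + \<Delta> *\<^sub>R u + G *v w) = v * (1 + (e w + (a w + b w)))"
        by (simp add: algebra_simps)
      have neg: "A *v (- x) = - (A *v x)" for A :: "real^'k^'l" and x
        by (simp add: vec_eq_iff matrix_vector_mult_def sum_negf)
      have "quad_form Q (z + \<Delta> *\<^sub>R u + G *v (- w)) = v + v * e w - v * a w - v * b w"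
        unfolding ve va vb unfolding quad_form_add[OF sym] qs v_def neg
        by (simp add: matrix_vector_mult_scaleR inner_add_left algebra_simps quad_form_def neg)
      then show "quad_form Q (z + \<Delta> *\<^sub>R u + G *v (- w)) = v * (1 + (e w - (a w + b w)))"
        by (simp add: algebra_simps)
    qed
    define \<phi> where "\<phi> w = ennreal (quad_form Q (z + \<Delta> *\<^sub>R u + G *v w) powr q)" for w
    have \<phi>_meas [measurable]: "\<phi> \<in> borel_measurable borel"
    proof -
      have "continuous_on UNIV (\<lambda>w. quad_form Q (z + \<Delta> *\<^sub>R u + G *v w))"
        unfolding quad_form_def
        by (intro continuous_intros bounded_linear.continuous_on[OF matrix_vector_mul_bounded_linear])
      then have [measurable]: "(\<lambda>w. quad_form Q (z + \<Delta> *\<^sub>R u + G *v w)) \<in> borel_measurable borel"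
        by (rule borel_measurable_continuous_onI)
      show ?thesis unfolding \<phi>_def by measurable
    qed
    note [measurable] = isotropic_gaussian_measurable[OF W]
    define n where "n \<omega> = norm (W \<omega>) / sqrt \<Delta>" for \<omega>
    define Y where "Y \<omega> = 1 + q * e (W \<omega>) + q * (q-1) / 2 * (a (W \<omega>))^2 + C0 * s^4 * (1 + n \<omega>)^m" for \<omega>
    have x: "-1 \<le> e w + (a w + b w)" "-1 \<le> e w - (a w + b w)" for w
    proof -
      have "0 \<le> v * (1 + (e w + (a w + b w)))" "0 \<le> v * (1 + (e w - (a w + b w)))"
        unfolding expand'[symmetric] unfolding expand[symmetric] by (rule quad_form_nonneg[OF Q])+
      then show "-1 \<le> e w + (a w + b w)" "-1 \<le> e w - (a w + b w)"
        using v by (auto simp: zero_le_mult_iff)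
    qed
    have avg: "((1 + (e w + (a w + b w))) powr q + (1 + (e w - (a w + b w))) powr q) / 2 \<le> Y \<omega>"
      if "w = W \<omega>" for w \<omega>
      unfolding Y_def n_def that[symmetric]
      by (rule even_part[OF s(1,2) _ a_le b_le e_le x]) (use \<Delta> in auto)
    have pw: "\<phi> (W \<omega>) + \<phi> (- W \<omega>) \<le> 2 * ennreal (v powr q * Y \<omega>)" for \<omega>
    proof -
      define w where "w = W \<omega>"
      have "(1 + (e w + (a w + b w))) powr q + (1 + (e w - (a w + b w))) powr q \<le> 2 * Y \<omega>"
        using avg[OF w_def] by simp
      moreover have pm: "(v * (1 + y)) powr q = v powr q * (1 + y) powr q" if "-1 \<le> y" for y
        by (rule powr_mult)
      ultimately have "v powr q * ((1 + (e w + (a w + b w))) powr q + (1 + (e w - (a w + b w))) powr q) \<le> v powr q * (2 * Y \<omega>)"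
        by (intro mult_left_mono) auto
      then have "ennreal (v powr q * ((1 + (e w + (a w + b w))) powr q + (1 + (e w - (a w + b w))) powr q))
        \<le> ennreal (2 * (v powr q * Y \<omega>))" by (intro ennreal_leI) (simp add: ac_simps)
      also have "ennreal (2 * (v powr q * Y \<omega>)) = 2 * ennreal (v powr q * Y \<omega>)"
        by (simp add: ennreal_mult')
      finally show ?thesis
        unfolding \<phi>_def w_def[symmetric] expand' unfolding expand
        using pm x[of w] by (simp add: ennreal_plus[symmetric] distrib_left[symmetric] del: ennreal_plus distrib_left_numeral)
    qed
    \<comment> \<open>Symmetrisation: the increment and its negative have the same law.\<close>
    have "2 * (\<integral>\<^sup>+\<omega>. \<phi> (W \<omega>) \<partial>M) = (\<integral>\<^sup>+\<omega>. \<phi> (W \<omega>) + \<phi> (- W \<omega>) \<partial>M)"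
      using isotropic_gaussian_symmetrise[OF W sD \<phi>_meas] by (simp add: nn_integral_add mult_2)
    also have "\<dots> \<le> (\<integral>\<^sup>+\<omega>. 2 * ennreal (v powr q * Y \<omega>) \<partial>M)" by (intro nn_integral_mono pw)
    finally have two: "2 * (\<integral>\<^sup>+\<omega>. \<phi> (W \<omega>) \<partial>M) \<le> (\<integral>\<^sup>+\<omega>. 2 * ennreal (v powr q * Y \<omega>) \<partial>M)" .
    have eI: "has_bochner_integral M (\<lambda>\<omega>. e (W \<omega>))
      ((2 * \<Delta> * (z \<bullet> (Q *v u)) + \<Delta>^2 * quad_form Q u + \<Delta> * trace (transpose G ** Q ** G)) / v)"
    proof -
      have "w \<bullet> (transpose G *v y) = (G *v w) \<bullet> y" for w y
        using dot_lmul_matrix[of w "transpose G" y] by (simp only: vector_transpose_matrix)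
      then have "quad_form Q (G *v w) = w \<bullet> ((transpose G ** Q ** G) *v w)" for w
        unfolding quad_form_def by (simp only: matrix_vector_mul_assoc[symmetric])
      then have "has_bochner_integral M (\<lambda>\<omega>. quad_form Q (G *v W \<omega>)) ((sqrt \<Delta>)^2 * trace (transpose G ** Q ** G))"
        using isotropic_gaussian_quadratic[OF W sD] by simp
      then show ?thesis unfolding e_def using \<Delta>
        by (intro has_bochner_integral_divide_zero has_bochner_integral_add) (auto simp: has_bochner_integral_iff prob_space)
    qed
    have aI: "has_bochner_integral M (\<lambda>\<omega>. (a (W \<omega>))^2) (4 * \<Delta> * (norm ((z v* Q) v* G))\<^sup>2 / v^2)"
    proof -
      have "has_bochner_integral M (\<lambda>\<omega>. 4 / v^2 * (((z v* Q) v* G) \<bullet> W \<omega>)^2) (4 / v^2 * ((sqrt \<Delta>)^2 * (norm ((z v* Q) v* G))\<^sup>2))"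
        by (intro has_bochner_integral_mult_right isotropic_gaussian_linear_square[OF W sD])
      then show ?thesis unfolding a_def using \<Delta> by (simp add: power_divide power_mult_distrib mult.assoc)
    qed
    have nI: "integrable M (\<lambda>\<omega>. (1 + n \<omega>)^m)" "(\<integral>\<omega>. (1 + n \<omega>)^m \<partial>M) \<le> R"
      unfolding n_def R_def using isotropic_gaussian_moment[OF W sD] by auto
    have Yint: "integrable M Y" unfolding Y_def
      using nI(1) eI aI by (auto simp: has_bochner_integral_iff)
    have EY: "(\<integral>\<omega>. Y \<omega> \<partial>M) \<le> 1 + q * \<Delta> *
            ((2 * (z \<bullet> (Q *v u)) + trace (transpose G ** Q ** G)) / v
              - (2 - 2 * q) * (norm ((z v* Q) v* G))\<^sup>2 / v\<^sup>2) + (q * L + C0 * R) * (h * \<Delta>)\<^sup>2"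
    proof -
      have "(\<integral>\<omega>. Y \<omega> \<partial>M) = 1 + q * ((2 * \<Delta> * (z \<bullet> (Q *v u)) + \<Delta>^2 * quad_form Q u + \<Delta> * trace (transpose G ** Q ** G)) / v)
         + q * (q-1) / 2 * (4 * \<Delta> * (norm ((z v* Q) v* G))\<^sup>2 / v^2) + C0 * s^4 * (\<integral>\<omega>. (1 + n \<omega>)^m \<partial>M)"
        unfolding Y_def using nI(1) eI aI by (simp add: has_bochner_integral_iff prob_space)
      also have "\<dots> \<le> 1 + q * ((2 * \<Delta> * (z \<bullet> (Q *v u)) + v * L * s^4 + \<Delta> * trace (transpose G ** Q ** G)) / v)
         + q * (q-1) / 2 * (4 * \<Delta> * (norm ((z v* Q) v* G))\<^sup>2 / v^2) + C0 * s^4 * R"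
      proof -
        have "q * ((2 * \<Delta> * (z \<bullet> (Q *v u)) + \<Delta>^2 * quad_form Q u + \<Delta> * trace (transpose G ** Q ** G)) / v)
          \<le> q * ((2 * \<Delta> * (z \<bullet> (Q *v u)) + v * L * s^4 + \<Delta> * trace (transpose G ** Q ** G)) / v)"
          using uu(1) v q by (intro mult_left_mono divide_right_mono) auto
        moreover have "C0 * s^4 * (\<integral>\<omega>. (1 + n \<omega>)^m \<partial>M) \<le> C0 * s^4 * R"
          using C0 nI(2) by (intro mult_left_mono) auto
        ultimately show ?thesis by linarith
      qed
      also have "\<dots> = 1 + q * \<Delta> *
            ((2 * (z \<bullet> (Q *v u)) + trace (transpose G ** Q ** G)) / v
              - (2 - 2 * q) * (norm ((z v* Q) v* G))\<^sup>2 / v\<^sup>2) + (q * L + C0 * R) * s^4"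
        using v by (simp add: field_simps)
      finally show ?thesis unfolding s4 .
    qed
    have "(\<integral>\<^sup>+\<omega>. \<phi> (W \<omega>) \<partial>M) \<le> (\<integral>\<^sup>+\<omega>. ennreal (v powr q * Y \<omega>) \<partial>M)"
      using two Yint by (subst (asm) nn_integral_cmult) (auto simp: ennreal_mult_le_mult_iff)
    also have "\<dots> = ennreal (\<integral>\<omega>. v powr q * Y \<omega> \<partial>M)"
    proof (rule nn_integral_eq_integral)
      show "AE \<omega> in M. 0 \<le> v powr q * Y \<omega>"
      proof (rule AE_I2)
        fix \<omega>
        have "0 \<le> ((1 + (e (W \<omega>) + (a (W \<omega>) + b (W \<omega>)))) powr q
            + (1 + (e (W \<omega>) - (a (W \<omega>) + b (W \<omega>)))) powr q) / 2" by simp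
        also have "\<dots> \<le> Y \<omega>" by (rule avg) simp
        finally show "0 \<le> v powr q * Y \<omega>" by simp
      qed
    qed (use Yint in auto)
    also have "\<dots> \<le> ennreal (v powr q * (1 + q * \<Delta> *
            ((2 * (z \<bullet> (Q *v u)) + trace (transpose G ** Q ** G)) / v
              - (2 - 2 * q) * (norm ((z v* Q) v* G))\<^sup>2 / v\<^sup>2) + (q * L + C0 * R) * (h * \<Delta>)\<^sup>2))"
      using EY by (intro ennreal_leI) (simp add: mult_left_mono)
    finally show "(\<integral>\<^sup>+\<omega>. ennreal (quad_form Q (z + \<Delta> *\<^sub>R u + G *v W \<omega>) powr q) \<partial>M)
       \<le> ennreal (quad_form Q z powr q * (1 + q * \<Delta> *
            ((2 * (z \<bullet> (Q *v u)) + trace (transpose G ** Q ** G)) / quad_form Q z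
              - (2 - 2 * q) * (norm ((z v* Q) v* G))\<^sup>2 / (quad_form Q z)\<^sup>2) + (q * L + C0 * R) * (h * \<Delta>)\<^sup>2))"
      unfolding \<phi>_def v_def .
  qed
qed

end


section \<open>Measurability of the truncated scheme\<close>

lemma truncate_eq_scaleR:
  assumes "0 \<le> R"
  obtains c where "0 \<le> c" "c \<le> 1" "truncate R x = c *\<^sub>R x"
proof (cases "x = 0")
  case True then show ?thesis using that[of 0] by (simp add: truncate_def)
next
  case False
  have r: "0 \<le> real_of_ereal (min (ereal (norm x)) R)" "real_of_ereal (min (ereal (norm x)) R) \<le> norm x"
    using assms by (cases R; auto simp: min_def)+
  show ?thesis
  proof (rule that)
    show "truncate R x = (real_of_ereal (min (ereal (norm x)) R) / norm x) *\<^sub>R x"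
      by (simp add: truncate_def sgn_div_norm divide_inverse)
  qed (use r False in simp_all)
qed

lemma norm_truncate_le:
  assumes "0 \<le> R" shows "ereal (norm (truncate R x)) \<le> R"
proof (cases "x = 0")
  case True then show ?thesis using assms by (simp add: truncate_def zero_ereal_def[symmetric])
next
  case False
  then show ?thesis using assms
    by (cases R) (auto simp: truncate_def norm_sgn min_def)
qed

lemma borel_measurable_truncate [measurable]: "truncate R \<in> borel_measurable borel"
  unfolding truncate_def[abs_def] sgn_div_norm by measurable

lemma borel_measurable_matrix_vector_mult:
  fixes G :: "'a \<Rightarrow> real^'d^'n" and b :: "'a \<Rightarrow> real^'d"
  assumes "G \<in> borel_measurable N" "b \<in> borel_measurable N"
  shows "(\<lambda>\<omega>. G \<omega> *v b \<omega>) \<in> borel_measurable N"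
proof -
  have "continuous_on UNIV (\<lambda>p :: (real^'d^'n) \<times> (real^'d). fst p *v snd p)"
    unfolding matrix_vector_mult_def by (intro continuous_intros)
  then show ?thesis by (rule borel_measurable_continuous_Pair[OF assms])
qed

lemma lipschitz_on_cballs_borel_measurable:
  fixes f :: "real^'n \<Rightarrow> 'b::{metric_space}"
  assumes "\<forall>R. \<exists>L. L-lipschitz_on (cball 0 R) f"
  shows "f \<in> borel_measurable borel"
proof -
  have "isCont f x" for x
  proof -
    obtain L where "L-lipschitz_on (cball 0 (norm x + 1)) f" using assms by blast
    then have "continuous_on (cball 0 (norm x + 1)) f" by (rule lipschitz_on_continuous_on)
    moreover have "x \<in> interior (cball 0 (norm x + 1))" by simp
    ultimately show ?thesis by (rule continuous_on_interior)
  qed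
  then have "continuous_on UNIV f" by (simp add: continuous_at_imp_continuous_on)
  then show ?thesis by (rule borel_measurable_continuous_onI)
qed

text \<open>
  The algebra \<open>N\<close> is arbitrary because the scheme has to be measurable for several ones: the filtration, for
  the Markov property, and the algebra \<open>driving_algebra\<close> below, for the independence of the next
  increment.
\<close>

lemma tem_measurable:
  fixes r :: "real \<Rightarrow> 'a \<Rightarrow> 's::finite" and B :: "real \<Rightarrow> 'a \<Rightarrow> real^'d"
    and f :: "real^'n \<Rightarrow> 's \<Rightarrow> real^'n" and g :: "real^'n \<Rightarrow> 's \<Rightarrow> real^'d^'n"
  assumes [measurable]: "\<And>i. (\<lambda>x. f x i) \<in> borel_measurable borel" "\<And>i. (\<lambda>x. g x i) \<in> borel_measurable borel"
    and \<Delta>: "0 \<le> \<Delta>"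
    and B: "\<And>u. 0 \<le> u \<Longrightarrow> u \<le> real k * \<Delta> \<Longrightarrow> B u \<in> borel_measurable N"
    and r: "\<And>u. 0 \<le> u \<Longrightarrow> u \<le> real k * \<Delta> \<Longrightarrow> r u \<in> measurable N (count_space UNIV)"
  shows "tem_pre f g \<phi>inv h B r x\<^sub>0 \<Delta> k \<in> borel_measurable N"
    and "tem f g \<phi>inv h B r x\<^sub>0 \<Delta> k \<in> borel_measurable N"
proof -
  have pre: "j \<le> k \<Longrightarrow> tem_pre f g \<phi>inv h B r x\<^sub>0 \<Delta> j \<in> borel_measurable N" for j
  proof (induction j)
    case (Suc j)
    have t: "0 \<le> real j * \<Delta>" "real j * \<Delta> \<le> real k * \<Delta>" "0 \<le> real (Suc j) * \<Delta>" "real (Suc j) * \<Delta> \<le> real k * \<Delta>"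
      using Suc.prems \<Delta> by (auto intro: mult_right_mono mult_nonneg_nonneg)
    have [measurable]: "tem_pre f g \<phi>inv h B r x\<^sub>0 \<Delta> j \<in> borel_measurable N" using Suc by simp
    have [measurable]: "B (real j * \<Delta>) \<in> borel_measurable N" "B (real (Suc j) * \<Delta>) \<in> borel_measurable N"
      using B t by auto
    have rj: "r (real j * \<Delta>) \<in> measurable N (count_space UNIV)" using r t by auto
    define \<Psi> where "\<Psi> i \<omega> = (let z = truncate (\<phi>inv i (h \<Delta>)) (tem_pre f g \<phi>inv h B r x\<^sub>0 \<Delta> j \<omega>)
      in z + \<Delta> *\<^sub>R f z i + g z i *v (B (real (Suc j) * \<Delta>) \<omega> - B (real j * \<Delta>) \<omega>))" for i \<omega>
    have "\<Psi> i \<in> borel_measurable N" for i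
      unfolding \<Psi>_def Let_def by (intro borel_measurable_add borel_measurable_matrix_vector_mult; measurable)
    then have "(\<lambda>\<omega>. \<Psi> (r (real j * \<Delta>) \<omega>) \<omega>) \<in> borel_measurable N"
      using rj by (rule measurable_compose_countable)
    then show ?case by (simp add: \<Psi>_def Let_def)
  qed simp
  show "tem_pre f g \<phi>inv h B r x\<^sub>0 \<Delta> k \<in> borel_measurable N" using pre by simp
  have "(\<lambda>\<omega>. truncate (\<phi>inv i (h \<Delta>)) (tem_pre f g \<phi>inv h B r x\<^sub>0 \<Delta> k \<omega>)) \<in> borel_measurable N" for i
    using pre[of k] by measurable
  then have "(\<lambda>\<omega>. truncate (\<phi>inv (r (real k * \<Delta>) \<omega>) (h \<Delta>)) (tem_pre f g \<phi>inv h B r x\<^sub>0 \<Delta> k \<omega>)) \<in> borel_measurable N"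
    by (rule measurable_compose_countable) (use r \<Delta> in auto)
  then show "tem f g \<phi>inv h B r x\<^sub>0 \<Delta> k \<in> borel_measurable N" unfolding tem_def[abs_def] .
qed

section \<open>Independence of the next increment\<close>

text \<open>
  Integrating out an independent variable.  The independence is that of two \<open>\<sigma>\<close>-algebras, so that \<open>X\<close>
  and \<open>Y\<close> may take values in different types.
\<close>

lemma (in prob_space) nn_integral_indep:
  assumes ind: "indep_set (sets D) (sets (vimage_algebra (space M) Y T))"
    and D: "space D = space M" and X: "X \<in> measurable D S" and Y [measurable]: "Y \<in> measurable M T"
    and \<phi> [measurable]: "\<phi> \<in> borel_measurable (S \<Otimes>\<^sub>M T)"
  shows "(\<integral>\<^sup>+\<omega>. \<phi> (X \<omega>, Y \<omega>) \<partial>M) = (\<integral>\<^sup>+\<omega>. (\<integral>\<^sup>+\<omega>'. \<phi> (X \<omega>, Y \<omega>') \<partial>M) \<partial>M)"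
proof -
  have XM [measurable]: "X \<in> measurable M S"
    using measurable_from_subalg[OF _ X] indep_setD_ev1[OF ind] D by (simp add: subalgebra_def)
  interpret X: prob_space "distr M S X" by (rule prob_space_distr) fact
  interpret Y: prob_space "distr M T Y" by (rule prob_space_distr) fact
  have prod: "distr M S X \<Otimes>\<^sub>M distr M T Y = distr M (S \<Otimes>\<^sub>M T) (\<lambda>\<omega>. (X \<omega>, Y \<omega>))" (is "_ = ?J")
  proof (rule pair_measure_eqI)
    show "sigma_finite_measure (distr M S X)" "sigma_finite_measure (distr M T Y)" by unfold_locales
    fix A C assume A: "A \<in> sets (distr M S X)" and C: "C \<in> sets (distr M T Y)"
    have a: "X -` A \<inter> space M \<in> sets D" using measurable_sets[OF X, of A] A D by simp
    have c: "Y -` C \<inter> space M \<in> sets (vimage_algebra (space M) Y T)"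
      using C by (intro in_vimage_algebra) simp
    have "emeasure ?J (A \<times> C) = emeasure M ((\<lambda>\<omega>. (X \<omega>, Y \<omega>)) -` (A \<times> C) \<inter> space M)"
      using A C by (intro emeasure_distr) auto
    also have "(\<lambda>\<omega>. (X \<omega>, Y \<omega>)) -` (A \<times> C) \<inter> space M = (X -` A \<inter> space M) \<inter> (Y -` C \<inter> space M)"
      by auto
    also have "emeasure M \<dots> = emeasure M (X -` A \<inter> space M) * emeasure M (Y -` C \<inter> space M)"
      using indep_setD[OF ind a c] by (simp add: emeasure_eq_measure ennreal_mult)
    also have "\<dots> = emeasure (distr M S X) A * emeasure (distr M T Y) C"
      using A C by (simp add: emeasure_distr)
    finally show "emeasure (distr M S X) A * emeasure (distr M T Y) C = emeasure ?J (A \<times> C)" by simp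
  qed simp
  have "(\<integral>\<^sup>+\<omega>. \<phi> (X \<omega>, Y \<omega>) \<partial>M) = (\<integral>\<^sup>+z. \<phi> z \<partial>?J)"
    by (subst nn_integral_distr) auto
  also have "\<dots> = (\<integral>\<^sup>+x. \<integral>\<^sup>+y. \<phi> (x, y) \<partial>distr M T Y \<partial>distr M S X)"
    unfolding prod[symmetric] by (subst Y.nn_integral_fst[symmetric]) auto
  also have "\<dots> = (\<integral>\<^sup>+x. \<integral>\<^sup>+\<omega>'. \<phi> (x, Y \<omega>') \<partial>M \<partial>distr M S X)"
    by (intro nn_integral_cong, subst nn_integral_distr) auto
  also have "\<dots> = (\<integral>\<^sup>+\<omega>. (\<integral>\<^sup>+\<omega>'. \<phi> (X \<omega>, Y \<omega>') \<partial>M) \<partial>M)"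
    by (subst nn_integral_distr) auto
  finally show ?thesis .
qed

context usual_filtered_prob_space
begin

text \<open>
  The algebra in terms of which independence of two processes is stated: it knows the entire path.
\<close>

definition path_algebra :: "(real \<Rightarrow> 'a \<Rightarrow> 'b) \<Rightarrow> 'b measure \<Rightarrow> 'a measure" where
  "path_algebra X N = vimage_algebra (space M) (\<lambda>\<omega>. \<lambda>t\<in>{0..}. X t \<omega>) (PiM {0..} (\<lambda>_. N))"

text \<open>
  The past of the Brownian motion up to \<open>s\<close> together with the whole path of the chain, future included.
  Its generator consists of the intersections of an event of the Brownian motion in \<open>F s\<close> with an
  event of the chain.
  
  It would not do to use all of \<open>F s\<close> instead: although \<open>F s\<close> is independent of the next increment of
  \<open>B\<close>, and \<open>B\<close> is independent of \<open>r\<close>, a random variable in \<open>F s\<close> may couple the futures of \<open>B\<close> and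
  \<open>r\<close>.  The scheme only sees \<open>B\<close> and \<open>r\<close> themselves.
\<close>

definition driving_algebra :: "(real \<Rightarrow> 'a \<Rightarrow> real^'d) \<Rightarrow> (real \<Rightarrow> 'a \<Rightarrow> 's) \<Rightarrow> real \<Rightarrow> 'a measure" where
  "driving_algebra B r s = sigma (space M)
     {A \<inter> R | A R. A \<in> sets (F s) \<and> A \<in> sets (path_algebra B borel)
                 \<and> R \<in> sets (path_algebra r (count_space UNIV))}"

lemma F_sets_subset: "0 \<le> t \<Longrightarrow> sets (F t) \<subseteq> sets M" "0 \<le> t \<Longrightarrow> space (F t) = space M"
  using subalgebra_F unfolding subalgebra_def by auto

lemma path_algebra_component:
  assumes X: "\<And>t. 0 \<le> t \<Longrightarrow> X t \<in> measurable M N" and u: "0 \<le> u"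
  shows "X u \<in> measurable (path_algebra X N) N"
proof -
  let ?p = "\<lambda>\<omega>. \<lambda>t\<in>{0..}. X t \<omega>"
  have "?p \<in> measurable M (PiM {0..} (\<lambda>_. N))"
    by (intro measurable_restrict X) simp
  then have f: "?p \<in> space M \<rightarrow> space (PiM {0..} (\<lambda>_. N))"
    by (rule measurable_space[THEN funcsetI])
  have c: "(\<lambda>p. p u) \<in> measurable (PiM {0..} (\<lambda>_. N)) N"
    using u by (intro measurable_component_singleton) simp
  have "(\<lambda>p. p u) \<circ> ?p \<in> measurable (path_algebra X N) N"
    unfolding path_algebra_def by (rule measurable_comp[OF measurable_vimage_algebra1[OF f] c])
  moreover have "(\<lambda>p. p u) \<circ> ?p = X u" using u by (simp add: comp_def)
  ultimately show ?thesis by (simp only:)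
qed

lemma space_path_algebra [simp]: "space (path_algebra X N) = space M"
  by (simp add: path_algebra_def)

lemma path_algebra_subset:
  assumes X: "\<And>t. 0 \<le> t \<Longrightarrow> X t \<in> measurable M N"
  shows "sets (path_algebra X N) \<subseteq> sets M"
proof -
  have "(\<lambda>\<omega>. \<lambda>t\<in>{0..}. X t \<omega>) \<in> measurable M (PiM {0..} (\<lambda>_. N))"
    by (intro measurable_restrict X) simp
  then show ?thesis unfolding path_algebra_def by (rule sets_image_in_sets[OF refl])
qed

context
  fixes B :: "real \<Rightarrow> 'a \<Rightarrow> real^'d" and r :: "real \<Rightarrow> 'a \<Rightarrow> 's::finite" and \<Gamma> :: "real^'s^'s"
  assumes B: "brownian_motion B" and r: "markov_chain \<Gamma> r" and Br: "indep_processes B r"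
begin

lemma B_adapted: "0 \<le> t \<Longrightarrow> B t \<in> borel_measurable (F t)"
  by (rule B[unfolded brownian_motion_def, THEN conjunct1, rule_format])

lemma r_adapted: "0 \<le> t \<Longrightarrow> r t \<in> measurable (F t) (count_space UNIV)"
  by (rule r[unfolded markov_chain_def, THEN conjunct2, THEN conjunct1, rule_format])

lemma F_measurable_mono:
  assumes "X \<in> measurable (F u) N" "0 \<le> u" "u \<le> t" shows "X \<in> measurable (F t) N"
proof (rule measurableI)
  have sp: "space (F u) = space M" "space (F t) = space M"
    using F_sets_subset(2) assms(2,3) by auto
  show "X x \<in> space N" if "x \<in> space (F t)" for x
    using that measurable_space[OF assms(1)] unfolding sp by simp
  show "X -` A \<inter> space (F t) \<in> sets (F t)" if "A \<in> sets N" for A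
    using measurable_sets[OF assms(1) that] F_mono[OF assms(2,3)] unfolding sp by blast
qed

lemma F_measurable_M:
  assumes "X \<in> measurable (F u) N" "0 \<le> u" shows "X \<in> measurable M N"
  using measurable_from_subalg[OF subalgebra_F[OF assms(2)] assms(1)] .

lemma B_measurable: "0 \<le> t \<Longrightarrow> B t \<in> borel_measurable M"
  using B_adapted F_measurable_M by blast

lemma r_measurable: "0 \<le> t \<Longrightarrow> r t \<in> measurable M (count_space UNIV)"
  using r_adapted F_measurable_M by blast

lemma driving_generator_Pow:
  assumes "0 \<le> s"
  shows "{A \<inter> R | A R. A \<in> sets (F s) \<and> A \<in> sets (path_algebra B borel)
                 \<and> R \<in> sets (path_algebra r (count_space UNIV))} \<subseteq> Pow (space M)"
proof clarify
  fix x A R assume A: "A \<in> sets (F s)" and x: "x \<in> A" "x \<in> R"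
  show "x \<in> space M" using sets.sets_into_space[OF A] x(1) F_sets_subset(2)[OF assms] by auto
qed

lemma space_driving_algebra [simp]: "space (driving_algebra B r s) = space M"
  unfolding driving_algebra_def by (simp add: space_measure_of_conv)

lemma B_driving_measurable:
  assumes u: "0 \<le> u" "u \<le> s"
  shows "B u \<in> borel_measurable (driving_algebra B r s)"
proof (rule measurableI)
  have s: "0 \<le> s" using u by simp
  fix C :: "(real^'d) set" assume C: "C \<in> sets borel"
  have "B u -` C \<inter> space M \<in> sets (F s)"
    using measurable_sets[OF F_measurable_mono[OF B_adapted[OF u(1)] u] C] F_sets_subset(2)[OF s] by simp
  moreover have "B u -` C \<inter> space M \<in> sets (path_algebra B borel)"
    using measurable_sets[OF path_algebra_component[OF B_measurable u(1)] C] by simp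
  moreover have "space M \<in> sets (path_algebra r (count_space UNIV))"
    using sets.top[of "path_algebra r (count_space UNIV)"] by simp
  ultimately have "(B u -` C \<inter> space M) \<inter> space M \<in> sets (driving_algebra B r s)"
    unfolding driving_algebra_def sets_measure_of[OF driving_generator_Pow[OF s]]
    by (intro sigma_sets.Basic) blast
  then show "B u -` C \<inter> space (driving_algebra B r s) \<in> sets (driving_algebra B r s)" by simp
qed simp

lemma r_driving_measurable:
  assumes s: "0 \<le> s" and u: "0 \<le> u"
  shows "r u \<in> measurable (driving_algebra B r s) (count_space UNIV)"
proof (rule measurableI)
  fix C :: "'s set" assume C: "C \<in> sets (count_space UNIV)"
  have "r u -` C \<inter> space M \<in> sets (path_algebra r (count_space UNIV))"
    using measurable_sets[OF path_algebra_component[OF r_measurable u] C] by simp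
  moreover have "space M \<in> sets (path_algebra B borel)" "space M \<in> sets (F s)"
    using sets.top[of "path_algebra B borel"] sets.top[of "F s"] F_sets_subset(2)[OF s] by simp_all
  ultimately have "space M \<inter> (r u -` C \<inter> space M) \<in> sets (driving_algebra B r s)"
    unfolding driving_algebra_def sets_measure_of[OF driving_generator_Pow[OF s]]
    by (intro sigma_sets.Basic) blast
  moreover have "space M \<inter> (r u -` C \<inter> space M) = r u -` C \<inter> space M" by auto
  ultimately show "r u -` C \<inter> space (driving_algebra B r s) \<in> sets (driving_algebra B r s)" by simp
qed simp

text \<open>
  For \<open>A\<close> an event of \<open>B\<close> in \<open>F s\<close>, \<open>R\<close> an event of the chain and \<open>C\<close> an event of the increment,
  \<open>A \<inter> C\<close> is an event of \<open>B\<close>.  Independence of the two processes splits off \<open>R\<close>, and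
  independence of the increment from \<open>F s\<close> separates \<open>A\<close> from \<open>C\<close>.  The intersections
  \<open>A \<inter> R\<close> are stable under intersection, which extends this to the generated algebra.
\<close>

lemma increment_indep_driving:
  assumes s: "0 \<le> s" "s < t"
  shows "indep_set (sets (driving_algebra B r s))
    (sets (vimage_algebra (space M) (\<lambda>\<omega>. B t \<omega> - B s \<omega>) borel))"
proof -
  define W where "W = (\<lambda>\<omega>. B t \<omega> - B s \<omega>)"
  define G where "G = {A \<inter> R | A R. A \<in> sets (F s) \<and> A \<in> sets (path_algebra B borel)
                 \<and> R \<in> sets (path_algebra r (count_space UNIV))}"
  define V where "V = {W -` C \<inter> space M | C. C \<in> sets borel}"
  have GP: "G \<subseteq> Pow (space M)" unfolding G_def by (rule driving_generator_Pow[OF s(1)])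
  have WM: "W \<in> borel_measurable M" unfolding W_def using B_measurable s by auto
  have WB: "W \<in> borel_measurable (path_algebra B borel)"
    unfolding W_def using path_algebra_component[where X=B, OF B_measurable] s by auto
  have ind1: "indep_set (sets (F s)) (sets (vimage_algebra (space M) W borel))"
    unfolding W_def using s
    by (intro B[unfolded brownian_motion_def, THEN conjunct2, THEN conjunct2, THEN conjunct2, rule_format,
          THEN conjunct1]) simp
  have ind2: "indep_set (sets (path_algebra B borel)) (sets (path_algebra r (count_space UNIV)))"
    using Br unfolding indep_processes_def path_algebra_def .
  have "indep_set G V"
  proof (rule indep_setI)
    show "G \<subseteq> events" unfolding G_def
    proof clarify
      fix A R assume "A \<in> sets (F s)" "R \<in> sets (path_algebra r (count_space UNIV))"
      then show "A \<inter> R \<in> events"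
        using F_sets_subset(1)[OF s(1)] path_algebra_subset[where X=r, OF r_measurable]
        by (intro sets.Int) auto
    qed
    show "V \<subseteq> events" unfolding V_def using WM by (auto intro: measurable_sets)
    fix a b assume "a \<in> G" "b \<in> V"
    then obtain A R C where a: "a = A \<inter> R" and A: "A \<in> sets (F s)" "A \<in> sets (path_algebra B borel)"
      and R: "R \<in> sets (path_algebra r (count_space UNIV))"
      and b: "b = W -` C \<inter> space M" and C: "C \<in> sets borel"
      unfolding G_def V_def by blast
    have bB: "b \<in> sets (path_algebra B borel)" using measurable_sets[OF WB C] b by simp
    have bV: "b \<in> sets (vimage_algebra (space M) W borel)"
      unfolding b by (rule in_vimage_algebra[OF C])
    have "prob (a \<inter> b) = prob ((A \<inter> b) \<inter> R)" unfolding a by (rule arg_cong[where f=prob]) auto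
    also have "\<dots> = prob (A \<inter> b) * prob R"
      by (rule indep_setD[OF ind2 sets.Int[OF A(2) bB] R])
    also have "prob (A \<inter> b) = prob A * prob b"
      by (rule indep_setD[OF ind1 A(1) bV])
    also have "prob A * prob b * prob R = prob (A \<inter> R) * prob b"
      using indep_setD[OF ind2 A(2) R] by simp
    finally show "prob (a \<inter> b) = prob a * prob b" unfolding a .
  qed
  moreover have "Int_stable G"
  proof (rule Int_stableI)
    fix a b assume "a \<in> G" "b \<in> G"
    then obtain A R A' R' where "a = A \<inter> R" "A \<in> sets (F s)" "A \<in> sets (path_algebra B borel)"
        "R \<in> sets (path_algebra r (count_space UNIV))"
        "b = A' \<inter> R'" "A' \<in> sets (F s)" "A' \<in> sets (path_algebra B borel)"
        "R' \<in> sets (path_algebra r (count_space UNIV))"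
      unfolding G_def by blast
    moreover from this have "a \<inter> b = (A \<inter> A') \<inter> (R \<inter> R')" by blast
    ultimately show "a \<inter> b \<in> G" unfolding G_def by blast
  qed
  moreover have "Int_stable V"
  proof (rule Int_stableI)
    fix a b assume "a \<in> V" "b \<in> V"
    then obtain C C' where "a = W -` C \<inter> space M" "C \<in> sets borel" "b = W -` C' \<inter> space M" "C' \<in> sets borel"
      unfolding V_def by blast
    moreover from this have "a \<inter> b = W -` (C \<inter> C') \<inter> space M" by blast
    ultimately show "a \<inter> b \<in> V" unfolding V_def by blast
  qed
  ultimately have ind: "indep_set (sigma_sets (space M) G) (sigma_sets (space M) V)"
    by (rule indep_set_sigma_sets)
  have dr: "sets (driving_algebra B r s) = sigma_sets (space M) G"
    unfolding driving_algebra_def G_def[symmetric] using GP by simp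
  show ?thesis
    using ind unfolding dr W_def[symmetric] V_def sets_vimage_algebra .
qed

end
end


section \<open>One step of the scheme along the chain\<close>

context usual_filtered_prob_space
begin

definition state_ind :: "(real \<Rightarrow> 'a \<Rightarrow> 's) \<Rightarrow> real \<Rightarrow> 's \<Rightarrow> 'a \<Rightarrow> real" where
  "state_ind r t j = indicator {\<omega> \<in> space M. r t \<omega> = j}"

lemma state_ind_measurable:
  assumes "r t \<in> measurable N (count_space UNIV)" "space N = space M"
  shows "state_ind r t j \<in> borel_measurable N"
proof -
  have "{\<omega> \<in> space M. r t \<omega> = j} = r t -` {j} \<inter> space N" using assms(2) by auto
  then have "{\<omega> \<in> space M. r t \<omega> = j} \<in> sets N" using measurable_sets[OF assms(1), of "{j}"] by simp
  then show ?thesis unfolding state_ind_def by simp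
qed

lemma sum_state_ind:
  fixes r :: "real \<Rightarrow> 'a \<Rightarrow> 's::finite"
  assumes "\<omega> \<in> space M"
  shows "(\<Sum>j\<in>UNIV. c j * state_ind r t j \<omega>) = c (r t \<omega>)"
proof -
  have "(\<Sum>j\<in>UNIV. c j * state_ind r t j \<omega>) = (\<Sum>j\<in>UNIV. if j = r t \<omega> then c j else 0)"
    using assms by (intro sum.cong) (auto simp: state_ind_def indicator_def)
  then show ?thesis by simp
qed

text \<open>
  The Markov property in integrated form, tested against a variable \<open>Y\<close> known at time \<open>s\<close>.
\<close>

lemma markov_transition_expectation:
  fixes r :: "real \<Rightarrow> 'a \<Rightarrow> 's::finite"
  assumes P: "AE \<omega> in M. real_cond_exp M (F s) (indicator {\<omega> \<in> space M. r (s + t) \<omega> = j}) \<omega> = p (r s \<omega>)"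
    and s: "0 \<le> s" and rs: "r s \<in> measurable (F s) (count_space UNIV)"
    and rt: "r (s + t) \<in> measurable M (count_space UNIV)"
    and Y: "Y \<in> borel_measurable (F s)" "integrable M Y"
  shows "(\<integral>\<omega>. Y \<omega> * state_ind r s i \<omega> * state_ind r (s + t) j \<omega> \<partial>M)
    = p i * (\<integral>\<omega>. Y \<omega> * state_ind r s i \<omega> \<partial>M)"
proof -
  interpret S: finite_measure_subalgebra M "F s"
    by unfold_locales (rule subalgebra_F[OF s])
  have spF: "space (F s) = space M" using subalgebra_F[OF s] by (simp add: subalgebra_def)
  have mi: "state_ind r s i \<in> borel_measurable (F s)" by (rule state_ind_measurable[where r=r, OF rs spF])
  have miM [measurable]: "state_ind r s i \<in> borel_measurable M"
    by (rule measurable_from_subalg[OF subalgebra_F[OF s] mi])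
  have mj [measurable]: "state_ind r (s + t) j \<in> borel_measurable M"
    by (rule state_ind_measurable[where r=r, OF rt refl])
  have YiF: "(\<lambda>\<omega>. Y \<omega> * state_ind r s i \<omega>) \<in> borel_measurable (F s)"
    using Y(1) mi by (rule borel_measurable_times)
  have YM [measurable]: "Y \<in> borel_measurable M" using Y(2) by auto
  have int: "integrable M (\<lambda>\<omega>. Y \<omega> * state_ind r s i \<omega> * state_ind r (s + t) j \<omega>)"
  proof (rule Bochner_Integration.integrable_bound[OF Y(2)])
    show "(\<lambda>\<omega>. Y \<omega> * state_ind r s i \<omega> * state_ind r (s + t) j \<omega>) \<in> borel_measurable M" by measurable
  qed (auto simp: state_ind_def indicator_def)
  have "(\<integral>\<omega>. Y \<omega> * state_ind r s i \<omega> * state_ind r (s + t) j \<omega> \<partial>M)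
     = (\<integral>\<omega>. Y \<omega> * state_ind r s i \<omega> * real_cond_exp M (F s) (state_ind r (s + t) j) \<omega> \<partial>M)"
    by (rule S.real_cond_exp_intg(2)[OF int YiF mj, symmetric])
  also have "\<dots> = (\<integral>\<omega>. p i * (Y \<omega> * state_ind r s i \<omega>) \<partial>M)"
  proof (rule integral_cong_AE)
    show "AE \<omega> in M. Y \<omega> * state_ind r s i \<omega> * real_cond_exp M (F s) (state_ind r (s + t) j) \<omega>
        = p i * (Y \<omega> * state_ind r s i \<omega>)"
      using P unfolding state_ind_def by eventually_elim (auto simp: indicator_def)
  qed measurable
  finally show ?thesis by simp
qed

text \<open>
  Propagation of the moments \<open>E(v(Z\<^sub>k); r\<^sub>k = i)\<close> through one step.  Truncation does not increase \<open>v\<close>.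
  The increment is independent of \<open>(Z\<^sub>k, r\<^sub>k, r\<^sub>k\<^sub>+\<^sub>1)\<close> jointly, so it can be integrated out while the
  next state is held fixed, which costs a factor \<open>m i\<close>; the passage from \<open>i\<close> to \<open>j\<close> then
  contributes \<open>p i j\<close> by the Markov property.
\<close>

lemma tem_one_step:
  fixes B :: "real \<Rightarrow> 'a \<Rightarrow> real^'d" and r :: "real \<Rightarrow> 'a \<Rightarrow> 's::finite" and \<Gamma> :: "real^'s^'s"
    and f :: "real^'n \<Rightarrow> 's \<Rightarrow> real^'n" and g :: "real^'n \<Rightarrow> 's \<Rightarrow> real^'d^'n"
    and v :: "real^'n \<Rightarrow> real"
  assumes B: "brownian_motion B" and r: "markov_chain \<Gamma> r" and Br: "indep_processes B r"
    and P: "\<And>s j. 0 \<le> s \<Longrightarrow> AE \<omega> in M. real_cond_exp M (F s)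
              (indicator {\<omega> \<in> space M. r (s + \<Delta>) \<omega> = j}) \<omega> = p (r s \<omega>) j"
    and \<Delta>: "0 < \<Delta>"
    and fm [measurable]: "\<And>i. (\<lambda>x. f x i) \<in> borel_measurable borel"
    and gm [measurable]: "\<And>i. (\<lambda>x. g x i) \<in> borel_measurable borel"
    and v [measurable]: "v \<in> borel_measurable borel" and v0: "\<And>x. 0 \<le> v x"
    and shrink: "\<And>i x. v (truncate (\<phi>inv i (h \<Delta>)) x) \<le> v x"
    and m0: "\<And>i. 0 \<le> m i"
    and step: "\<And>k i x z. z = truncate (\<phi>inv i (h \<Delta>)) x \<Longrightarrow>
       (\<integral>\<^sup>+\<omega>. ennreal (v (z + \<Delta> *\<^sub>R f z i + g z i *v (B (real (Suc k) * \<Delta>) \<omega> - B (real k * \<Delta>) \<omega>))) \<partial>M)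
         \<le> ennreal (m i * v z)"
    and int: "integrable M (\<lambda>\<omega>. v (tem f g \<phi>inv h B r x\<^sub>0 \<Delta> k \<omega>))"
  shows "integrable M (\<lambda>\<omega>. v (tem f g \<phi>inv h B r x\<^sub>0 \<Delta> (Suc k) \<omega>))"
    and "(\<integral>\<omega>. v (tem f g \<phi>inv h B r x\<^sub>0 \<Delta> (Suc k) \<omega>) * state_ind r (real (Suc k) * \<Delta>) j \<omega> \<partial>M)
      \<le> (\<Sum>i\<in>UNIV. m i * p i j *
           (\<integral>\<omega>. v (tem f g \<phi>inv h B r x\<^sub>0 \<Delta> k \<omega>) * state_ind r (real k * \<Delta>) i \<omega> \<partial>M))"
proof -
  define s where "s = real k * \<Delta>"
  define t where "t = real (Suc k) * \<Delta>"
  have st: "0 \<le> s" "s < t" "t = s + \<Delta>" "0 \<le> t" using \<Delta> unfolding s_def t_def by (auto simp: algebra_simps)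
  define Z where "Z = tem f g \<phi>inv h B r x\<^sub>0 \<Delta> k"
  define Z' where "Z' = tem f g \<phi>inv h B r x\<^sub>0 \<Delta> (Suc k)"
  define W where "W = (\<lambda>\<omega>. B t \<omega> - B s \<omega>)"
  note BM = B_measurable[OF B r Br] and rM = r_measurable[OF B r Br]
  have rsM [measurable]: "r s \<in> measurable M (count_space UNIV)" and rtM [measurable]: "r t \<in> measurable M (count_space UNIV)"
    using rM st by auto
  have Z'M [measurable]: "Z' \<in> borel_measurable M" unfolding Z'_def
    by (rule tem_measurable(2)[OF fm gm]) (use \<Delta> BM rM in auto)
  have ZM [measurable]: "Z \<in> borel_measurable M" unfolding Z_def
    by (rule tem_measurable(2)[OF fm gm]) (use \<Delta> BM rM in auto)
  have ZF: "Z \<in> borel_measurable (F s)" unfolding Z_def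
    by (rule tem_measurable(2)[OF fm gm])
       (use \<Delta> F_measurable_mono[OF B r Br B_adapted[OF B r Br]] F_measurable_mono[OF B r Br r_adapted[OF B r Br]]
         in \<open>auto simp: s_def\<close>)
  have ZD: "Z \<in> borel_measurable (driving_algebra B r s)" unfolding Z_def
    by (rule tem_measurable(2)[OF fm gm])
       (use \<Delta> B_driving_measurable[OF B r Br] r_driving_measurable[OF B r Br st(1)] in \<open>auto simp: s_def\<close>)
  define N :: "((real^'n) \<times> 's \<times> 's) measure" where "N = borel \<Otimes>\<^sub>M (count_space UNIV \<Otimes>\<^sub>M count_space UNIV)"
  define X where "X \<omega> = (Z \<omega>, r s \<omega>, r t \<omega>)" for \<omega>
  have X: "X \<in> measurable (driving_algebra B r s) N"
    unfolding X_def N_def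
    using ZD r_driving_measurable[OF B r Br st(1) st(1)] r_driving_measurable[OF B r Br st(1) st(4)]
    by (intro measurable_Pair) auto
  have WM: "W \<in> borel_measurable M" unfolding W_def using BM st by auto
  have ind: "indep_set (sets (driving_algebra B r s)) (sets (vimage_algebra (space M) W borel))"
    unfolding W_def by (rule increment_indep_driving[OF B r Br st(1,2)])
  \<comment> \<open>The untruncated value after the step, as a function of the pair formed by
    \<open>(Z\<^sub>k, r\<^sub>k, r\<^sub>k\<^sub>+\<^sub>1)\<close> and the increment.\<close>
  define \<psi> :: "'s \<Rightarrow> ((real^'n) \<times> 's \<times> 's) \<times> (real^'d) \<Rightarrow> ennreal"
    where "\<psi> j y = ennreal (v (fst (fst y) + \<Delta> *\<^sub>R f (fst (fst y)) (fst (snd (fst y)))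
       + g (fst (fst y)) (fst (snd (fst y))) *v snd y)) * indicator {j} (snd (snd (fst y)))" for j y
  have \<psi>: "\<psi> j \<in> borel_measurable (N \<Otimes>\<^sub>M borel)" for j
  proof -
    have "(\<lambda>y. v (fst (fst y) + \<Delta> *\<^sub>R f (fst (fst y)) i + g (fst (fst y)) i *v snd y)) \<in> borel_measurable (N \<Otimes>\<^sub>M borel)" for i
      unfolding N_def by (rule measurable_compose[OF _ v], intro borel_measurable_add borel_measurable_matrix_vector_mult; measurable)
    moreover have "(\<lambda>y. fst (snd (fst y))) \<in> measurable (N \<Otimes>\<^sub>M borel) (count_space UNIV)"
      unfolding N_def by measurable
    ultimately have "(\<lambda>y. v (fst (fst y) + \<Delta> *\<^sub>R f (fst (fst y)) (fst (snd (fst y)))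
       + g (fst (fst y)) (fst (snd (fst y))) *v snd y)) \<in> borel_measurable (N \<Otimes>\<^sub>M borel)"
      by (rule measurable_compose_countable[where f="\<lambda>i y. v (fst (fst y) + \<Delta> *\<^sub>R f (fst (fst y)) i + g (fst (fst y)) i *v snd y)"])
    moreover have "(\<lambda>y. indicator {j} (snd (snd (fst y))) :: ennreal) \<in> borel_measurable (N \<Otimes>\<^sub>M borel)"
      unfolding N_def by measurable
    ultimately show ?thesis unfolding \<psi>_def[abs_def] by measurable
  qed
  define E where "E j = (\<Sum>i\<in>UNIV. m i * p i j * (\<integral>\<omega>. v (Z \<omega>) * state_ind r s i \<omega> \<partial>M))" for j
  have si [measurable]: "state_ind r s i \<in> borel_measurable M" "state_ind r t i \<in> borel_measurable M" for i
    using state_ind_measurable[where r=r, OF rsM] state_ind_measurable[where r=r, OF rtM] by auto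
  have intZ: "integrable M (\<lambda>\<omega>. v (Z \<omega>))" using int unfolding Z_def .
  have intij: "integrable M (\<lambda>\<omega>. v (Z \<omega>) * state_ind r s i \<omega> * state_ind r t j \<omega>)" for i j
  proof (rule Bochner_Integration.integrable_bound[OF intZ])
    show "(\<lambda>\<omega>. v (Z \<omega>) * state_ind r s i \<omega> * state_ind r t j \<omega>) \<in> borel_measurable M" by measurable
  qed (auto simp: state_ind_def indicator_def)
  have trans: "(\<integral>\<omega>. v (Z \<omega>) * state_ind r s i \<omega> * state_ind r t j \<omega> \<partial>M)
      = p i j * (\<integral>\<omega>. v (Z \<omega>) * state_ind r s i \<omega> \<partial>M)" for i j
    unfolding st(3)
  proof (rule markov_transition_expectation[OF P[OF st(1)] st(1) r_adapted[OF B r Br st(1)] _ _ intZ])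
    show "r (s + \<Delta>) \<in> measurable M (count_space UNIV)" using rtM st(3) by simp
    show "(\<lambda>\<omega>. v (Z \<omega>)) \<in> borel_measurable (F s)" by (rule measurable_compose[OF ZF v])
  qed
  have main: "(\<integral>\<^sup>+\<omega>. ennreal (v (Z' \<omega>) * state_ind r t j \<omega>) \<partial>M) \<le> ennreal (E j)" for j
  proof -
    have "(\<integral>\<^sup>+\<omega>. ennreal (v (Z' \<omega>) * state_ind r t j \<omega>) \<partial>M) \<le> (\<integral>\<^sup>+\<omega>. \<psi> j (X \<omega>, W \<omega>) \<partial>M)"
    proof (rule nn_integral_mono)
      fix \<omega> assume "\<omega> \<in> space M"
      have pre: "tem_pre f g \<phi>inv h B r x\<^sub>0 \<Delta> (Suc k) \<omega> = Z \<omega> + \<Delta> *\<^sub>R f (Z \<omega>) (r s \<omega>) + g (Z \<omega>) (r s \<omega>) *v W \<omega>"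
        unfolding Z_def W_def tem_def s_def t_def by (simp add: Let_def)
      have "v (Z' \<omega>) \<le> v (Z \<omega> + \<Delta> *\<^sub>R f (Z \<omega>) (r s \<omega>) + g (Z \<omega>) (r s \<omega>) *v W \<omega>)"
        unfolding Z'_def tem_def pre by (rule shrink)
      then show "ennreal (v (Z' \<omega>) * state_ind r t j \<omega>) \<le> \<psi> j (X \<omega>, W \<omega>)"
        unfolding \<psi>_def X_def state_ind_def
        by (auto simp: indicator_def intro: ennreal_leI)
    qed
    also have "\<dots> = (\<integral>\<^sup>+\<omega>. (\<integral>\<^sup>+\<omega>'. \<psi> j (X \<omega>, W \<omega>') \<partial>M) \<partial>M)"
      by (rule nn_integral_indep[OF ind space_driving_algebra[OF B r Br] X WM \<psi>])
    also have "\<dots> \<le> (\<integral>\<^sup>+\<omega>. ennreal (\<Sum>i\<in>UNIV. m i * (v (Z \<omega>) * state_ind r s i \<omega> * state_ind r t j \<omega>)) \<partial>M)"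
    proof (rule nn_integral_mono)
      fix \<omega> assume \<omega>: "\<omega> \<in> space M"
      have "(\<integral>\<^sup>+\<omega>'. \<psi> j (X \<omega>, W \<omega>') \<partial>M) \<le> ennreal (m (r s \<omega>) * v (Z \<omega>) * state_ind r t j \<omega>)"
      proof (cases "r t \<omega> = j")
        case True
        have "(\<integral>\<^sup>+\<omega>'. \<psi> j (X \<omega>, W \<omega>') \<partial>M) = (\<integral>\<^sup>+\<omega>'. ennreal (v (Z \<omega> + \<Delta> *\<^sub>R f (Z \<omega>) (r s \<omega>) + g (Z \<omega>) (r s \<omega>) *v W \<omega>')) \<partial>M)"
          unfolding \<psi>_def X_def using True by simp
        also have "\<dots> \<le> ennreal (m (r s \<omega>) * v (Z \<omega>))"
          unfolding W_def s_def t_def by (rule step) (simp add: Z_def tem_def)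
        finally show ?thesis using True \<omega> by (simp add: state_ind_def)
      next
        case False
        then show ?thesis unfolding \<psi>_def X_def by simp
      qed
      also have "m (r s \<omega>) * v (Z \<omega>) * state_ind r t j \<omega>
          = (\<Sum>i\<in>UNIV. (m i * (v (Z \<omega>) * state_ind r t j \<omega>)) * state_ind r s i \<omega>)"
        unfolding sum_state_ind[OF \<omega>] by simp
      also have "\<dots> = (\<Sum>i\<in>UNIV. m i * (v (Z \<omega>) * state_ind r s i \<omega> * state_ind r t j \<omega>))"
        by (simp add: ac_simps)
      finally show "(\<integral>\<^sup>+\<omega>'. \<psi> j (X \<omega>, W \<omega>') \<partial>M)
        \<le> ennreal (\<Sum>i\<in>UNIV. m i * (v (Z \<omega>) * state_ind r s i \<omega> * state_ind r t j \<omega>))" .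
    qed
    also have "\<dots> = ennreal (\<integral>\<omega>. (\<Sum>i\<in>UNIV. m i * (v (Z \<omega>) * state_ind r s i \<omega> * state_ind r t j \<omega>)) \<partial>M)"
      by (rule nn_integral_eq_integral)
         (use intij m0 v0 in \<open>auto intro!: AE_I2 sum_nonneg mult_nonneg_nonneg simp: state_ind_def\<close>)
    also have "(\<integral>\<omega>. (\<Sum>i\<in>UNIV. m i * (v (Z \<omega>) * state_ind r s i \<omega> * state_ind r t j \<omega>)) \<partial>M)
        = (\<Sum>i\<in>UNIV. m i * (\<integral>\<omega>. v (Z \<omega>) * state_ind r s i \<omega> * state_ind r t j \<omega> \<partial>M))"
      using intij by (simp add: Bochner_Integration.integral_sum)
    also have "\<dots> = E j"
      unfolding trans E_def by (simp add: ac_simps)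
    finally show ?thesis .
  qed
  have intj: "integrable M (\<lambda>\<omega>. v (Z' \<omega>) * state_ind r t j \<omega>)" for j
  proof (rule integrableI_bounded)
    have "(\<integral>\<^sup>+\<omega>. ennreal (norm (v (Z' \<omega>) * state_ind r t j \<omega>)) \<partial>M) = (\<integral>\<^sup>+\<omega>. ennreal (v (Z' \<omega>) * state_ind r t j \<omega>) \<partial>M)"
      using v0 by (intro nn_integral_cong) (auto simp: state_ind_def indicator_def)
    also have "\<dots> < \<infinity>" using main[of j] by (simp add: le_less_trans)
    finally show "(\<integral>\<^sup>+\<omega>. ennreal (norm (v (Z' \<omega>) * state_ind r t j \<omega>)) \<partial>M) < \<infinity>" .
  qed measurable
  have "integrable M (\<lambda>\<omega>. \<Sum>j\<in>UNIV. v (Z' \<omega>) * state_ind r t j \<omega>)" using intj by auto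
  then have "integrable M (\<lambda>\<omega>. v (Z' \<omega>))"
    by (rule Bochner_Integration.integrable_cong[THEN iffD1, rotated -1]) (auto simp: sum_state_ind[where c="\<lambda>_. _"])
  then show "integrable M (\<lambda>\<omega>. v (tem f g \<phi>inv h B r x\<^sub>0 \<Delta> (Suc k) \<omega>))" unfolding Z'_def .
  have E0: "0 \<le> E j" for j
  proof -
    have "0 \<le> m i * p i j * (\<integral>\<omega>. v (Z \<omega>) * state_ind r s i \<omega> \<partial>M)" for i
    proof -
      have "0 \<le> (\<integral>\<omega>. v (Z \<omega>) * state_ind r s i \<omega> * state_ind r t j \<omega> \<partial>M)"
        using v0 by (intro integral_nonneg_AE) (auto simp: state_ind_def)
      then show ?thesis using m0[of i] unfolding trans by (simp add: mult.assoc)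
    qed
    then show ?thesis unfolding E_def by (intro sum_nonneg)
  qed
  have "ennreal (\<integral>\<omega>. v (Z' \<omega>) * state_ind r t j \<omega> \<partial>M) \<le> ennreal (E j)"
    using main[of j] nn_integral_eq_integral[OF intj[of j]] v0 by (simp add: state_ind_def)
  then show "(\<integral>\<omega>. v (tem f g \<phi>inv h B r x\<^sub>0 \<Delta> (Suc k) \<omega>) * state_ind r (real (Suc k) * \<Delta>) j \<omega> \<partial>M)
      \<le> (\<Sum>i\<in>UNIV. m i * p i j *
           (\<integral>\<omega>. v (tem f g \<phi>inv h B r x\<^sub>0 \<Delta> k \<omega>) * state_ind r (real k * \<Delta>) i \<omega> \<partial>M))"
    using E0[of j] unfolding E_def Z_def Z'_def s_def t_def by (simp add: ennreal_le_iff)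
qed

end


section \<open>Lyapunov exponents from moments\<close>

lemma elog_le:
  assumes "x \<le> ennreal (exp y)" shows "elog x \<le> ereal y"
proof -
  have "x \<noteq> \<infinity>" using assms by (auto simp: top_unique)
  moreover have "ln (enn2real x) \<le> y" if "x \<noteq> 0"
  proof -
    have "0 < enn2real x" using that \<open>x \<noteq> \<infinity>\<close> by (cases x) auto
    moreover have "enn2real x \<le> exp y" using assms by (simp add: enn2real_leI)
    ultimately show ?thesis by (metis exp_gt_zero ln_exp ln_le_cancel_iff)
  qed
  ultimately show ?thesis unfolding elog_def by auto
qed

lemma limsup_elog_le:
  fixes x :: "nat \<Rightarrow> ennreal"
  assumes \<Delta>: "0 < \<Delta>" and ev: "eventually (\<lambda>k. x k \<le> ennreal (exp (c * (real k * \<Delta>)))) sequentially"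
  shows "limsup (\<lambda>k. elog (x k) / ereal (real k * \<Delta>)) \<le> ereal c"
proof (rule Limsup_bounded)
  show "\<forall>\<^sub>F k in sequentially. elog (x k) / ereal (real k * \<Delta>) \<le> ereal c"
    using ev eventually_gt_at_top[of 0]
  proof eventually_elim
    case (elim k)
    have pos: "0 < real k * \<Delta>" using elim(2) \<Delta> by simp
    have "elog (x k) / ereal (real k * \<Delta>) \<le> ereal (c * (real k * \<Delta>)) / ereal (real k * \<Delta>)"
      using pos by (intro ereal_divide_right_mono elog_le elim(1)) auto
    also have "\<dots> = ereal c"
    proof -
      have "real k * \<Delta> \<noteq> 0" by (rule less_imp_neq[OF pos, symmetric])
      then show ?thesis by simp
    qed
    finally show ?case .
  qed
qed

context prob_space
begin

text \<open>
  An exponential bound on moments controls both Lyapunov exponents, at the price of a slightly smaller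
  rate \<open>b\<close>.  The gap absorbs the constant \<open>K\<close>; for the pathwise statement it makes
  the expectation of \<open>\<Sum>k. e\<^sup>b\<^sup>k\<^sup>\<Delta> |X\<^sub>k|\<^sup>p\<close> finite, so that almost surely the terms of this series tend
  to \<open>0\<close>.
\<close>

lemma exponential_decay_Lyapunov:
  fixes X :: "nat \<Rightarrow> 'a \<Rightarrow> 'b::euclidean_space"
  assumes X [measurable]: "\<And>k. X k \<in> borel_measurable M"
    and \<Delta>: "0 < \<Delta>" and p: "0 < p" and ba: "b < a" and K: "0 \<le> K"
    and moment: "\<And>k. (\<integral>\<^sup>+\<omega>. ennreal (norm (X k \<omega>) powr p) \<partial>M) \<le> ennreal (K * exp (- a * (real k * \<Delta>)))"
  shows "limsup (\<lambda>k. elog (\<integral>\<^sup>+\<omega>. ennreal (norm (X k \<omega>) powr p) \<partial>M) / ereal (real k * \<Delta>)) \<le> ereal (- b)"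
    and "AE \<omega> in M. limsup (\<lambda>k. elog (ennreal (norm (X k \<omega>))) / ereal (real k * \<Delta>)) \<le> ereal (- b / p)"
proof -
  define \<delta> where "\<delta> = (a - b) * \<Delta>"
  have \<delta>: "0 < \<delta>" unfolding \<delta>_def using ba \<Delta> by simp
  have "((\<lambda>k. K * exp (- \<delta> * real k)) \<longlongrightarrow> 0) sequentially"
  proof -
    have "(\<lambda>k. exp (- \<delta>) ^ k) \<longlonglongrightarrow> 0" using \<delta> by (intro LIMSEQ_power_zero) simp
    then have "(\<lambda>k. K * exp (- \<delta>) ^ k) \<longlonglongrightarrow> K * 0" by (rule tendsto_mult_left)
    then show ?thesis by (simp add: exp_of_nat_mult[symmetric] mult.commute)
  qed
  then have "eventually (\<lambda>k. K * exp (- \<delta> * real k) < 1) sequentially" by (rule order_tendstoD) simp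
  then have "eventually (\<lambda>k. (\<integral>\<^sup>+\<omega>. ennreal (norm (X k \<omega>) powr p) \<partial>M) \<le> ennreal (exp ((- b) * (real k * \<Delta>)))) sequentially"
  proof eventually_elim
    case (elim k)
    have "K * exp (- a * (real k * \<Delta>)) = (K * exp (- \<delta> * real k)) * exp ((- b) * (real k * \<Delta>))"
      unfolding \<delta>_def by (simp add: exp_add[symmetric] algebra_simps)
    also have "\<dots> \<le> 1 * exp ((- b) * (real k * \<Delta>))" using elim by (intro mult_right_mono) auto
    finally show ?case using moment[of k] by (auto intro: order_trans ennreal_leI)
  qed
  then show "limsup (\<lambda>k. elog (\<integral>\<^sup>+\<omega>. ennreal (norm (X k \<omega>) powr p) \<partial>M) / ereal (real k * \<Delta>)) \<le> ereal (- b)"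
    by (rule limsup_elog_le[OF \<Delta>])
  define Y where "Y k \<omega> = exp (b * (real k * \<Delta>)) * norm (X k \<omega>) powr p" for k \<omega>
  have Y [measurable]: "Y k \<in> borel_measurable M" for k unfolding Y_def by measurable
  have "(\<integral>\<^sup>+\<omega>. (\<Sum>k. ennreal (Y k \<omega>)) \<partial>M) = (\<Sum>k. \<integral>\<^sup>+\<omega>. ennreal (Y k \<omega>) \<partial>M)"
    by (rule nn_integral_suminf) measurable
  also have "\<dots> \<le> (\<Sum>k. ennreal (K * exp (- \<delta>) ^ k))"
  proof (rule suminf_le)
    fix k
    have "(\<integral>\<^sup>+\<omega>. ennreal (Y k \<omega>) \<partial>M) = ennreal (exp (b * (real k * \<Delta>))) * (\<integral>\<^sup>+\<omega>. ennreal (norm (X k \<omega>) powr p) \<partial>M)"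
      unfolding Y_def by (subst nn_integral_cmult[symmetric]) (auto simp: ennreal_mult)
    also have "\<dots> \<le> ennreal (exp (b * (real k * \<Delta>))) * ennreal (K * exp (- a * (real k * \<Delta>)))"
      by (intro mult_left_mono moment) auto
    also have "\<dots> = ennreal (exp (b * (real k * \<Delta>)) * (K * exp (- a * (real k * \<Delta>))))"
      using K by (simp add: ennreal_mult)
    also have "exp (b * (real k * \<Delta>)) * (K * exp (- a * (real k * \<Delta>))) = K * exp (- \<delta>) ^ k"
      unfolding \<delta>_def by (simp add: exp_add[symmetric] exp_of_nat_mult[symmetric] algebra_simps)
    finally show "(\<integral>\<^sup>+\<omega>. ennreal (Y k \<omega>) \<partial>M) \<le> ennreal (K * exp (- \<delta>) ^ k)" .
  qed auto
  also have "\<dots> < \<infinity>"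
  proof -
    have "summable (\<lambda>k. K * exp (- \<delta>) ^ k)" using \<delta> by (intro summable_mult summable_geometric) simp
    then show ?thesis using K by (simp add: suminf_ennreal2)
  qed
  finally have "(\<integral>\<^sup>+\<omega>. (\<Sum>k. ennreal (Y k \<omega>)) \<partial>M) \<noteq> \<infinity>" by simp
  then have "AE \<omega> in M. (\<Sum>k. ennreal (Y k \<omega>)) \<noteq> \<infinity>" by (intro nn_integral_PInf_AE) auto
  then show "AE \<omega> in M. limsup (\<lambda>k. elog (ennreal (norm (X k \<omega>))) / ereal (real k * \<Delta>)) \<le> ereal (- b / p)"
  proof eventually_elim
    case (elim \<omega>)
    have "summable (\<lambda>k. Y k \<omega>)"
      using elim by (intro summable_suminf_not_top) (auto simp: Y_def)
    then have "(\<lambda>k. Y k \<omega>) \<longlonglongrightarrow> 0" by (rule summable_LIMSEQ_zero)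
    then have "eventually (\<lambda>k. Y k \<omega> < 1) sequentially" by (rule order_tendstoD) simp
    then have "eventually (\<lambda>k. ennreal (norm (X k \<omega>)) \<le> ennreal (exp ((- b / p) * (real k * \<Delta>)))) sequentially"
    proof eventually_elim
      case (elim k)
      have "norm (X k \<omega>) powr p \<le> exp (- b * (real k * \<Delta>))"
        using elim unfolding Y_def by (simp add: exp_minus field_simps)
      then have "(norm (X k \<omega>) powr p) powr (1 / p) \<le> exp (- b * (real k * \<Delta>)) powr (1 / p)"
        using p by (intro powr_mono2) auto
      then show ?case using p by (intro ennreal_leI) (simp add: powr_powr exp_powr_real)
    qed
    then show ?case by (rule limsup_elog_le[OF \<Delta>])
  qed
qed

end

section \<open>Growth control and contraction\<close>

text \<open>
  What truncation is for: inside the truncated ball the coefficients grow linearly with the constant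
  \<open>H\<close>.  In the locally Lipschitz case the radius is the number \<open>u \<ge> 1\<close> with \<open>\<phi> u = H\<close>, which exists by
  the intermediate value theorem.
\<close>

lemma truncation_control_growth:
  fixes a :: "real^'n \<Rightarrow> real^'n" and b :: "real^'n \<Rightarrow> real^'d^'n"
  assumes tc: "truncation_control a b \<phi> \<phi>inv" and a0: "a 0 = 0" and b0: "b 0 = 0" and H: "\<phi> 1 \<le> H" "0 \<le> H"
  shows "0 \<le> \<phi>inv H"
    and "norm (a (truncate (\<phi>inv H) x)) \<le> H * norm (truncate (\<phi>inv H) x)"
    and "(norm (b (truncate (\<phi>inv H) x)))\<^sup>2 \<le> H * (norm (truncate (\<phi>inv H) x))\<^sup>2"
proof -
  define z where "z = truncate (\<phi>inv H) x"
  have "0 \<le> \<phi>inv H \<and> norm (a z) \<le> H * norm z \<and> (norm (b z))\<^sup>2 \<le> H * (norm z)\<^sup>2"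
    using tc unfolding truncation_control_def
  proof (elim disjE exE conjE)
    assume mono: "strict_mono_on {0..} \<phi>" and cont: "continuous_on {0..} \<phi>"
      and top: "filterlim \<phi> at_top at_top"
      and lip: "\<forall>u\<ge>1. \<forall>x y. norm x \<le> u \<and> norm y \<le> u \<and> x \<noteq> y \<longrightarrow>
         max (norm (a x - a y) / norm (x - y)) ((norm (b x - b y))\<^sup>2 / (norm (x - y))\<^sup>2) \<le> \<phi> u"
      and inv: "\<forall>v\<ge>\<phi> 1. \<phi>inv v = ereal (the_inv_into {0..} \<phi> v)"
    have "eventually (\<lambda>u. H \<le> \<phi> u \<and> 1 \<le> u) at_top"
      using top[unfolded filterlim_at_top, rule_format, of H] eventually_ge_at_top[of 1] by eventually_elim simp
    then obtain w where w: "H \<le> \<phi> w" "1 \<le> w" by (auto simp: eventually_at_top_linorder)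
    have "continuous_on {1..w} \<phi>" using cont by (rule continuous_on_subset) auto
    then obtain u where u: "1 \<le> u" "\<phi> u = H" using IVT'[of \<phi> 1 H w] w H by auto
    have "\<phi>inv H = ereal u"
      using inv H(1) the_inv_into_f_f[OF strict_mono_on_imp_inj_on[OF mono], of u] u by simp
    then have zu: "norm z \<le> u" and "0 \<le> \<phi>inv H"
      using norm_truncate_le[of "\<phi>inv H" x] u(1) unfolding z_def by auto
    show ?thesis
    proof (cases "z = 0")
      case False
      then have "max (norm (a z - a 0) / norm (z - 0)) ((norm (b z - b 0))\<^sup>2 / (norm (z - 0))\<^sup>2) \<le> \<phi> u"
        using u(1) zu by (intro lip[rule_format]) auto
      then show ?thesis using False \<open>0 \<le> \<phi>inv H\<close> unfolding a0 b0 u(2)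
        by (simp add: pos_divide_le_eq)
    qed (use a0 b0 \<open>0 \<le> \<phi>inv H\<close> in simp)
  next
    fix C assume lip: "\<forall>x y. norm (a x - a y) \<le> C * norm (x - y) \<and> (norm (b x - b y))\<^sup>2 \<le> C * (norm (x - y))\<^sup>2"
      and C: "\<forall>u\<ge>0. \<phi> u = C" and inv: "\<forall>v\<ge>C. \<phi>inv v = \<infinity>"
    have CH: "C \<le> H" using C H by simp
    have "norm (a z) \<le> C * norm z" "(norm (b z))\<^sup>2 \<le> C * (norm z)\<^sup>2"
      using lip[rule_format, of z 0] a0 b0 by auto
    moreover have "C * norm z \<le> H * norm z" "C * (norm z)\<^sup>2 \<le> H * (norm z)\<^sup>2"
      using CH by (auto intro: mult_right_mono)
    ultimately show ?thesis using inv CH by simp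
  qed
  then show "0 \<le> \<phi>inv H"
    and "norm (a (truncate (\<phi>inv H) x)) \<le> H * norm (truncate (\<phi>inv H) x)"
    and "(norm (b (truncate (\<phi>inv H) x)))\<^sup>2 \<le> H * (norm (truncate (\<phi>inv H) x))\<^sup>2"
    unfolding z_def by auto
qed

lemma truncation_control_mono:
  assumes "truncation_control a b \<phi> \<phi>inv" "1 \<le> w" shows "\<phi> 1 \<le> \<phi> w"
  using assms(1) unfolding truncation_control_def
proof (elim disjE exE conjE)
  assume "strict_mono_on {0..} \<phi>"
  then show ?thesis using assms(2) strict_mono_on_imp_mono_on[THEN mono_onD, of "{0..}" \<phi> 1 w] by auto
qed (use assms(2) in auto)

text \<open>
  The condition on \<open>h\<close> says \<open>h \<Delta> = O(\<Delta>\<^sup>1\<^sup>/\<^sup>2\<^sup>+\<^sup>\<theta>)\<close>, so that the squared error of an Euler step is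
  \<open>o(\<Delta>)\<close>.
\<close>

lemma stepsize_control_bounds:
  fixes f :: "real^'n \<Rightarrow> 's::finite \<Rightarrow> real^'n" and g :: "real^'n \<Rightarrow> 's \<Rightarrow> real^'d^'n"
  assumes tc: "\<forall>i. truncation_control (\<lambda>x. f x i) (\<lambda>x. g x i) (\<phi> i) (\<phi>inv i)"
    and sc: "stepsize_control f g \<phi> x\<^sub>0 h"
  obtains \<theta> K where "0 < \<theta>" "0 < K"
    "\<And>\<Delta> i. 0 < \<Delta> \<Longrightarrow> \<Delta> \<le> 1 \<Longrightarrow> \<phi> i 1 \<le> h \<Delta>"
    "\<And>\<Delta>. 0 < \<Delta> \<Longrightarrow> \<Delta> \<le> 1 \<Longrightarrow> 0 \<le> h \<Delta>"
    "\<And>\<Delta>. 0 < \<Delta> \<Longrightarrow> \<Delta> \<le> 1 \<Longrightarrow> h \<Delta> * \<Delta> \<le> K"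
    "\<And>\<Delta>. 0 < \<Delta> \<Longrightarrow> \<Delta> \<le> 1 \<Longrightarrow> (h \<Delta> * \<Delta>)\<^sup>2 \<le> K\<^sup>2 * \<Delta> powr (1 + 2 * \<theta>)"
proof -
  obtain \<theta> K where \<theta>: "0 < \<theta>" "\<theta> < 1/2" and K: "0 < K"
    and hK: "\<And>\<Delta>. \<Delta> \<in> {0<..1} \<Longrightarrow> \<Delta> powr (1 / 2 - \<theta>) * h \<Delta> \<le> K"
    using sc unfolding stepsize_control_def by blast
  have h1: "(MAX i. max (norm (f 0 i)) ((norm (g 0 i))\<^sup>2)) \<le> h 1"
    and hm: "\<And>\<Delta>. \<Delta> \<in> {0<..1} \<Longrightarrow> (MAX i. \<phi> i (max (norm x\<^sub>0) 1)) \<le> h \<Delta>"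
    and hd: "\<And>\<Delta> \<Delta>'. \<Delta> \<in> {0<..1} \<Longrightarrow> \<Delta>' \<in> {0<..1} \<Longrightarrow> \<Delta> < \<Delta>' \<Longrightarrow> h \<Delta>' < h \<Delta>"
    using sc unfolding stepsize_control_def by blast+
  have a: "\<phi> i 1 \<le> h \<Delta>" if "0 < \<Delta>" "\<Delta> \<le> 1" for \<Delta> i
  proof -
    have "\<phi> i 1 \<le> \<phi> i (max (norm x\<^sub>0) 1)" by (rule truncation_control_mono[OF tc[rule_format]]) simp
    also have "\<dots> \<le> (MAX i. \<phi> i (max (norm x\<^sub>0) 1))" by (rule Max_ge) auto
    also have "\<dots> \<le> h \<Delta>" using hm that by simp
    finally show ?thesis .
  qed
  have "0 \<le> max (norm (f 0 i)) ((norm (g 0 i))\<^sup>2)" for i by (simp add: le_max_iff_disj)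
  moreover have "max (norm (f 0 i)) ((norm (g 0 i))\<^sup>2) \<le> (MAX i. max (norm (f 0 i)) ((norm (g 0 i))\<^sup>2))" for i
    by (rule Max_ge) auto
  ultimately have "0 \<le> h 1" using h1 by (meson order_trans)
  then have b: "0 \<le> h \<Delta>" if "0 < \<Delta>" "\<Delta> \<le> 1" for \<Delta>
    using hd[of \<Delta> 1] that by (cases "\<Delta> = 1") auto
  have d: "h \<Delta> * \<Delta> \<le> K * \<Delta> powr (1/2 + \<theta>)" if "0 < \<Delta>" "\<Delta> \<le> 1" for \<Delta>
  proof -
    have "\<Delta> = \<Delta> powr (1/2 - \<theta>) * \<Delta> powr (1/2 + \<theta>)" using that by (simp add: powr_add[symmetric])
    then have "h \<Delta> * \<Delta> = (\<Delta> powr (1/2 - \<theta>) * h \<Delta>) * \<Delta> powr (1/2 + \<theta>)" by (metis mult.assoc mult.commute)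
    also have "\<dots> \<le> K * \<Delta> powr (1/2 + \<theta>)" using hK that by (intro mult_right_mono) auto
    finally show ?thesis .
  qed
  show ?thesis
  proof (rule that[OF \<theta>(1) K a b])
    fix \<Delta> :: real assume \<Delta>: "0 < \<Delta>" "\<Delta> \<le> 1"
    have "\<Delta> powr (1/2 + \<theta>) \<le> 1" using \<Delta> \<theta> by (intro powr_le1) auto
    then have "K * \<Delta> powr (1/2 + \<theta>) \<le> K * 1" using K by (intro mult_left_mono) auto
    then show "h \<Delta> * \<Delta> \<le> K" using d[OF \<Delta>] by linarith
    have "(h \<Delta> * \<Delta>)\<^sup>2 \<le> (K * \<Delta> powr (1/2 + \<theta>))\<^sup>2" using d[OF \<Delta>] b[OF \<Delta>] \<Delta> by (intro power_mono) auto
    also have "\<dots> = K\<^sup>2 * \<Delta> powr (1 + 2 * \<theta>)"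
      by (simp add: power_mult_distrib power2_eq_square powr_add[symmetric])
    finally show "(h \<Delta> * \<Delta>)\<^sup>2 \<le> K\<^sup>2 * \<Delta> powr (1 + 2 * \<theta>)" .
  qed auto
qed

text \<open>
  Both sides of the last inequality equal \<open>c\<^sub>i\<close> at \<open>\<Delta> = 0\<close>, and the difference of their right
  derivatives there is \<open>((\<Gamma> + diag u) c)\<^sub>i + a c\<^sub>i < 0\<close>; the perturbation of order \<open>\<Delta>\<^sup>e\<close> with \<open>e > 1\<close> is
  invisible to the derivative.
\<close>

lemma transition_contraction:
  fixes \<Gamma> :: "real^'s::finite^'s" and P :: "real \<Rightarrow> real^'s^'s"
  assumes P: "transition_semigroup \<Gamma> P" and e: "1 < e"
    and c: "\<And>i. 0 < c$i" "\<And>i. ((\<Gamma> + diag u) *v c)$i < - a * c$i"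
  obtains D where "0 < D" "D \<le> 1"
    "\<And>\<Delta> i. 0 < \<Delta> \<Longrightarrow> \<Delta> \<le> D \<Longrightarrow>
       max 0 (1 + u$i * \<Delta> + C * \<Delta> powr e) * (\<Sum>j\<in>UNIV. P \<Delta> $ i $ j * c$j) \<le> exp (- a * \<Delta>) * c$i"
proof -
  define \<psi> where "\<psi> i \<Delta> = (1 + u$i * \<Delta> + C * \<Delta> powr e) * (\<Sum>j\<in>UNIV. P \<Delta> $ i $ j * c$j) - (1 - a * \<Delta>) * c$i" for i \<Delta>
  have P0: "P 0 = mat 1" and Pd: "(P has_vector_derivative \<Gamma>) (at 0 within {0..})"
    using P unfolding transition_semigroup_def by auto
  have comp: "((\<lambda>\<Delta>. P \<Delta> $ i $ j) has_real_derivative \<Gamma> $ i $ j) (at 0 within {0..})" for i j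
  proof -
    have "bounded_linear (\<lambda>X :: real^'s^'s. X $ i $ j)"
      using bounded_linear_compose[OF bounded_linear_vec_nth[of j] bounded_linear_vec_nth[of i]] by simp
    then show ?thesis
      using bounded_linear.has_vector_derivative[OF _ Pd] by (simp add: has_real_derivative_iff_has_vector_derivative)
  qed
  have pw: "((\<lambda>\<Delta>::real. \<Delta> powr e) has_real_derivative 0) (at 0 within {0..})"
  proof -
    have "((\<lambda>y::real. y powr (e - 1)) \<longlongrightarrow> 0) (at 0 within {0..})"
      using e by (intro tendsto_zero_powrI[where b="e - 1"] tendsto_intros tendsto_ident_at) (auto simp: eventually_at_filter)
    moreover have "eventually (\<lambda>y::real. y powr (e - 1) = (y powr e - 0 powr e) / (y - 0)) (at 0 within {0..})"
      unfolding eventually_at_filter by (intro always_eventually) (auto simp: powr_diff)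
    ultimately show ?thesis unfolding has_field_derivative_iff by (rule Lim_transform_eventually)
  qed
  have P0c: "(\<Sum>j\<in>UNIV. P 0 $ i $ j * c$j) = c$i" for i
    unfolding P0 mat_def by (simp add: mult_delta_left sum.delta)
  have \<psi>0: "\<psi> i 0 = 0" for i unfolding \<psi>_def P0c by simp
  have "(\<psi> i has_real_derivative
      ((1 + u$i * 0 + C * 0 powr e) * (\<Sum>j\<in>UNIV. \<Gamma> $ i $ j * c$j) + (u$i + C * 0) * (\<Sum>j\<in>UNIV. P 0 $ i $ j * c$j)) - (- a) * c$i) (at 0 within {0..})" for i
    unfolding \<psi>_def
    by (rule derivative_eq_intros comp pw refl | simp)+
  moreover have "((1 + u$i * 0 + C * 0 powr e) * (\<Sum>j\<in>UNIV. \<Gamma> $ i $ j * c$j) + (u$i + C * 0) * (\<Sum>j\<in>UNIV. P 0 $ i $ j * c$j)) - (- a) * c$i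
     = ((\<Gamma> + diag u) *v c)$i + a * c$i" for i
    unfolding P0c
    by (simp add: matrix_vector_mult_def diag_def distrib_right sum.distrib mult_delta_left sum.delta)
  ultimately have der: "(\<psi> i has_real_derivative (((\<Gamma> + diag u) *v c)$i + a * c$i)) (at 0 within {0..})" for i
    by metis
  have "\<exists>d>0. \<forall>y>0. y < d \<longrightarrow> \<psi> i y < 0" for i
    using has_real_derivative_neg_dec_right[OF der[of i]] c(2)[of i] \<psi>0 by auto
  then obtain d where d: "\<And>i. 0 < d i" "\<And>i y. 0 < y \<Longrightarrow> y < d i \<Longrightarrow> \<psi> i y < 0" by metis
  define D where "D = min 1 (Min (range d) / 2)"
  have "0 < Min (range d)" using d(1) by simp
  then have D: "0 < D" "D \<le> 1" "\<And>i. D < d i"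
  proof -
    show "D < d i" for i
    proof -
      have "Min (range d) \<le> d i" by (rule Min_le) auto
      then show ?thesis using \<open>0 < Min (range d)\<close> unfolding D_def by linarith
    qed
  qed (auto simp: D_def)
  show ?thesis
  proof (rule that[OF D(1,2)])
    fix \<Delta> :: real and i assume \<Delta>: "0 < \<Delta>" "\<Delta> \<le> D"
    have "\<psi> i \<Delta> < 0" using d(2) \<Delta> D(3)[of i] by simp
    moreover have "1 - a * \<Delta> \<le> exp (- a * \<Delta>)" using exp_ge_add_one_self[of "- a * \<Delta>"] by simp
    then have "(1 - a * \<Delta>) * c$i \<le> exp (- a * \<Delta>) * c$i" using c(1)[of i] by (intro mult_right_mono) auto
    ultimately have "(1 + u$i * \<Delta> + C * \<Delta> powr e) * (\<Sum>j\<in>UNIV. P \<Delta> $ i $ j * c$j) \<le> exp (- a * \<Delta>) * c$i"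
      unfolding \<psi>_def by linarith
    then show "max 0 (1 + u$i * \<Delta> + C * \<Delta> powr e) * (\<Sum>j\<in>UNIV. P \<Delta> $ i $ j * c$j) \<le> exp (- a * \<Delta>) * c$i"
      using c(1)[of i] by (auto simp: max_def)
  qed
qed


section \<open>Exponential decay of moments\<close>

context usual_filtered_prob_space
begin

text \<open>
  The weights \<open>c\<close> turn the system of inequalities for \<open>E(v(Z\<^sub>k); r\<^sub>k = i)\<close> into a scalar one that
  contracts by \<open>\<kappa>\<close> in each step.
\<close>

lemma tem_moment_decay:
  fixes B :: "real \<Rightarrow> 'a \<Rightarrow> real^'d" and r :: "real \<Rightarrow> 'a \<Rightarrow> 's::finite" and \<Gamma> :: "real^'s^'s"
    and f :: "real^'n \<Rightarrow> 's \<Rightarrow> real^'n" and g :: "real^'n \<Rightarrow> 's \<Rightarrow> real^'d^'n"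
    and v :: "real^'n \<Rightarrow> real" and c :: "real^'s"
  assumes B: "brownian_motion B" and r: "markov_chain \<Gamma> r" and Br: "indep_processes B r"
    and P: "\<And>s j. 0 \<le> s \<Longrightarrow> AE \<omega> in M. real_cond_exp M (F s)
              (indicator {\<omega> \<in> space M. r (s + \<Delta>) \<omega> = j}) \<omega> = p (r s \<omega>) j"
    and \<Delta>: "0 < \<Delta>"
    and fm: "\<And>i. (\<lambda>x. f x i) \<in> borel_measurable borel"
    and gm: "\<And>i. (\<lambda>x. g x i) \<in> borel_measurable borel"
    and v: "v \<in> borel_measurable borel" and v0: "\<And>x. 0 \<le> v x"
    and shrink: "\<And>i x. v (truncate (\<phi>inv i (h \<Delta>)) x) \<le> v x"
    and m0: "\<And>i. 0 \<le> m i"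
    and step: "\<And>k i x z. z = truncate (\<phi>inv i (h \<Delta>)) x \<Longrightarrow>
       (\<integral>\<^sup>+\<omega>. ennreal (v (z + \<Delta> *\<^sub>R f z i + g z i *v (B (real (Suc k) * \<Delta>) \<omega> - B (real k * \<Delta>) \<omega>))) \<partial>M)
         \<le> ennreal (m i * v z)"
    and c: "\<And>i. 0 < c$i" and contr: "\<And>i. m i * (\<Sum>j\<in>UNIV. p i j * c$j) \<le> \<kappa> * c$i"
    and \<kappa>: "0 \<le> \<kappa>"
  shows "(\<integral>\<^sup>+\<omega>. ennreal (v (tem f g \<phi>inv h B r x\<^sub>0 \<Delta> k \<omega>)) \<partial>M)
    \<le> ennreal ((\<Sum>j\<in>UNIV. c$j) / Min (range (\<lambda>j. c$j)) * v x\<^sub>0 * \<kappa> ^ k)"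
proof -
  define Z where "Z = tem f g \<phi>inv h B r x\<^sub>0 \<Delta>"
  define U where "U k j = (\<integral>\<omega>. v (Z k \<omega>) * state_ind r (real k * \<Delta>) j \<omega> \<partial>M)" for k j
  note BM = B_measurable[OF B r Br] and rM = r_measurable[OF B r Br]
  have rk: "r (real k * \<Delta>) \<in> measurable M (count_space UNIV)" for k using rM \<Delta> by simp
  have sk [measurable]: "state_ind r (real k * \<Delta>) j \<in> borel_measurable M" for k j
    by (rule state_ind_measurable[where r=r, OF rk refl])
  have Zm [measurable]: "Z k \<in> borel_measurable M" for k unfolding Z_def
    by (rule tem_measurable(2)[OF fm gm]) (use \<Delta> BM rM in auto)
  note [measurable] = v
  have Z0: "v (Z 0 \<omega>) \<le> v x\<^sub>0" for \<omega> unfolding Z_def tem_def by (simp add: shrink)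
  have int: "integrable M (\<lambda>\<omega>. v (Z k \<omega>))" for k
  proof (induction k)
    case 0
    show ?case by (rule integrable_const_bound[where B="v x\<^sub>0"]) (use Z0 v0 in auto)
  next
    case (Suc k)
    show ?case unfolding Z_def
      by (rule tem_one_step(1)[where p=p and m=m and B=B and r=r and \<Gamma>=\<Gamma> and \<Delta>=\<Delta> and f=f and g=g
        and v=v and \<phi>inv=\<phi>inv and h=h and x\<^sub>0=x\<^sub>0 and k=k, OF B r Br P \<Delta> fm gm v v0 shrink m0 step Suc[unfolded Z_def]])
  qed
  have intj: "integrable M (\<lambda>\<omega>. v (Z k \<omega>) * state_ind r (real k * \<Delta>) j \<omega>)" for k j
  proof (rule Bochner_Integration.integrable_bound[OF int])
    show "(\<lambda>\<omega>. v (Z k \<omega>) * state_ind r (real k * \<Delta>) j \<omega>) \<in> borel_measurable M" by measurable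
  qed (auto simp: state_ind_def indicator_def)
  have U0: "0 \<le> U k j" for k j
    unfolding U_def using v0 by (intro integral_nonneg_AE) (auto simp: state_ind_def)
  have decay: "(\<Sum>j\<in>UNIV. c$j * U k j) \<le> (\<Sum>j\<in>UNIV. c$j) * v x\<^sub>0 * \<kappa> ^ k" for k
  proof (induction k)
    case 0
    have "U 0 j \<le> v x\<^sub>0" for j
    proof -
      have "U 0 j \<le> (\<integral>\<omega>. v x\<^sub>0 \<partial>M)" unfolding U_def
        by (rule integral_mono[OF intj])
           (use Z0 v0 in \<open>auto simp: state_ind_def indicator_def\<close>)
      then show ?thesis by (simp add: prob_space)
    qed
    then have "(\<Sum>j\<in>UNIV. c$j * U 0 j) \<le> (\<Sum>j\<in>UNIV. c$j * v x\<^sub>0)"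
      using c by (intro sum_mono mult_left_mono) (auto simp: less_imp_le)
    then show ?case by (simp add: sum_distrib_right)
  next
    case (Suc k)
    have "U (Suc k) j \<le> (\<Sum>i\<in>UNIV. m i * p i j * U k i)" for j
      unfolding U_def Z_def
      by (rule tem_one_step(2)[where p=p and m=m and B=B and r=r and \<Gamma>=\<Gamma> and \<Delta>=\<Delta> and f=f and g=g
        and v=v and \<phi>inv=\<phi>inv and h=h and x\<^sub>0=x\<^sub>0 and k=k, OF B r Br P \<Delta> fm gm v v0 shrink m0 step int[unfolded Z_def]])
    then have "(\<Sum>j\<in>UNIV. c$j * U (Suc k) j) \<le> (\<Sum>j\<in>UNIV. c$j * (\<Sum>i\<in>UNIV. m i * p i j * U k i))"
      using c by (intro sum_mono mult_left_mono) (auto simp: less_imp_le)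
    also have "\<dots> = (\<Sum>j\<in>UNIV. \<Sum>i\<in>UNIV. (m i * (p i j * c$j)) * U k i)"
      by (simp add: sum_distrib_left ac_simps)
    also have "\<dots> = (\<Sum>i\<in>UNIV. \<Sum>j\<in>UNIV. (m i * (p i j * c$j)) * U k i)" by (rule sum.swap)
    also have "\<dots> = (\<Sum>i\<in>UNIV. (m i * (\<Sum>j\<in>UNIV. p i j * c$j)) * U k i)"
      by (simp add: sum_distrib_left sum_distrib_right)
    also have "\<dots> \<le> (\<Sum>i\<in>UNIV. (\<kappa> * c$i) * U k i)"
      by (intro sum_mono mult_right_mono contr U0)
    also have "\<dots> = \<kappa> * (\<Sum>i\<in>UNIV. c$i * U k i)" by (simp add: sum_distrib_left mult.assoc)
    also have "\<dots> \<le> \<kappa> * ((\<Sum>j\<in>UNIV. c$j) * v x\<^sub>0 * \<kappa> ^ k)" by (rule mult_left_mono[OF Suc \<kappa>])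
    finally show ?case by (simp add: ac_simps)
  qed
  define cm where "cm = Min (range (\<lambda>j. c$j))"
  have cm: "0 < cm" "\<And>j. cm \<le> c$j" unfolding cm_def using c by auto
  have "(\<integral>\<^sup>+\<omega>. ennreal (v (Z k \<omega>)) \<partial>M) = ennreal (\<integral>\<omega>. v (Z k \<omega>) \<partial>M)"
    by (rule nn_integral_eq_integral[OF int]) (simp add: v0)
  also have "(\<integral>\<omega>. v (Z k \<omega>) \<partial>M) = (\<integral>\<omega>. (\<Sum>j\<in>UNIV. v (Z k \<omega>) * state_ind r (real k * \<Delta>) j \<omega>) \<partial>M)"
    by (intro Bochner_Integration.integral_cong refl) (simp add: sum_state_ind)
  also have "\<dots> = (\<Sum>j\<in>UNIV. U k j)" unfolding U_def by (rule Bochner_Integration.integral_sum[OF intj])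
  also have "(\<Sum>j\<in>UNIV. U k j) \<le> (\<Sum>j\<in>UNIV. c$j * U k j / cm)"
  proof (rule sum_mono)
    fix j show "U k j \<le> c$j * U k j / cm"
      using mult_right_mono[OF cm(2)[of j] U0[of k j]] cm(1) by (simp add: pos_le_divide_eq mult.commute)
  qed
  also have "\<dots> = (\<Sum>j\<in>UNIV. c$j * U k j) / cm" by (simp add: sum_divide_distrib)
  also have "\<dots> \<le> (\<Sum>j\<in>UNIV. c$j) * v x\<^sub>0 * \<kappa> ^ k / cm"
    using decay cm(1) by (intro divide_right_mono) auto
  finally show ?thesis unfolding Z_def cm_def by (simp add: ennreal_leI)
qed

end


section \<open>Stability of the scheme\<close>

theorem corollary4p9:
  fixes M :: "'a measure" and F :: "real \<Rightarrow> 'a measure"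
    and B :: "real \<Rightarrow> 'a \<Rightarrow> real^'d"
    and r :: "real \<Rightarrow> 'a \<Rightarrow> 's::finite"
    and \<Gamma> :: "real^'s^'s" and \<pi> \<beta> :: "real^'s"
    and f :: "real^'n \<Rightarrow> 's \<Rightarrow> real^'n" and g :: "real^'n \<Rightarrow> 's \<Rightarrow> real^'d^'n"
    and x\<^sub>0 :: "real^'n" and l :: 's
    and \<phi> :: "'s \<Rightarrow> real \<Rightarrow> real" and \<phi>inv :: "'s \<Rightarrow> real \<Rightarrow> ereal" and h :: "real \<Rightarrow> real"
    and Q :: "real^'n^'n" and \<rho> p \<epsilon> :: real and pstar :: ereal
  assumes "usual_filtered_prob_space M F"
    and "usual_filtered_prob_space.brownian_motion M F B"
    and "usual_filtered_prob_space.markov_chain M F \<Gamma> r"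
    and "usual_filtered_prob_space.indep_processes M B r"
    and "AE \<omega> in M. r 0 \<omega> = l"
    and "irreducible_with_stationary \<Gamma> \<pi>"
    and "\<forall>i R. \<exists>L. L-lipschitz_on (cball 0 R) (\<lambda>x. f x i)"
    and "\<forall>i R. \<exists>L. L-lipschitz_on (cball 0 R) (\<lambda>x. g x i)"
    and "\<forall>i. truncation_control (\<lambda>x. f x i) (\<lambda>x. g x i) (\<phi> i) (\<phi>inv i)"
    and "stepsize_control f g \<phi> x\<^sub>0 h"
    and "\<forall>i. f 0 i = 0" and "\<forall>i. g 0 i = 0"
    and "0 < \<rho>" and "sym_pos_def Q"
    and "\<forall>x i. (x \<bullet> (Q *v x)) * psi Q f g x i - (2 - \<rho>) * (norm ((x v* Q) v* g x i))\<^sup>2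
           \<le> \<beta> $ i * (x \<bullet> (Q *v x))\<^sup>2"
    and "(\<Sum>i\<in>UNIV. \<pi> $ i * \<beta> $ i) < 0"
    and "is_pstar \<Gamma> \<beta> pstar"
    and "0 < p" and "ereal p < pstar" and "p \<le> \<rho>"
    and "0 < \<epsilon>" and "\<epsilon> < eta \<Gamma> p \<beta>"
  shows "\<exists>D\<in>{0<..1}. \<forall>\<Delta>\<in>{0<..D}.
      limsup (\<lambda>k. elog (\<integral>\<^sup>+ \<omega>. ennreal (norm (tem f g \<phi>inv h B r x\<^sub>0 \<Delta> k \<omega>) powr p) \<partial>M)
                    / ereal (real k * \<Delta>)) \<le> ereal (- (eta \<Gamma> p \<beta> - \<epsilon>))
    \<and> - (eta \<Gamma> p \<beta> - \<epsilon>) < 0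
    \<and> (AE \<omega> in M.
        limsup (\<lambda>k. elog (ennreal (norm (tem f g \<phi>inv h B r x\<^sub>0 \<Delta> k \<omega>)))
                    / ereal (real k * \<Delta>)) \<le> ereal (- (eta \<Gamma> p \<beta> - \<epsilon>) / p))"
proof -
  interpret usual_filtered_prob_space M F by (rule assms(1))
  have B: "brownian_motion B" and r: "markov_chain \<Gamma> r" and Br: "indep_processes B r"
    using assms(2,3,4) .
  obtain P where PP: "transition_semigroup \<Gamma> P \<and> (\<forall>s\<ge>0. \<forall>t\<ge>0. \<forall>j. AE \<omega> in M.
      real_cond_exp M (F s) (indicator {\<omega> \<in> space M. r (s + t) \<omega> = j}) \<omega> = P t $ (r s \<omega>) $ j)"
    using r[unfolded markov_chain_def, THEN conjunct2, THEN conjunct2, THEN conjunct2] by (rule exE)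
  note P = PP[THEN conjunct1] and Pr = PP[THEN conjunct2, rule_format]
  define q where "q = p / 2"
  have q: "0 < q" unfolding q_def using assms(18) by simp
  \<comment> \<open>Half of \<open>\<epsilon>\<close> goes into the subeigenvector, the other half into passing from moments to paths.\<close>
  define a where "a = eta \<Gamma> p \<beta> - \<epsilon> / 2"
  define b where "b = eta \<Gamma> p \<beta> - \<epsilon>"
  have ba: "b < a" unfolding a_def b_def using assms(21) by simp
  have off: "0 \<le> (\<Gamma> + (p / 2) *\<^sub>R diag \<beta>) $ i $ j" if "i \<noteq> j" for i j
    using r that unfolding markov_chain_def is_generator_def diag_def by simp
  have "Max (Re ` spectrum (\<Gamma> + (p / 2) *\<^sub>R diag \<beta>)) < - a"
    unfolding a_def eta_def using assms(21) by simp
  then obtain c where c: "\<And>i. 0 < c$i" "\<And>i. ((\<Gamma> + (p / 2) *\<^sub>R diag \<beta>) *v c)$i < - a * c$i"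
    using metzler_positive_subeigenvector[OF off] by blast
  have "(p / 2) *\<^sub>R diag \<beta> = diag (q *\<^sub>R \<beta>)" unfolding diag_def q_def by (simp add: vec_eq_iff)
  with c(2) have c2: "\<And>i. ((\<Gamma> + diag (q *\<^sub>R \<beta>)) *v c)$i < - a * c$i" by simp
  obtain \<theta> K where \<theta>: "0 < \<theta>" and K: "0 < K"
    and h1: "\<And>\<Delta> i. 0 < \<Delta> \<Longrightarrow> \<Delta> \<le> 1 \<Longrightarrow> \<phi> i 1 \<le> h \<Delta>"
    and h0: "\<And>\<Delta>. 0 < \<Delta> \<Longrightarrow> \<Delta> \<le> 1 \<Longrightarrow> 0 \<le> h \<Delta>"
    and hK: "\<And>\<Delta>. 0 < \<Delta> \<Longrightarrow> \<Delta> \<le> 1 \<Longrightarrow> h \<Delta> * \<Delta> \<le> K"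
    and h2: "\<And>\<Delta>. 0 < \<Delta> \<Longrightarrow> \<Delta> \<le> 1 \<Longrightarrow> (h \<Delta> * \<Delta>)\<^sup>2 \<le> K\<^sup>2 * \<Delta> powr (1 + 2 * \<theta>)"
    by (rule stepsize_control_bounds[OF assms(9,10)]) (rule that)
  obtain C where C: "0 \<le> C" and Euler:
    "\<And>\<Delta> h z u (G :: real^'d^'n) W. 0 < \<Delta> \<Longrightarrow> 0 \<le> h \<Longrightarrow> h * \<Delta> \<le> K \<Longrightarrow> z \<noteq> 0 \<Longrightarrow>
       norm u \<le> h * norm z \<Longrightarrow> (norm G)\<^sup>2 \<le> h * (norm z)\<^sup>2 \<Longrightarrow> isotropic_gaussian (sqrt \<Delta>) W \<Longrightarrow>
       (\<integral>\<^sup>+\<omega>. ennreal (quad_form Q (z + \<Delta> *\<^sub>R u + G *v W \<omega>) powr q) \<partial>M)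
       \<le> ennreal (quad_form Q z powr q * (1 + q * \<Delta> *
            ((2 * (z \<bullet> (Q *v u)) + trace (transpose G ** Q ** G)) / quad_form Q z
              - (2 - 2 * q) * (norm ((z v* Q) v* G))\<^sup>2 / (quad_form Q z)\<^sup>2) + C * (h * \<Delta>)\<^sup>2))"
    by (rule Euler_step_moment[OF assms(14) q less_imp_le[OF K], where ?'d='d]) (rule that)
  obtain \<kappa> where \<kappa>: "0 < \<kappa>" "\<And>x. \<kappa> * (norm x)\<^sup>2 \<le> quad_form Q x"
    using sym_pos_def_coercive[OF assms(14)] by blast
  have e1: "1 < 1 + 2 * \<theta>" using \<theta> by simp
  obtain D where D: "0 < D" "D \<le> 1" and contr: "\<And>\<Delta> i. 0 < \<Delta> \<Longrightarrow> \<Delta> \<le> D \<Longrightarrow>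
       max 0 (1 + (q *\<^sub>R \<beta>)$i * \<Delta> + (C * K\<^sup>2) * \<Delta> powr (1 + 2 * \<theta>)) * (\<Sum>j\<in>UNIV. P \<Delta> $ i $ j * c$j)
         \<le> exp (- a * \<Delta>) * c$i"
    by (rule transition_contraction[OF P e1 c(1) c2, of "C * K\<^sup>2"]) (rule that)
  have fm: "(\<lambda>x. f x i) \<in> borel_measurable borel" and gm: "(\<lambda>x. g x i) \<in> borel_measurable borel" for i
    using assms(7,8) by (auto intro!: lipschitz_on_cballs_borel_measurable)
  define v where "v x = quad_form Q x powr q" for x
  have v [measurable]: "v \<in> borel_measurable borel"
    unfolding v_def using borel_measurable_continuous_onI[OF continuous_on_quad_form] by measurable
  have v0: "0 \<le> v x" for x unfolding v_def by simp
  \<comment> \<open>The hypothesis divided by \<open>V\<^sup>2\<close>; \<open>2 - 2q = 2 - p\<close> may replace \<open>2 - \<rho>\<close> because \<open>p \<le> \<rho>\<close>.\<close>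
  have drift: "psi Q f g z i / quad_form Q z - (2 - 2 * q) * (norm ((z v* Q) v* g z i))\<^sup>2 / (quad_form Q z)\<^sup>2 \<le> \<beta> $ i"
    if "z \<noteq> 0" for z i
  proof -
    define V where "V = quad_form Q z"
    have V: "0 < V" unfolding V_def by (rule quad_form_pos[OF assms(14) that])
    have "V * psi Q f g z i - (2 - 2 * q) * (norm ((z v* Q) v* g z i))\<^sup>2
        \<le> V * psi Q f g z i - (2 - \<rho>) * (norm ((z v* Q) v* g z i))\<^sup>2"
      unfolding q_def using assms(20) by (intro diff_left_mono mult_right_mono) auto
    also have "\<dots> \<le> \<beta> $ i * V\<^sup>2"
      using assms(15) unfolding V_def quad_form_def by blast
    finally have "(V * psi Q f g z i - (2 - 2 * q) * (norm ((z v* Q) v* g z i))\<^sup>2) / V\<^sup>2 \<le> \<beta> $ i"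
      using V by (simp add: pos_divide_le_eq)
    moreover have "(V * psi Q f g z i - (2 - 2 * q) * (norm ((z v* Q) v* g z i))\<^sup>2) / V\<^sup>2
        = psi Q f g z i / V - (2 - 2 * q) * (norm ((z v* Q) v* g z i))\<^sup>2 / V\<^sup>2"
      using V by (simp add: diff_divide_distrib power2_eq_square)
    ultimately show ?thesis unfolding V_def by simp
  qed
  show ?thesis
  proof (intro bexI[of _ D] ballI)
    show "D \<in> {0<..1}" using D by simp
    fix \<Delta> assume "\<Delta> \<in> {0<..D}"
    then have \<Delta>: "0 < \<Delta>" "\<Delta> \<le> D" "\<Delta> \<le> 1" using D by auto
    define Z where "Z = tem f g \<phi>inv h B r x\<^sub>0 \<Delta>"
    define m where "m i = max 0 (1 + (q *\<^sub>R \<beta>)$i * \<Delta> + (C * K\<^sup>2) * \<Delta> powr (1 + 2 * \<theta>))" for i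
    define S where "S = (\<Sum>j\<in>UNIV. c$j) / Min (range (\<lambda>j. c$j)) * v x\<^sub>0"
    have growth: "0 \<le> \<phi>inv i (h \<Delta>)"
       "norm (f (truncate (\<phi>inv i (h \<Delta>)) x) i) \<le> h \<Delta> * norm (truncate (\<phi>inv i (h \<Delta>)) x)"
       "(norm (g (truncate (\<phi>inv i (h \<Delta>)) x) i))\<^sup>2 \<le> h \<Delta> * (norm (truncate (\<phi>inv i (h \<Delta>)) x))\<^sup>2" for i x
      using truncation_control_growth[OF assms(9)[rule_format] _ _ h1[OF \<Delta>(1,3)] h0[OF \<Delta>(1,3)]] assms(11,12)
      by auto
    have shrink: "v (truncate (\<phi>inv i (h \<Delta>)) x) \<le> v x" for i x
    proof -
      obtain t where t: "0 \<le> t" "t \<le> 1" "truncate (\<phi>inv i (h \<Delta>)) x = t *\<^sub>R x"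
        using truncate_eq_scaleR[OF growth(1)] by blast
      have "quad_form Q (t *\<^sub>R x) = t\<^sup>2 * quad_form Q x"
        unfolding quad_form_def by (simp add: matrix_vector_mult_scaleR power2_eq_square)
      moreover have "t\<^sup>2 \<le> 1" using t(1,2) by (simp add: power_le_one)
      ultimately have "quad_form Q (t *\<^sub>R x) \<le> quad_form Q x"
        using quad_form_nonneg[OF assms(14), of x] mult_right_mono[of "t\<^sup>2" 1 "quad_form Q x"] by simp
      then show ?thesis unfolding v_def t(3)
        using q quad_form_nonneg[OF assms(14)] by (intro powr_mono2) auto
    qed
    have W: "isotropic_gaussian (sqrt \<Delta>) (\<lambda>\<omega>. B (real (Suc k) * \<Delta>) \<omega> - B (real k * \<Delta>) \<omega>)" for k
    proof -
      have "0 \<le> real k * \<Delta> \<and> real k * \<Delta> < real (Suc k) * \<Delta>" "real (Suc k) * \<Delta> - real k * \<Delta> = \<Delta>"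
        using \<Delta>(1) by (auto simp: algebra_simps)
      then show ?thesis unfolding isotropic_gaussian_def
        using B[unfolded brownian_motion_def, THEN conjunct2, THEN conjunct2, THEN conjunct2, rule_format,
            of "real k * \<Delta>" "real (Suc k) * \<Delta>"] by (simp only: simp_thms)
    qed
    have step: "(\<integral>\<^sup>+\<omega>. ennreal (v (z + \<Delta> *\<^sub>R f z i + g z i *v (B (real (Suc k) * \<Delta>) \<omega> - B (real k * \<Delta>) \<omega>))) \<partial>M)
        \<le> ennreal (m i * v z)" if z: "z = truncate (\<phi>inv i (h \<Delta>)) x" for z i x k
    proof (cases "z = 0")
      case True
      then show ?thesis using assms(11,12) by (simp add: v_def quad_form_def)
    next
      case False
      have "(\<integral>\<^sup>+\<omega>. ennreal (v (z + \<Delta> *\<^sub>R f z i + g z i *v (B (real (Suc k) * \<Delta>) \<omega> - B (real k * \<Delta>) \<omega>))) \<partial>M)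
        \<le> ennreal (quad_form Q z powr q * (1 + q * \<Delta> *
            ((2 * (z \<bullet> (Q *v f z i)) + trace (transpose (g z i) ** Q ** g z i)) / quad_form Q z
              - (2 - 2 * q) * (norm ((z v* Q) v* g z i))\<^sup>2 / (quad_form Q z)\<^sup>2) + C * (h \<Delta> * \<Delta>)\<^sup>2))"
        unfolding v_def
        by (rule Euler[OF \<Delta>(1) h0[OF \<Delta>(1,3)] hK[OF \<Delta>(1,3)] False _ _ W]) (use growth z in auto)
      also have "\<dots> \<le> ennreal (m i * v z)"
      proof (rule ennreal_leI)
        have "1 + q * \<Delta> * (psi Q f g z i / quad_form Q z
              - (2 - 2 * q) * (norm ((z v* Q) v* g z i))\<^sup>2 / (quad_form Q z)\<^sup>2) + C * (h \<Delta> * \<Delta>)\<^sup>2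
          \<le> 1 + q * \<Delta> * \<beta> $ i + C * (K\<^sup>2 * \<Delta> powr (1 + 2 * \<theta>))"
          using q \<Delta>(1) C by (intro add_mono mult_left_mono drift[OF False] h2[OF \<Delta>(1,3)]) auto
        also have "\<dots> \<le> m i" unfolding m_def by (simp add: ac_simps)
        finally show "quad_form Q z powr q * (1 + q * \<Delta> *
            ((2 * (z \<bullet> (Q *v f z i)) + trace (transpose (g z i) ** Q ** g z i)) / quad_form Q z
              - (2 - 2 * q) * (norm ((z v* Q) v* g z i))\<^sup>2 / (quad_form Q z)\<^sup>2) + C * (h \<Delta> * \<Delta>)\<^sup>2) \<le> m i * v z"
          unfolding v_def psi_def mult.commute[of "m i"] by (intro mult_left_mono) auto
      qed
      finally show ?thesis .
    qed
    have vdecay: "(\<integral>\<^sup>+\<omega>. ennreal (v (Z k \<omega>)) \<partial>M) \<le> ennreal (S * exp (- a * \<Delta>) ^ k)" for k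
      unfolding Z_def S_def
    proof (rule tem_moment_decay[where p="\<lambda>i j. P \<Delta> $ i $ j" and m=m and B=B and r=r and \<Gamma>=\<Gamma> and \<Delta>=\<Delta>
          and f=f and g=g and v=v and \<phi>inv=\<phi>inv and h=h, OF B r Br _ \<Delta>(1) fm gm v v0 shrink _ _ c(1)])
      show "AE \<omega> in M. real_cond_exp M (F s) (indicator {\<omega> \<in> space M. r (s + \<Delta>) \<omega> = j}) \<omega> = P \<Delta> $ (r s \<omega>) $ j"
        if "0 \<le> s" for s j by (rule Pr[OF that less_imp_le[OF \<Delta>(1)]])
      show "0 \<le> m i" for i unfolding m_def by simp
      show "m i * (\<Sum>j\<in>UNIV. P \<Delta> $ i $ j * c $ j) \<le> exp (- a * \<Delta>) * c $ i" for i
        unfolding m_def by (rule contr[OF \<Delta>(1,2)])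
      show "(\<integral>\<^sup>+\<omega>. ennreal (v (z + \<Delta> *\<^sub>R f z i + g z i *v (B (real (Suc k) * \<Delta>) \<omega> - B (real k * \<Delta>) \<omega>))) \<partial>M)
        \<le> ennreal (m i * v z)" if "z = truncate (\<phi>inv i (h \<Delta>)) x" for k i x z
        by (rule step[OF that])
    qed (rule exp_ge_zero)
    have S: "0 \<le> S" unfolding S_def using c(1) v0
      by (intro mult_nonneg_nonneg divide_nonneg_nonneg sum_nonneg) (auto simp: less_imp_le)
    have Zm: "Z k \<in> borel_measurable M" for k unfolding Z_def
      by (rule tem_measurable(2)[OF fm gm])
         (use \<Delta>(1) B_measurable[OF B r Br] r_measurable[OF B r Br] in auto)
    note [measurable] = Zm
    have moment: "(\<integral>\<^sup>+\<omega>. ennreal (norm (Z k \<omega>) powr p) \<partial>M)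
        \<le> ennreal (((1 / \<kappa>) powr q * S) * exp (- a * (real k * \<Delta>)))" for k
    proof -
      have "(\<integral>\<^sup>+\<omega>. ennreal (norm (Z k \<omega>) powr p) \<partial>M) \<le> (\<integral>\<^sup>+\<omega>. ennreal ((1 / \<kappa>) powr q) * ennreal (v (Z k \<omega>)) \<partial>M)"
        using norm_powr_le_quad_form[OF \<kappa> assms(18)]
        by (intro nn_integral_mono) (auto simp: v_def q_def ennreal_mult[symmetric] intro: ennreal_leI)
      also have "\<dots> = ennreal ((1 / \<kappa>) powr q) * (\<integral>\<^sup>+\<omega>. ennreal (v (Z k \<omega>)) \<partial>M)"
        by (rule nn_integral_cmult) measurable
      also have "\<dots> \<le> ennreal ((1 / \<kappa>) powr q) * ennreal (S * exp (- a * \<Delta>) ^ k)"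
        by (intro mult_left_mono vdecay) auto
      also have "\<dots> = ennreal (((1 / \<kappa>) powr q * S) * exp (- a * (real k * \<Delta>)))"
        using S by (simp add: ennreal_mult[symmetric] exp_of_nat_mult[symmetric] ac_simps)
      finally show ?thesis .
    qed
    have KS: "0 \<le> (1 / \<kappa>) powr q * S" using S by simp
    show "limsup (\<lambda>k. elog (\<integral>\<^sup>+ \<omega>. ennreal (norm (tem f g \<phi>inv h B r x\<^sub>0 \<Delta> k \<omega>) powr p) \<partial>M)
                    / ereal (real k * \<Delta>)) \<le> ereal (- (eta \<Gamma> p \<beta> - \<epsilon>))
    \<and> - (eta \<Gamma> p \<beta> - \<epsilon>) < 0
    \<and> (AE \<omega> in M.
        limsup (\<lambda>k. elog (ennreal (norm (tem f g \<phi>inv h B r x\<^sub>0 \<Delta> k \<omega>)))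
                    / ereal (real k * \<Delta>)) \<le> ereal (- (eta \<Gamma> p \<beta> - \<epsilon>) / p))"
      using exponential_decay_Lyapunov[OF Zm \<Delta>(1) assms(18) ba KS moment] assms(22)
      unfolding Z_def b_def by simp
  qed
qed

end
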